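(* Let $k\ge1$, $\boldsymbol h\in\mathrm{ord}_p(\mathcal O_{\mathcal K}\setminus\{0\})^k$ and $\boldsymbol d,\boldsymbol e\in\mathbb Z^k$ with $\boldsymbol e\ge\boldsymbol d$. Assume $\boldsymbol e-\boldsymbol d\ge\lfloor\boldsymbol h\rfloor$. For each $s=(s_{\boldsymbol m})_{\boldsymbol m\in\mathbb Z_{\ge0}^k}\in J_{\boldsymbol h}^{[\boldsymbol d,\boldsymbol e]}$ there exists a unique $f_s\in\mathcal H_{\boldsymbol h/\mathcal K}$ such that $$f_s-\tilde s_{\boldsymbol m}\in(\Omega_{\boldsymbol m}^{[\boldsymbol d,\boldsymbol e]})\mathcal H_{\boldsymbol h/\mathcal K}\qquad\text{for each }\boldsymbol m\in\mathbb Z_{\ge0}^k,$$ where $\tilde s_{\boldsymbol m}\in\mathcal O_{\mathcal K}[[X_1,\dots,X_k]]\otimes_{\mathcal O_{\mathcal K}}\mathcal K$ is a lift of $s_{\boldsymbol m}$. Further, $s\mapsto f_s$ is an isomorphism of $\mathcal O_{\mathcal K}[[X_1,\dots,X_k]]\otimes_{\mathcal O_{\mathcal K}}\mathcal K$-modules $J_{\boldsymbol h}^{[\boldsymbol d,\boldsymbol e]}\xrightarrow{\sim}\mathcal H_{\boldsymbol h/\mathcal K}$, and via this isomorphism $$\{f\in\mathcal H_{\boldsymbol h/\mathcal K}\mid v_{\mathcal H_{\boldsymbol h}}(f)\ge\alpha_{\boldsymbol h}^{[\boldsymbol d,\boldsymbol e]}\}\subset\big(J_{\boldsymbol h}^{[\boldsymbol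 d,\boldsymbol e]}\big)^0\subset\{f\in\mathcal H_{\boldsymbol h/\mathcal K}\mid v_{\mathcal H_{\boldsymbol h}}(f)\ge\beta_{\boldsymbol h}\},$$ where $\alpha_{\boldsymbol h}^{[\boldsymbol d,\boldsymbol e]}=\sum_{i=1}^k\alpha_{h_i}^{[d_i,e_i]}$, $\beta_{\boldsymbol h}=\sum_{i=1}^k\beta_{h_i}$ with $$\alpha_{h_i}^{[d_i,e_i]}=\Big\lfloor\tfrac{e_i-d_i+1}{p-1}+\max\big\{0,\,h_i-\tfrac{h_i}{\log p}\big(1+\log\tfrac{\log p}{(p-1)h_i}\big)\big\}\Big\rfloor+1\ \text{ if }h_i>0,\qquad \alpha_{h_i}^{[d_i,e_i]}=0\ \text{ if }h_i=0,$$ $$\beta_{h_i}=-\big\lfloor\max\{h_i,\tfrac p{p-1}\}\big\rfloor-1\ \text{ if }h_i>0,\qquad\beta_{h_i}=0\ \text{ if }h_i=0.$$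
   Context: $p$ is a prime, $\mathrm{ord}_p$ is the valuation on $\mathbb C_p$ with $\mathrm{ord}_p(p)=1$, $\mathcal K\subset\mathbb C_p$ is a complete subfield with ring of integers $\mathcal O_{\mathcal K}$. $\log$ in the constants is the real natural logarithm. For each $1\le i\le k$, $u_i$ is a topological generator of $1+2p\mathbb Z_p$. $\langle\boldsymbol a,\boldsymbol b\rangle_k=\sum a_ib_i$; the order on $\mathbb Z^k$ is componentwise; $\lfloor\boldsymbol h\rfloor$ is componentwise. For $x\in\mathrm{ord}_p(\mathcal K^\times)$, $p^{x}$ denotes an element of $\mathcal K$ of valuation $x$ (the choice is irrelevant). For $n\in\mathbb Z_{\ge0}$, $\ell(n)$ is the smallest non-negative integer $m$ with $p^m>n$; $\ell(\boldsymbol n)=(\ell(n_1),\dots,\ell(n_k))$. $\mathcal H_{\boldsymbol h/\mathcal K}$ is the set of $f=\sum a_{\boldsymbol n}X^{\boldsymbol n}\in\mathcal K[[X_1,\dots,X_k]]$ with $v_{\mathcal H_{\boldsymbol h}}(f):=\inf_{\boldsymbol n\in\mathbb Z_{\ge 0}^k}\{\mathrm{ord}_p(a_{\boldsymbol n})+\langle\boldsymbol h,\ell(\boldsymbol n)\rangle_k\}>-\infty$; it is an $\mathcal O_{\mathcal K}[[X_1,\dots,X_k]]\otimes_{\mathcal O_{\mathcal K}}\mathcal K$-module. For $m\ge0$ put $\Omega_m^{[d_i,e_i]}(X_i)=\prod_{j=d_i}^{e_i}\big((1+X_i)^{p^m}-u_i^{jp^m}\big)$, and for $\boldsymbol m\in\mathbb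 Z_{\ge0}^k$ let $(\Omega_{\boldsymbol m}^{[\boldsymbol d,\boldsymbol e]})$ be the ideal of $A:=\mathcal O_{\mathcal K}[[X_1,\dots,X_k]]$ generated by $\Omega_{m_1}^{[d_1,e_1]}(X_1),\dots,\Omega_{m_k}^{[d_k,e_k]}(X_k)$; $(\Omega_{\boldsymbol m}^{[\boldsymbol d,\boldsymbol e]})\mathcal H_{\boldsymbol h/\mathcal K}$ is the submodule generated by products. Define $$J_{\boldsymbol h}^{[\boldsymbol d,\boldsymbol e]}=\Big\{(s_{\boldsymbol m})_{\boldsymbol m}\in\varprojlim_{\boldsymbol m}\Big(\tfrac{A}{(\Omega_{\boldsymbol m}^{[\boldsymbol d,\boldsymbol e]})}\otimes_{\mathcal O_{\mathcal K}}\mathcal K\Big)\ \Big|\ (p^{\langle\boldsymbol h,\boldsymbol m\rangle_k}s_{\boldsymbol m})_{\boldsymbol m}\in\Big(\prod_{\boldsymbol m}\tfrac{A}{(\Omega_{\boldsymbol m}^{[\boldsymbol d,\boldsymbol e]})}\Big)\otimes_{\mathcal O_{\mathcal K}}\mathcal K\Big\}$$ (both modules seen inside $\prod_{\boldsymbol m}(A/(\Omega_{\boldsymbol m}^{[\boldsymbol d,\boldsymbol e]})\otimes\mathcal K)$), and $(J_{\boldsymbol h}^{[\boldsymbol d,\boldsymbol e]})^0$ is the subset with $(p^{\langle\boldsymbol h,\boldsymbol m\rangle_k}s_{\boldsymbol m})_{\boldsymbol m}\in\prod_{\boldsymbol m}A/(\Omega_{\boldsymbol m}^{[\boldsymbol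 d,\boldsymbol e]})$. *)

theory Defs
  imports
    "HOL-Analysis.Elementary_Metric_Spaces"
    "HOL-Library.Extended_Real"
    "HOL-Computational_Algebra.Primes"
    "HOL-Algebra.Module"
    "HOL-Algebra.QuotRing"
    "HOL-Algebra.Algebraic_Closure_Type"
begin

section \<open>The field of $p$-adic complex numbers\<close>

text \<open>
  The type \<open>'c\<close> is complete as a metric space. \<open>\<rat>\<close> is the prime field of \<open>'c\<close>, so its closure is
  the completion of the rationals, i.e. the field of $p$-adic numbers.
\<close>

definition padic_rationals :: "'c::{field_char_0, complete_space} set"
  where "padic_rationals = closure \<rat>"

text \<open>
  The predicate says that \<open>'c\<close>, with the valuation \<open>ord\<close> normalised by \<open>ord p = 1\<close>, is the
  completion of an algebraic closure \<open>L\<close> of the field of $p$-adic numbers. The metric is the one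
  given by the absolute value \<open>p powr (- ord x)\<close>, and \<open>ord 0 = \<infinity>\<close>.
\<close>

locale padic_complex_field =
  fixes p :: nat and ord :: "'c::{field_char_0, complete_space} \<Rightarrow> ereal"
  assumes prime_p: "prime p"
    and ord_eq_infinity_iff: "ord x = \<infinity> \<longleftrightarrow> x = 0"
    and ord_not_minus_infinity: "ord x \<noteq> - \<infinity>"
    and ord_mult: "ord (x * y) = ord x + ord y"
    and ord_add: "min (ord x) (ord y) \<le> ord (x + y)"
    and ord_p: "ord (of_nat p) = 1"
    and dist_eq_ord:
      "dist x y = (if x = y then 0 else real p powr (- real_of_ereal (ord (x - y))))"
    and dense_algebraic_closure:
      "\<exists>L. algebraic_closure (ring_of_type_algebra\<lparr>carrier := L\<rparr>) (padic_rationals :: 'c set) \<and>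
           closure L = UNIV"

definition padic_integers :: "('c::{field_char_0, complete_space} \<Rightarrow> ereal) \<Rightarrow> 'c set"
  where "padic_integers ord = {x \<in> padic_rationals. 0 \<le> ord x}"

definition principal_units :: "nat \<Rightarrow> ('c::{field_char_0, complete_space} \<Rightarrow> ereal) \<Rightarrow> 'c set"
  where "principal_units p ord = {1 + 2 * of_nat p * x |x. x \<in> padic_integers ord}"

definition topological_generator :: "'c::{field, topological_space} \<Rightarrow> 'c set \<Rightarrow> bool"
  where "topological_generator u G \<longleftrightarrow> u \<in> G \<and> G \<subseteq> closure (range (\<lambda>n::int. u powi n))"

definition valuation_ring :: "('c \<Rightarrow> ereal) \<Rightarrow> 'c set \<Rightarrow> 'c set"
  where "valuation_ring ord K = {x \<in> K. 0 \<le> ord x}"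

definition elt_of_ord :: "('c \<Rightarrow> ereal) \<Rightarrow> 'c set \<Rightarrow> real \<Rightarrow> 'c"
  where "elt_of_ord ord K x = (SOME c. c \<in> K \<and> ord c = ereal x)"


section \<open>Multivariate formal power series\<close>

text \<open>
  The variables are indexed by the finite type \<open>'k\<close>; a multi-index is a function \<open>'k \<Rightarrow> nat\<close>.
\<close>

typedef ('k, 'a) mfps = "UNIV :: (('k \<Rightarrow> nat) \<Rightarrow> 'a) set"
  morphisms mcoeff Abs_mfps ..

setup_lifting type_definition_mfps

lemma mfps_eqI: "(\<And>n. mcoeff f n = mcoeff g n) \<Longrightarrow> f = g"
  by transfer auto

lemma finite_atMost_multiindex [simp]: "finite {..n :: 'k::finite \<Rightarrow> nat}"
proof -
  have "{..n} = PiE UNIV (\<lambda>i. {..n i})"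
    by (auto simp: le_fun_def PiE_def Pi_def)
  then show ?thesis by (simp add: finite_PiE)
qed

instantiation mfps :: (finite, comm_ring_1) comm_ring_1
begin

lift_definition zero_mfps :: "('a, 'b) mfps" is "\<lambda>_. 0" .
lift_definition one_mfps :: "('a, 'b) mfps" is "\<lambda>n. if n = (\<lambda>_. 0) then 1 else 0" .
lift_definition plus_mfps :: "('a, 'b) mfps \<Rightarrow> ('a, 'b) mfps \<Rightarrow> ('a, 'b) mfps"
  is "\<lambda>f g n. f n + g n" .
lift_definition minus_mfps :: "('a, 'b) mfps \<Rightarrow> ('a, 'b) mfps \<Rightarrow> ('a, 'b) mfps"
  is "\<lambda>f g n. f n - g n" .
lift_definition uminus_mfps :: "('a, 'b) mfps \<Rightarrow> ('a, 'b) mfps"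
  is "\<lambda>f n. - f n" .
lift_definition times_mfps :: "('a, 'b) mfps \<Rightarrow> ('a, 'b) mfps \<Rightarrow> ('a, 'b) mfps"
  is "\<lambda>f g n. \<Sum>i\<in>{..n}. f i * g (\<lambda>x. n x - i x)" .

instance
proof
  fix f g h :: "('a, 'b) mfps"
  show "f * g * h = f * (g * h)"
  proof (transfer, rule ext)
    fix f g h :: "('a \<Rightarrow> nat) \<Rightarrow> 'b" and n :: "'a \<Rightarrow> nat"
    have "(\<Sum>a\<in>{..n}. (\<Sum>b\<in>{..a}. f b * g (\<lambda>x. a x - b x)) * h (\<lambda>x. n x - a x)) =
        (\<Sum>(a, b)\<in>(SIGMA a:{..n}. {..a}). f b * g (\<lambda>x. a x - b x) * h (\<lambda>x. n x - a x))"
      by (simp add: sum.Sigma sum_distrib_right)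
    also have "\<dots> = (\<Sum>(b, c)\<in>(SIGMA b:{..n}. {..(\<lambda>x. n x - b x)}).
        f b * (g c * h (\<lambda>x. n x - b x - c x)))"
    proof (rule sum.reindex_bij_witness[where i = "\<lambda>(b, c). (\<lambda>x. b x + c x, b)"
            and j = "\<lambda>(a, b). (b, \<lambda>x. a x - b x)"], goal_cases)
      case (1 ab) then show ?case by (auto simp: le_fun_def)
    next
      case (2 ab) then show ?case
        by (auto simp: le_fun_def) (meson le_trans diff_le_mono)+
    next
      case (3 bc) then show ?case by (auto simp: le_fun_def)
    next
      case (4 bc) then show ?case
        by (auto simp: le_fun_def) (metis le_add_diff_inverse nat_add_left_cancel_le)
    next
      case (5 ab) then show ?case
        by (auto simp: le_fun_def mult.assoc)
    qed
    also have "\<dots> = (\<Sum>b\<in>{..n}. f b * (\<Sum>c\<in>{..(\<lambda>x. n x - b x)}. g c * h (\<lambda>x. n x - b x - c x)))"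
      by (simp add: sum.Sigma sum_distrib_left)
    finally show "(\<Sum>a\<in>{..n}. (\<Sum>b\<in>{..a}. f b * g (\<lambda>x. a x - b x)) * h (\<lambda>x. n x - a x)) =
        (\<Sum>b\<in>{..n}. f b * (\<Sum>c\<in>{..(\<lambda>x. n x - b x)}. g c * h (\<lambda>x. n x - b x - c x)))" .
  qed
  show "f * g = g * f"
  proof (transfer, rule ext)
    fix f g :: "('a \<Rightarrow> nat) \<Rightarrow> 'b" and n :: "'a \<Rightarrow> nat"
    show "(\<Sum>i\<in>{..n}. f i * g (\<lambda>x. n x - i x)) = (\<Sum>i\<in>{..n}. g i * f (\<lambda>x. n x - i x))"
      by (rule sum.reindex_bij_witness[where i = "\<lambda>i x. n x - i x" and j = "\<lambda>i x. n x - i x"])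
        (auto simp: le_fun_def mult.commute)
  qed
  show "1 * f = f"
  proof (transfer, rule ext)
    fix f :: "('a \<Rightarrow> nat) \<Rightarrow> 'b" and n :: "'a \<Rightarrow> nat"
    have "(\<Sum>i\<in>{..n}. (if i = (\<lambda>_. 0) then 1 else 0) * f (\<lambda>x. n x - i x)) =
        (\<Sum>i\<in>{..n}. if i = (\<lambda>_. 0) then f n else 0)"
      by (rule sum.cong) auto
    also have "\<dots> = f n" by (simp add: le_fun_def)
    finally show "(\<Sum>i\<in>{..n}. (if i = (\<lambda>_. 0) then 1 else 0) * f (\<lambda>x. n x - i x)) = f n" .
  qed
  show "(f + g) * h = f * h + g * h"
    by transfer (simp add: sum.distrib distrib_right)
  show "f + g + h = f + (g + h)" by transfer (simp add: add.assoc)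
  show "f + g = g + f" by transfer (simp add: add.commute)
  show "0 + f = f" by transfer simp
  show "- f + f = 0" by transfer simp
  show "f - g = f + - g" by transfer simp
  show "(0 :: ('a, 'b) mfps) \<noteq> 1" by transfer (metis zero_neq_one)
qed

end

lift_definition mconst :: "'a::zero \<Rightarrow> ('k, 'a) mfps"
  is "\<lambda>c n. if n = (\<lambda>_. 0) then c else 0" .

lift_definition mvar :: "'k \<Rightarrow> ('k, 'a::zero_neq_one) mfps"
  is "\<lambda>i n. if n = (\<lambda>j. if j = i then 1 else 0) then 1 else 0" .

definition mfps_over :: "'a set \<Rightarrow> ('k, 'a) mfps set"
  where "mfps_over S = {f. \<forall>n. mcoeff f n \<in> S}"


section \<open>Module isomorphisms\<close>

definition module_iso ::
    "('r, 'x) ring_scheme \<Rightarrow> ('r, 'm, 'y) module_scheme \<Rightarrow> ('r, 'n, 'z) module_scheme \<Rightarrow>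
      ('m \<Rightarrow> 'n) \<Rightarrow> bool"
  where "module_iso R M N f \<longleftrightarrow>
    module R M \<and> module R N \<and> bij_betw f (carrier M) (carrier N) \<and>
    (\<forall>x\<in>carrier M. \<forall>y\<in>carrier M. f (x \<oplus>\<^bsub>M\<^esub> y) = f x \<oplus>\<^bsub>N\<^esub> f y) \<and>
    (\<forall>a\<in>carrier R. \<forall>x\<in>carrier M. f (a \<odot>\<^bsub>M\<^esub> x) = a \<odot>\<^bsub>N\<^esub> f x)"


section \<open>The modules of the interpolation problem\<close>

definition ell :: "nat \<Rightarrow> nat \<Rightarrow> nat"
  where "ell p n = (LEAST m. n < p ^ m)"

definition Omega ::
    "nat \<Rightarrow> 'c \<Rightarrow> int \<Rightarrow> int \<Rightarrow> nat \<Rightarrow> 'k::finite \<Rightarrow> ('k, 'c::field) mfps"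
  where "Omega p u d e m i =
    (\<Prod>j\<in>{d..e}. (1 + mvar i) ^ (p ^ m) - mconst (u powi (j * int (p ^ m))))"

context
  fixes p :: nat
    and ord :: "'c::{field_char_0, complete_space} \<Rightarrow> ereal"
    and K :: "'c set"
begin

definition Iw :: "('k::finite, 'c) mfps ring"
  where "Iw = ring_of_type_algebra\<lparr>carrier := mfps_over (valuation_ring ord K)\<rparr>"

text \<open>
  As \<open>K\<close> is the field of fractions of its valuation ring \<open>O\<close> and power series over \<open>O\<close> are
  torsion-free, the tensor product of \<open>carrier Iw\<close> with \<open>K\<close> over \<open>O\<close> is the following ring of
  power series over \<open>K\<close>.
\<close>

definition IwK :: "('k::finite, 'c) mfps ring"
  where "IwK = ring_of_type_algebra\<lparr>carrier := {mconst c * f |c f. c \<in> K \<and> f \<in> carrier Iw}\<rparr>"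

context
  fixes h :: "'k::finite \<Rightarrow> real"
begin

definition vH :: "('k, 'c) mfps \<Rightarrow> ereal"
  where "vH f = (INF n. ord (mcoeff f n) + ereal (\<Sum>i\<in>UNIV. h i * real (ell p (n i))))"

definition H_set :: "('k, 'c) mfps set"
  where "H_set = {f \<in> mfps_over K. - \<infinity> < vH f}"

text \<open>The fields \<open>mult\<close> and \<open>one\<close> of a module record play no role.\<close>

definition H_module :: "(('k, 'c) mfps, ('k, 'c) mfps) module"
  where "H_module = \<lparr>carrier = H_set, monoid.mult = (*), one = 1, zero = 0, add = (+), module.smult = (*)\<rparr>"

end

context
  fixes u :: "'k::finite \<Rightarrow> 'c" and d e :: "'k \<Rightarrow> int"
begin

definition Omega_ideal :: "('k \<Rightarrow> nat) \<Rightarrow> ('k, 'c) mfps set"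
  where "Omega_ideal m = Idl\<^bsub>Iw\<^esub> (range (\<lambda>i. Omega p (u i) (d i) (e i) (m i) i))"

definition Omega_idealK :: "('k \<Rightarrow> nat) \<Rightarrow> ('k, 'c) mfps set"
  where "Omega_idealK m = Idl\<^bsub>IwK\<^esub> (Omega_ideal m)"

text \<open>
  The tensor product of \<open>Iw Quot Omega_ideal m\<close> with \<open>K\<close>, by right exactness of the tensor product.
\<close>

definition level :: "('k \<Rightarrow> nat) \<Rightarrow> ('k, 'c) mfps set ring"
  where "level m = IwK Quot Omega_idealK m"

definition cls :: "('k \<Rightarrow> nat) \<Rightarrow> ('k, 'c) mfps \<Rightarrow> ('k, 'c) mfps set"
  where "cls m f = Omega_idealK m +>\<^bsub>IwK\<^esub> f"

text \<open>
  An element of \<open>level m\<close> is the set of its lifts to \<open>carrier IwK\<close>; the transition map from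
  \<open>level m'\<close> to \<open>level m\<close> for \<open>m \<le> m'\<close> sends the class of \<open>f\<close> to the class of \<open>f\<close>.
\<close>

definition inverse_limit :: "(('k \<Rightarrow> nat) \<Rightarrow> ('k, 'c) mfps set) set"
  where "inverse_limit =
    {s. (\<forall>m. s m \<in> carrier (level m)) \<and> (\<forall>m m'. m \<le> m' \<longrightarrow> (\<forall>f\<in>s m'. s m = cls m f))}"

definition scale_family ::
    "(('k \<Rightarrow> nat) \<Rightarrow> ('k, 'c) mfps) \<Rightarrow>
      (('k \<Rightarrow> nat) \<Rightarrow> ('k, 'c) mfps set) \<Rightarrow> (('k \<Rightarrow> nat) \<Rightarrow> ('k, 'c) mfps set)"
  where "scale_family g s = (\<lambda>m. cls m (g m) \<otimes>\<^bsub>level m\<^esub> s m)"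

text \<open>
  The images, in the product of all \<open>level m\<close>, of the product of all \<open>Iw Quot Omega_ideal m\<close> and
  of its tensor product with \<open>K\<close>. Finitely many elements of \<open>K\<close> have a common denominator in the
  valuation ring, so every element of this tensor product is a pure tensor.
\<close>

definition integral_families :: "(('k \<Rightarrow> nat) \<Rightarrow> ('k, 'c) mfps set) set"
  where "integral_families = {s. \<exists>a. \<forall>m. a m \<in> carrier Iw \<and> s m = cls m (a m)}"

definition bounded_families :: "(('k \<Rightarrow> nat) \<Rightarrow> ('k, 'c) mfps set) set"
  where "bounded_families = {scale_family (\<lambda>_. mconst c) s |c s. c \<in> K \<and> s \<in> integral_families}"

context
  fixes h :: "'k \<Rightarrow> real"
begin

definition twist ::
    "(('k \<Rightarrow> nat) \<Rightarrow> ('k, 'c) mfps set) \<Rightarrow> (('k \<Rightarrow> nat) \<Rightarrow> ('k, 'c) mfps set)"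
  where "twist = scale_family (\<lambda>m. mconst (elt_of_ord ord K (\<Sum>i\<in>UNIV. h i * real (m i))))"

definition J_set :: "(('k \<Rightarrow> nat) \<Rightarrow> ('k, 'c) mfps set) set"
  where "J_set = {s \<in> inverse_limit. twist s \<in> bounded_families}"

definition J_set0 :: "(('k \<Rightarrow> nat) \<Rightarrow> ('k, 'c) mfps set) set"
  where "J_set0 = {s \<in> J_set. twist s \<in> integral_families}"

definition J_module :: "(('k, 'c) mfps, ('k \<Rightarrow> nat) \<Rightarrow> ('k, 'c) mfps set) module"
  where "J_module =
    \<lparr>carrier = J_set,
     monoid.mult = (\<lambda>s t m. s m \<otimes>\<^bsub>level m\<^esub> t m),
     one = (\<lambda>m. \<one>\<^bsub>level m\<^esub>),
     zero = (\<lambda>m. \<zero>\<^bsub>level m\<^esub>),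
     add = (\<lambda>s t m. s m \<oplus>\<^bsub>level m\<^esub> t m),
     module.smult = (\<lambda>a. scale_family (\<lambda>_. a))\<rparr>"

definition Omega_H :: "('k \<Rightarrow> nat) \<Rightarrow> ('k, 'c) mfps set"
  where "Omega_H m =
    \<Inter>{N. submodule N IwK (H_module h) \<and> {w * f |w f. w \<in> Omega_ideal m \<and> f \<in> H_set h} \<subseteq> N}"

definition interpolates :: "(('k \<Rightarrow> nat) \<Rightarrow> ('k, 'c) mfps set) \<Rightarrow> ('k, 'c) mfps \<Rightarrow> bool"
  where "interpolates s f \<longleftrightarrow> f \<in> H_set h \<and> (\<forall>m. \<forall>t\<in>s m. f - t \<in> Omega_H m)"

definition interpolant :: "(('k \<Rightarrow> nat) \<Rightarrow> ('k, 'c) mfps set) \<Rightarrow> ('k, 'c) mfps"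
  where "interpolant s = (THE f. interpolates s f)"

end

end

end


section \<open>The constants\<close>

definition alpha_const :: "nat \<Rightarrow> real \<Rightarrow> int \<Rightarrow> int \<Rightarrow> int"
  where "alpha_const p h d e =
    (if h > 0 then
       \<lfloor>real_of_int (e - d + 1) / (real p - 1) +
          max 0 (h - h / ln (real p) * (1 + ln (ln (real p) / ((real p - 1) * h))))\<rfloor> + 1
     else 0)"

definition beta_const :: "nat \<Rightarrow> real \<Rightarrow> int"
  where "beta_const p h = (if h > 0 then - \<lfloor>max h (real p / (real p - 1))\<rfloor> - 1 else 0)"

end

theory Submission
  imports Defs
begin

text \<open>
  Let \<open>E = e - d + 1\<close> be the number of interpolation points in one variable, so that the level
  polynomial \<open>P\<close> of level \<open>m\<close> is monic of degree \<open>E * p ^ m\<close>. The proof rests on two bounds for its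
  coefficients.

  Each of the \<open>E\<close> factors of \<open>P\<close> is monic of degree \<open>p ^ m\<close>, and its other coefficients are divisible
  by \<open>p\<close>. Hence the coefficient of \<open>P\<close> at \<open>l\<close> has valuation at least \<open>(degree P - l) * r\<close> for the slope \<open>r = 1 / (p ^ m * (p - 1))\<close>, and the
  recursion for the remainder of \<open>X ^ n\<close> shows that its coefficient at \<open>l\<close> has valuation at least
  \<open>(n - l) * r\<close> (\<open>rem_kernel_bounds\<close>); the quotient obeys a similar bound. As \<open>n * r\<close> outgrows
  \<open>h * ell n\<close>, Weierstrass division extends from polynomials to all series of growth \<open>h\<close>
  (\<open>weier_division\<close>). Minimising \<open>n * r - h * ell n\<close> over \<open>n\<close> gives the constant \<open>\<alpha>\<close>: the remainder
  of level \<open>m\<close> loses at most \<open>h * m + \<alpha>\<close> (\<open>rem_kernel_alpha\<close>).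

  The coefficient at \<open>n\<close> has valuation at least \<open>E * max 0 (m + 1 - ell n)\<close>, because
  \<open>p ^ (m + 1 - ell n)\<close> divides the binomial coefficient \<open>p ^ m choose n\<close> (\<open>level_poly_bound\<close>).
  The assumption on \<open>e - d\<close> means \<open>h < E\<close>, so this smallness beats the growth \<open>h\<close>.

  In several variables one divides successively in all variables. The total remainder \<open>Rem m f\<close>
  vanishes exactly on the submodule generated by the level polynomials, its constants add up over
  the variables, and every class of level \<open>m\<close> contains exactly one reduced polynomial. An element of
  \<open>J\<close> is therefore a family of reduced polynomials \<open>r m\<close>, compatible under reduction, with
  coefficients of valuation at least \<open>c - \<langle>h, m\<rangle>\<close> for some constant \<open>c\<close>.

  Existence. If \<open>m i\<close> is raised by one, \<open>r\<close> changes by a multiple of a level polynomial in \<open>X i\<close>, and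
  division does not increase the size of the cofactor. The second bound then trades, one variable
  after the other, the cost \<open>\<langle>h, m\<rangle>\<close> of the level for the weight \<open>\<langle>h, ell n\<rangle>\<close> of the exponent
  (\<open>compatible_mixed\<close>). So all \<open>r m\<close> lie in the module of growth \<open>h\<close> with the same constant \<open>c\<close>, and
  with respect to the coarser weight \<open>\<langle>E, ell n\<rangle>\<close> they converge along the diagonal. The limit has
  constant \<open>c\<close> and remainders \<open>r m\<close> (\<open>diagonal_limit\<close>, \<open>Rem_diagonal_limit\<close>). For \<open>c = 0\<close> this gives
  the second inclusion, since \<open>\<beta> \<le> 0\<close>.

  Uniqueness. Suppose that all remainders of \<open>f\<close> vanish. The part \<open>low N\<close> of \<open>f\<close> with exponents below
  \<open>N\<close> is its own remainder at level \<open>N\<close>, hence it is minus the remainder of the tail \<open>f - low N\<close>. The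
  tail is small for the weight \<open>E\<close>, and for this weight the remainders of all levels are bounded
  uniformly. So \<open>low N\<close> tends to \<open>0\<close>, and \<open>f = 0\<close> (\<open>Rem_eq_0_imp_eq_0\<close>).

  Thus \<open>f \<mapsto> (Rem m f)\<close> induces a bijection from the series of growth \<open>h\<close> onto \<open>J\<close>. It is linear,
  because \<open>a * f - a * Rem m f\<close> lies in the submodule generated by the level polynomials.
\<close>

section \<open>Valuation bounds and convergent series\<close>

locale complete_subfield = padic_complex_field p ord
  for p :: nat and ord :: "'c::{field_char_0, complete_space} \<Rightarrow> ereal" +
  fixes K :: "'c set"
  assumes subfield_K: "subfield K ring_of_type_algebra"
    and complete_K: "complete K"
begin

text \<open>Lower bounds by real numbers avoid the arithmetic of the extended reals, and \<open>0\<close> satisfies all of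
  them.\<close>

definition vge :: "'c \<Rightarrow> real \<Rightarrow> bool"
  where "vge x r \<longleftrightarrow> ereal r \<le> ord x"

lemma p_gt_1: "1 < p" and p_ge_2: "2 \<le> p" and p_pos [simp]: "0 < p"
  using prime_p prime_gt_1_nat prime_ge_2_nat prime_gt_0_nat by blast+

lemma ord_zero [simp]: "ord 0 = \<infinity>"
  using ord_eq_infinity_iff by blast

lemma ord_one [simp]: "ord 1 = 0"
proof -
  have "ord 1 = ord 1 + ord 1" using ord_mult[of 1 1] by simp
  then show ?thesis
    using ord_eq_infinity_iff[of 1] ord_not_minus_infinity[of 1] by (cases "ord 1") auto
qed

lemma ord_uminus [simp]: "ord (- x) = ord x"
proof -
  have "ord (-1) + ord (-1) = 0" using ord_mult[of "-1" "-1"] by simp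
  then have "ord (-1) = 0"
    by (cases "ord (-1)") auto
  then show ?thesis using ord_mult[of "-1" x] by simp
qed

lemma ord_power: "ord x = ereal r \<Longrightarrow> ord (x ^ n) = ereal (real n * r)"
  by (induction n) (auto simp: ord_mult algebra_simps zero_ereal_def)

lemma ord_p_power: "ord (of_nat p ^ n) = ereal (real n)"
  using ord_power[of "of_nat p" 1 n] ord_p by (simp add: one_ereal_def)

lemma ord_inverse:
  assumes "ord x = ereal r"
  shows "ord (inverse x) = ereal (- r)"
proof -
  have "x \<noteq> 0" using assms by auto
  then have "ord x + ord (inverse x) = 0" using ord_mult[of x "inverse x"] by simp
  then show ?thesis using assms by (cases "ord (inverse x)") (auto simp: zero_ereal_def)
qed

lemma vge_zero [simp]: "vge 0 r"
  by (simp add: vge_def)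

lemma vge_one [simp]: "vge 1 r \<longleftrightarrow> r \<le> 0"
  by (simp add: vge_def zero_ereal_def)

lemma vge_mono: "vge x r \<Longrightarrow> s \<le> r \<Longrightarrow> vge x s"
  unfolding vge_def using order_trans ereal_less_eq(3) by blast

lemma vge_uminus [simp]: "vge (- x) r \<longleftrightarrow> vge x r"
  by (simp add: vge_def)

lemma vge_add: "vge x r \<Longrightarrow> vge y r \<Longrightarrow> vge (x + y) r"
  unfolding vge_def using ord_add[of x y] by (meson min.boundedI order_trans)

lemma vge_diff: "vge x r \<Longrightarrow> vge y r \<Longrightarrow> vge (x - y) r"
  using vge_add[of x r "- y"] by simp

lemma vge_mult: "vge x r \<Longrightarrow> vge y s \<Longrightarrow> vge (x * y) (r + s)"
  unfolding vge_def ord_mult plus_ereal.simps(1)[symmetric] by (rule add_mono)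

lemma vge_mult': "vge x r \<Longrightarrow> vge y s \<Longrightarrow> t \<le> r + s \<Longrightarrow> vge (x * y) t"
  using vge_mult vge_mono by blast

lemma vge_sum: "(\<And>a. a \<in> A \<Longrightarrow> vge (f a) r) \<Longrightarrow> vge (\<Sum>a\<in>A. f a) r"
  by (induction A rule: infinite_finite_induct) (auto intro: vge_add)

lemma vge_of_nat [simp]: "vge (of_nat n) 0"
  by (induction n) (auto intro: vge_add)

lemma vge_of_nat_dvd: "p ^ k dvd n \<Longrightarrow> vge (of_nat n) (real k)"
proof (elim dvdE)
  fix l assume "n = p ^ k * l"
  moreover have "vge (of_nat p ^ k) (real k)" by (simp add: vge_def ord_p_power)
  ultimately show ?thesis using vge_mult'[of "of_nat p ^ k" "real k" "of_nat l" 0] by simp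
qed

lemma vge_all_eq_0: "(\<And>r. vge x r) \<Longrightarrow> x = 0"
proof (rule ccontr)
  assume *: "\<And>r. vge x r" "x \<noteq> 0"
  then obtain r where "ord x = ereal r"
    using ord_eq_infinity_iff[of x] ord_not_minus_infinity[of x] by (cases "ord x") auto
  then show False using *(1)[of "r + 1"] by (simp add: vge_def)
qed

lemma vge_scale_iff: "ord c = ereal s \<Longrightarrow> vge (c * x) r \<longleftrightarrow> vge x (r - s)"
  unfolding vge_def ord_mult by (cases "ord x") auto

lemma vge_imp_dist: "vge (x - y) r \<Longrightarrow> dist x y \<le> real p powr (- r)"
proof (cases "x = y")
  case False
  assume "vge (x - y) r"
  moreover obtain s where "ord (x - y) = ereal s"
    using False ord_eq_infinity_iff[of "x - y"] ord_not_minus_infinity[of "x - y"]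
    by (cases "ord (x - y)") auto
  ultimately show ?thesis using False p_gt_1
    by (simp add: dist_eq_ord vge_def)
qed simp

lemma dist_imp_vge: "dist x y < real p powr (- r) \<Longrightarrow> vge (x - y) r"
proof (cases "x = y")
  case False
  assume *: "dist x y < real p powr (- r)"
  obtain s where "ord (x - y) = ereal s"
    using False ord_eq_infinity_iff[of "x - y"] ord_not_minus_infinity[of "x - y"]
    by (cases "ord (x - y)") auto
  then show ?thesis using False p_gt_1 *
    by (simp add: dist_eq_ord vge_def)
qed simp

lemma
  shows K_0 [simp]: "0 \<in> K" and K_1 [simp]: "1 \<in> K"
    and K_uminus: "x \<in> K \<Longrightarrow> - x \<in> K"
    and K_mult: "x \<in> K \<Longrightarrow> y \<in> K \<Longrightarrow> x * y \<in> K"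
    and K_add: "x \<in> K \<Longrightarrow> y \<in> K \<Longrightarrow> x + y \<in> K"
proof -
  let ?R = "ring_of_type_algebra :: 'c ring"
  interpret R: ring ?R by (rule ring_from_type_algebra)
  note E = subringE[OF subfieldE(1)[OF subfield_K]]
  show "0 \<in> K" "1 \<in> K" "x \<in> K \<Longrightarrow> y \<in> K \<Longrightarrow> x * y \<in> K"
    "x \<in> K \<Longrightarrow> y \<in> K \<Longrightarrow> x + y \<in> K"
    using E(2,3,6,7) by (auto simp: ring_of_type_algebra_def)
  assume x: "x \<in> K"
  have "\<ominus>\<^bsub>?R\<^esub> x = - x"
    by (rule R.minus_equality) (auto simp: ring_of_type_algebra_def)
  then show "- x \<in> K" using E(5)[OF x] by simp
qed

lemma K_diff: "x \<in> K \<Longrightarrow> y \<in> K \<Longrightarrow> x - y \<in> K"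
  using K_add[OF _ K_uminus, of x y] by simp

lemma K_sum: "(\<And>a. a \<in> A \<Longrightarrow> f a \<in> K) \<Longrightarrow> (\<Sum>a\<in>A. f a) \<in> K"
  by (induction A rule: infinite_finite_induct) (auto intro: K_add)

lemma K_prod: "(\<And>a. a \<in> A \<Longrightarrow> f a \<in> K) \<Longrightarrow> (\<Prod>a\<in>A. f a) \<in> K"
  by (induction A rule: infinite_finite_induct) (auto intro: K_mult)

lemma K_power: "x \<in> K \<Longrightarrow> x ^ n \<in> K"
  by (induction n) (auto intro: K_mult)

lemma K_of_nat [simp]: "of_nat n \<in> K"
  by (induction n) (auto intro: K_add)

lemma K_inverse: "x \<in> K \<Longrightarrow> inverse x \<in> K"
proof (cases "x = 0")
  case False
  assume x: "x \<in> K"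
  interpret R: ring "ring_of_type_algebra :: 'c ring" by (rule ring_from_type_algebra)
  have "x \<in> K - {\<zero>\<^bsub>ring_of_type_algebra\<^esub>}"
    using x False by (auto simp: ring_of_type_algebra_def)
  note inv = R.subfield_m_inv[OF subfield_K this]
  have "x * inv\<^bsub>ring_of_type_algebra\<^esub> x = 1"
    using inv(2) by (simp add: ring_of_type_algebra_def)
  then have "inv\<^bsub>ring_of_type_algebra\<^esub> x = inverse x"
    using inverse_unique by metis
  then show ?thesis using inv(1) by auto
qed simp

lemma K_divide: "x \<in> K \<Longrightarrow> y \<in> K \<Longrightarrow> x / y \<in> K"
  by (simp add: divide_inverse K_mult K_inverse)

lemma Rats_subset_K: "\<rat> \<subseteq> K"
proof
  fix x :: 'c assume "x \<in> \<rat>"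
  then obtain a b :: int where x: "x = of_int a / of_int b" by (auto elim: Rats_cases')
  have "of_int n \<in> K" for n by (cases n rule: int_cases2) (auto intro: K_uminus)
  then show "x \<in> K" unfolding x by (intro K_divide)
qed

lemma padic_rationals_subset_K: "padic_rationals \<subseteq> K"
  unfolding padic_rationals_def
  using Rats_subset_K complete_K by (simp add: closure_minimal complete_imp_closed)

text \<open>Convergence is expressed through \<open>ord\<close>, because the algebraic operations of the field carry
  no topological type class.\<close>

definition vanishing :: "(nat \<Rightarrow> 'c) \<Rightarrow> bool"
  where "vanishing a \<longleftrightarrow> (\<forall>r. \<forall>\<^sub>F n in sequentially. vge (a n) r)"

definition vlim :: "(nat \<Rightarrow> 'c) \<Rightarrow> 'c"
  where "vlim s = (THE L. vanishing (\<lambda>n. s n - L))"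

definition vsum :: "(nat \<Rightarrow> 'c) \<Rightarrow> 'c"
  where "vsum a = vlim (\<lambda>N. \<Sum>n<N. a n)"

lemma vanishing_add: "vanishing a \<Longrightarrow> vanishing b \<Longrightarrow> vanishing (\<lambda>n. a n + b n)"
  unfolding vanishing_def
proof
  fix r assume "\<forall>r. \<forall>\<^sub>F n in sequentially. vge (a n) r" "\<forall>r. \<forall>\<^sub>F n in sequentially. vge (b n) r"
  then have "\<forall>\<^sub>F n in sequentially. vge (a n) r" "\<forall>\<^sub>F n in sequentially. vge (b n) r" by blast+
  then show "\<forall>\<^sub>F n in sequentially. vge (a n + b n) r" by eventually_elim (rule vge_add)
qed

lemma vanishing_uminus: "vanishing a \<Longrightarrow> vanishing (\<lambda>n. - a n)"
  unfolding vanishing_def by simp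

lemma vanishing_diff: "vanishing a \<Longrightarrow> vanishing b \<Longrightarrow> vanishing (\<lambda>n. a n - b n)"
  using vanishing_add[OF _ vanishing_uminus, of a b] by simp

lemma vanishing_zero [simp]: "vanishing (\<lambda>n. 0)"
  unfolding vanishing_def by simp

lemma vanishing_mult_left:
  assumes "vanishing a" shows "vanishing (\<lambda>n. c * a n)"
proof (cases "c = 0")
  case False
  then obtain s where s: "ord c = ereal s"
    using ord_eq_infinity_iff[of c] ord_not_minus_infinity[of c] by (cases "ord c") auto
  show ?thesis
    using assms unfolding vanishing_def vge_scale_iff[OF s] by blast
qed simp

lemma vanishing_sum: "(\<And>j. j \<in> A \<Longrightarrow> vanishing (\<lambda>n. f j n)) \<Longrightarrow> vanishing (\<lambda>n. \<Sum>j\<in>A. f j n)"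
  by (induction A rule: infinite_finite_induct) (auto intro: vanishing_add)

lemma vanishing_const: "vanishing (\<lambda>n. c) \<Longrightarrow> c = 0"
  unfolding vanishing_def by (rule vge_all_eq_0) simp

lemma vanishing_shift: "vanishing (\<lambda>n. a (n + k)) \<longleftrightarrow> vanishing a"
  unfolding vanishing_def by (subst eventually_sequentially_seg) auto

lemma vanishing_eventually_zero: "\<forall>n\<ge>N. a n = 0 \<Longrightarrow> vanishing a"
  unfolding vanishing_def eventually_sequentially by (auto intro!: exI[of _ N])

lemma vlim_eqI:
  assumes "vanishing (\<lambda>n. s n - L)" shows "vlim s = L"
  unfolding vlim_def
proof (rule the_equality)
  show "vanishing (\<lambda>n. s n - L)" by fact
  fix L' assume "vanishing (\<lambda>n. s n - L')"
  from vanishing_diff[OF assms this] have "vanishing (\<lambda>n. L' - L)" by simp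
  then show "L' = L" using vanishing_const by force
qed

text \<open>By the ultrametric inequality a sequence is Cauchy as soon as its successive differences
  tend to zero.\<close>

lemma vlim_vanishing:
  assumes "vanishing (\<lambda>n. s (Suc n) - s n)"
  shows "vanishing (\<lambda>n. s n - vlim s)"
proof -
  have tail: "\<exists>M. \<forall>m\<ge>M. \<forall>n\<ge>m. vge (s n - s m) r" for r
  proof -
    obtain M where M: "\<And>n. n \<ge> M \<Longrightarrow> vge (s (Suc n) - s n) r"
      using assms unfolding vanishing_def eventually_sequentially by blast
    have "vge (s n - s m) r" if "n \<ge> m" "m \<ge> M" for m n
      using that(1)
    proof (induction n rule: dec_induct)
      case (step n)
      then show ?case using vge_add[OF M step.IH, of n] \<open>m \<ge> M\<close> by simp
    qed simp
    then show ?thesis by blast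
  qed
  have "Cauchy s"
  proof (rule metric_CauchyI)
    fix e :: real assume e: "e > 0"
    define r where "r = - log p e + 1"
    have "real p powr (- r) = e / p"
      using e p_gt_1 by (simp add: r_def powr_diff)
    also have "\<dots> < e" using e p_gt_1 by (simp add: field_simps)
    finally have re: "real p powr (- r) < e" .
    obtain M where M: "\<And>m n. m \<ge> M \<Longrightarrow> n \<ge> m \<Longrightarrow> vge (s n - s m) r" using tail by blast
    have *: "dist (s n) (s m) < e" if "m \<ge> M" "n \<ge> m" for m n
      using vge_imp_dist[OF M[OF that]] re by simp
    then have "dist (s m) (s n) < e" if "m \<ge> M" "n \<ge> M" for m n
      using *[of m n] *[of n m] that
      by (cases "m \<le> n") (auto simp: dist_commute)
    then show "\<exists>M. \<forall>m\<ge>M. \<forall>n\<ge>M. dist (s m) (s n) < e" by blast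
  qed
  then obtain L where L: "s \<longlonglongrightarrow> L"
    using Cauchy_convergent convergent_def by blast
  have "vanishing (\<lambda>n. s n - L)"
    unfolding vanishing_def
  proof
    fix r
    have "\<forall>\<^sub>F n in sequentially. dist (s n) L < real p powr (- r)"
      using L p_gt_1 by (intro tendstoD) auto
    then show "\<forall>\<^sub>F n in sequentially. vge (s n - L) r"
      by eventually_elim (rule dist_imp_vge)
  qed
  then show ?thesis using vlim_eqI by metis
qed

lemma vge_limit:
  assumes "vanishing (\<lambda>n. s n - L)" and "\<forall>\<^sub>F n in sequentially. vge (s n) r"
  shows "vge L r"
proof -
  have "\<forall>\<^sub>F n in sequentially. vge (s n - L) r" using assms(1) by (simp add: vanishing_def)
  with assms(2) have "\<forall>\<^sub>F n in sequentially. vge L r"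
    by eventually_elim (use vge_diff in fastforce)
  then show ?thesis by simp
qed

lemma K_limit:
  assumes "vanishing (\<lambda>n. s n - L)" and "\<And>n. s n \<in> K"
  shows "L \<in> K"
proof -
  have "s \<longlonglongrightarrow> L"
  proof (rule metric_LIMSEQ_I)
    fix e :: real assume e: "e > 0"
    define r where "r = - log p e + 1"
    have "real p powr (- r) = e / p"
      using e p_gt_1 by (simp add: r_def powr_diff)
    also have "\<dots> < e" using e p_gt_1 by (simp add: field_simps)
    finally have re: "real p powr (- r) < e" .
    obtain M where "\<And>n. n \<ge> M \<Longrightarrow> vge (s n - L) r"
      using assms(1) unfolding vanishing_def eventually_sequentially by blast
    then have "dist (s n) L < e" if "n \<ge> M" for n
      using vge_imp_dist[of "s n" L r] re that by fastforce
    then show "\<exists>M. \<forall>n\<ge>M. dist (s n) L < e" by blast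
  qed
  then show ?thesis
    using complete_imp_closed[OF complete_K] assms(2) closed_sequentially by blast
qed

lemma vsum_vanishing:
  assumes "vanishing a" shows "vanishing (\<lambda>N. (\<Sum>n<N. a n) - vsum a)"
  unfolding vsum_def by (rule vlim_vanishing) (use assms in simp)

lemma vsum_eqI: "vanishing (\<lambda>N. (\<Sum>n<N. a n) - L) \<Longrightarrow> vsum a = L"
  unfolding vsum_def by (rule vlim_eqI)

lemma vsum_zero [simp]: "vsum (\<lambda>n. 0) = 0"
  by (rule vsum_eqI) simp

lemma vsum_add:
  assumes "vanishing a" "vanishing b"
  shows "vsum (\<lambda>n. a n + b n) = vsum a + vsum b"
proof (rule vsum_eqI)
  show "vanishing (\<lambda>N. (\<Sum>n<N. a n + b n) - (vsum a + vsum b))"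
    using vanishing_add[OF vsum_vanishing[OF assms(1)] vsum_vanishing[OF assms(2)]]
    by (simp add: sum.distrib algebra_simps)
qed

lemma vsum_mult_left:
  assumes "vanishing a" shows "vsum (\<lambda>n. c * a n) = c * vsum a"
proof (rule vsum_eqI)
  show "vanishing (\<lambda>N. (\<Sum>n<N. c * a n) - c * vsum a)"
    using vanishing_mult_left[OF vsum_vanishing[OF assms], of c]
    by (simp add: sum_distrib_left right_diff_distrib)
qed

lemma vsum_sum:
  assumes "\<And>j. j \<in> A \<Longrightarrow> vanishing (f j)"
  shows "vsum (\<lambda>n. \<Sum>j\<in>A. f j n) = (\<Sum>j\<in>A. vsum (f j))"
  using assms
proof (induction A rule: infinite_finite_induct)
  case (insert x F)
  have "vanishing (\<lambda>n. \<Sum>j\<in>F. f j n)"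
    by (rule vanishing_sum) (use insert.prems in auto)
  then show ?case using insert by (simp add: vsum_add)
qed simp_all

lemma vsum_eventually_zero:
  assumes "\<forall>n\<ge>N. a n = 0" shows "vsum a = (\<Sum>n<N. a n)"
proof (rule vsum_eqI)
  have "(\<Sum>n<M. a n) - (\<Sum>n<N. a n) = 0" if "M \<ge> N" for M
    unfolding right_minus_eq using that assms by (intro sum.mono_neutral_right) auto
  then show "vanishing (\<lambda>M. (\<Sum>n<M. a n) - (\<Sum>n<N. a n))"
    by (intro vanishing_eventually_zero[of N]) blast
qed

lemma vsum_single: "vsum (\<lambda>n. if n = k then c else 0) = c"
  by (subst vsum_eventually_zero[of "Suc k"]) auto

lemma vsum_shift:
  assumes "vanishing a" and "\<And>n. n < k \<Longrightarrow> a n = 0"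
  shows "vsum (\<lambda>n. a (n + k)) = vsum a"
proof (rule vsum_eqI)
  have "(\<Sum>n<N. a (n + k)) = (\<Sum>n<N + k. a n)" for N
  proof -
    have "(\<Sum>n<N + k. a n) = (\<Sum>n\<in>{k..<N + k}. a n)"
      using assms(2) by (intro sum.mono_neutral_right) auto
    also have "\<dots> = (\<Sum>n<N. a (n + k))"
      using sum.shift_bounds_nat_ivl[of a 0 k N] by (simp only: lessThan_atLeast0 add_0)
    finally show ?thesis by simp
  qed
  then show "vanishing (\<lambda>N. (\<Sum>n<N. a (n + k)) - vsum a)"
    using vanishing_shift[of "\<lambda>N. (\<Sum>n<N. a n) - vsum a" k] vsum_vanishing[OF assms(1)] by simp
qed

lemma vge_vsum:
  assumes "vanishing a" and "\<And>n. vge (a n) r" shows "vge (vsum a) r"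
  by (rule vge_limit[OF vsum_vanishing[OF assms(1)]]) (simp add: assms(2) vge_sum)

lemma K_vsum:
  assumes "vanishing a" and "\<And>n. a n \<in> K" shows "vsum a \<in> K"
  by (rule K_limit[OF vsum_vanishing[OF assms(1)]]) (simp add: assms(2) K_sum)

end

section \<open>The digit length\<close>

lemma square_le_power2: "k * k \<le> 4 * 2 ^ k" for k :: nat
proof (cases "k < 3")
  case True
  then have "k = 0 \<or> k = 1 \<or> k = 2" by auto
  then show ?thesis by auto
next
  case False
  then have "3 \<le> k" by simp
  then show ?thesis
  proof (induction k rule: nat_induct_at_least)
    case (Suc k)
    have "3 * k \<le> k * k" using Suc.hyps by (rule mult_le_mono1)
    then have "Suc k * Suc k \<le> 2 * (k * k)"
      unfolding mult_Suc mult_Suc_right using Suc.hyps by linarith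
    then show ?case using Suc.IH by simp
  qed simp
qed

lemma ell_le_iff:
  assumes "2 \<le> p" shows "ell p n \<le> m \<longleftrightarrow> n < p ^ m"
proof
  have ex: "n < p ^ n" using power_gt_expt[of p n] assms by simp
  have less: "n < p ^ ell p n" unfolding ell_def by (rule LeastI[of "\<lambda>m. n < p ^ m", OF ex])
  show "ell p n \<le> m \<Longrightarrow> n < p ^ m"
    using less power_increasing[of "ell p n" m p] assms by linarith
  show "n < p ^ m \<Longrightarrow> ell p n \<le> m" unfolding ell_def by (rule Least_le)
qed

lemma ell_mono: "2 \<le> p \<Longrightarrow> n \<le> m \<Longrightarrow> ell p n \<le> ell p m"
  using ell_le_iff[of p n "ell p m"] ell_le_iff[of p m "ell p m"] by simp

lemma ell_add_le:
  assumes "2 \<le> p" shows "ell p (m + n) \<le> ell p m + ell p n"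
proof -
  have "m + 1 \<le> p ^ ell p m" "n + 1 \<le> p ^ ell p n"
    using ell_le_iff[OF assms, of m "ell p m"] ell_le_iff[OF assms, of n "ell p n"] by auto
  then have "(m + 1) * (n + 1) \<le> p ^ (ell p m + ell p n)"
    unfolding power_add by (rule mult_le_mono)
  then show ?thesis by (simp add: ell_le_iff[OF assms])
qed

lemma power_ell_le:
  assumes "2 \<le> p" "ell p n = Suc k" shows "p ^ k \<le> n"
  using ell_le_iff[OF assms(1), of n k] assms(2) by simp

text \<open>The square of \<open>ell p n\<close> is at most of the order of \<open>p ^ (ell p n - 1)\<close>, which is at most \<open>n\<close>;
  the constant comes from completing the square. The lemma makes all later series converge.\<close>

lemma ell_sublinear:
  assumes "2 \<le> p" "0 < \<epsilon>" "0 \<le> h"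
  shows "h * real (ell p n) \<le> \<epsilon> * real n + (h + h\<^sup>2 / \<epsilon>)"
proof (cases "ell p n")
  case 0
  then show ?thesis using assms by simp
next
  case (Suc k)
  have "2 ^ k \<le> p ^ k" using assms by (simp add: power_mono)
  with power_ell_le[OF assms(1) Suc] have "2 ^ k \<le> n" by linarith
  with square_le_power2[of k] have "k * k \<le> 4 * n" by linarith
  then have "real (k * k) \<le> real (4 * n)" by (simp only: of_nat_le_iff)
  then have "real k * real k \<le> 4 * real n" by simp
  then have "\<epsilon> / 4 * (real k * real k) \<le> \<epsilon> * real n"
    using assms by simp
  moreover define a where "a = h / \<epsilon>"
  have h: "h = \<epsilon> * a" "h\<^sup>2 / \<epsilon> = \<epsilon> * a * a"
    using assms by (simp_all add: a_def power2_eq_square)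
  have "0 \<le> \<epsilon> * (real k / 2 - a)\<^sup>2" using assms by simp
  then have "h * real k \<le> \<epsilon> / 4 * (real k * real k) + h\<^sup>2 / \<epsilon>"
    unfolding h by (simp add: power2_eq_square algebra_simps)
  moreover have "h * real (ell p n) = h * real k + h" using Suc by (simp add: algebra_simps)
  ultimately show ?thesis by linarith
qed

section \<open>Division of powers of the variable by a distinguished polynomial\<close>

lemma mod_sum_smult_left:
  fixes P :: "'a::field poly"
  shows "(\<Sum>j\<in>A. smult (c j) (q j)) mod P = (\<Sum>j\<in>A. smult (c j) (q j mod P))"
  by (induction A rule: infinite_finite_induct) (simp_all add: poly_mod_add_left mod_smult_left)

definition rem_kernel :: "'c::field poly \<Rightarrow> nat \<Rightarrow> nat \<Rightarrow> 'c"
  where "rem_kernel P n l = coeff (monom 1 n mod P) l"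

definition quot_kernel :: "'c::field poly \<Rightarrow> nat \<Rightarrow> nat \<Rightarrow> 'c"
  where "quot_kernel P n l = coeff (monom 1 n div P) l"

text \<open>Division of \<open>monom 1 n\<close> with remainder, read off at the exponent \<open>l\<close>. In this form it can be
  multiplied by the coefficients of a series and summed over \<open>n\<close>.\<close>

lemma kernel_division:
  "(\<Sum>j\<le>l. coeff P j * quot_kernel P n (l - j)) + rem_kernel P n l = (if n = l then 1 else 0)"
proof -
  have "coeff (P * (monom 1 n div P) + monom 1 n mod P) l = coeff (monom 1 n) l"
    by (simp only: mult_div_mod_eq)
  then show ?thesis by (simp only: coeff_mult quot_kernel_def rem_kernel_def coeff_add coeff_monom)
qed

text \<open>The remainder of \<open>P * monom 1 k\<close> is zero.\<close>

lemma rem_kernel_annihilates: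
  "(\<Sum>j\<le>degree P. coeff P j * rem_kernel P (k + j) l) = 0"
proof -
  have "P * monom 1 k = (\<Sum>j\<le>degree P. smult (coeff P j) (monom 1 (k + j)))"
    by (subst (1) poly_as_sum_of_monoms[symmetric])
      (simp add: sum_distrib_right mult_monom smult_monom add.commute)
  then have "(\<Sum>j\<le>degree P. smult (coeff P j) (monom 1 (k + j) mod P)) = P * monom 1 k mod P"
    by (simp only: mod_sum_smult_left)
  then have "(\<Sum>j\<le>degree P. smult (coeff P j) (monom 1 (k + j) mod P)) = 0" by simp
  from arg_cong[OF this, of "\<lambda>q. coeff q l"] show ?thesis
    by (simp add: coeff_sum rem_kernel_def)
qed

lemma rem_kernel_less: "n < degree P \<Longrightarrow> rem_kernel P n l = (if n = l then 1 else 0)"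
  by (simp add: rem_kernel_def mod_poly_less degree_monom_eq)

lemma rem_kernel_eq_0: "0 < degree P \<Longrightarrow> degree P \<le> l \<Longrightarrow> rem_kernel P n l = 0"
  unfolding rem_kernel_def using degree_mod_less[of P "monom 1 n"] by (cases "P = 0") (auto intro: coeff_eq_0)

context complete_subfield
begin

text \<open>The Newton polygon of \<open>P\<close> lies above the line of slope \<open>- r\<close> through its end point, that is, all
  roots have valuation at least \<open>r\<close>.\<close>

definition distinguished :: "real \<Rightarrow> 'c poly \<Rightarrow> bool"
  where "distinguished r P \<longleftrightarrow> 0 < degree P \<and> lead_coeff P = 1 \<and>
    (\<forall>l. coeff P l \<in> K \<and> vge (coeff P l) 0 \<and>
      vge (coeff P l) ((real (degree P) - real l) * r))"

text \<open>The remainder of the next power is \<open>X\<close> times the old one, minus the multiple of \<open>P\<close> that cancels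
  the new leading term.\<close>

lemma rem_quot_kernel_Suc:
  assumes "distinguished r P"
  defines "b n \<equiv> rem_kernel P n (degree P - 1)"
  shows "rem_kernel P (Suc n) 0 = - b n * coeff P 0"
    and "rem_kernel P (Suc n) (Suc l) = rem_kernel P n l - b n * coeff P (Suc l)"
    and "quot_kernel P (Suc n) 0 = b n"
    and "quot_kernel P (Suc n) (Suc l) = quot_kernel P n l"
proof -
  have P: "P \<noteq> 0" "0 < degree P" "lead_coeff P = 1" using assms(1) by (auto simp: distinguished_def)
  have b: "coeff (pCons 0 (monom 1 n mod P)) (degree P) / lead_coeff P = b n"
    using P by (cases "degree P") (auto simp: b_def rem_kernel_def)
  have R: "monom 1 (Suc n) mod P = pCons 0 (monom 1 n mod P) - smult (b n) P"
    unfolding monom_Suc using P(1) b by (subst mod_pCons_eq) simp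
  have Q: "monom 1 (Suc n) div P = pCons (b n) (monom 1 n div P)"
    unfolding monom_Suc using P(1) b by (subst div_pCons_eq) simp
  show "rem_kernel P (Suc n) 0 = - b n * coeff P 0"
    and "rem_kernel P (Suc n) (Suc l) = rem_kernel P n l - b n * coeff P (Suc l)"
    unfolding rem_kernel_def R by simp_all
  show "quot_kernel P (Suc n) 0 = b n"
    and "quot_kernel P (Suc n) (Suc l) = quot_kernel P n l"
    unfolding quot_kernel_def Q by simp_all
qed

text \<open>The bounds required of \<open>P\<close> are exactly those that the recursion preserves.\<close>

lemma rem_kernel_bounds:
  assumes P: "distinguished r P" and r: "0 \<le> r"
  shows "rem_kernel P n l \<in> K \<and> vge (rem_kernel P n l) 0 \<and>
    vge (rem_kernel P n l) ((real n - real l) * r)"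
proof (induction n arbitrary: l)
  case 0
  have "rem_kernel P 0 l = (if 0 = l then 1 else 0)"
    using P by (intro rem_kernel_less) (simp add: distinguished_def)
  then show ?case by auto
next
  case (Suc n)
  let ?D = "degree P"
  let ?b = "rem_kernel P n (?D - 1)"
  have D: "0 < ?D" and c: "coeff P j \<in> K" "vge (coeff P j) 0" "vge (coeff P j) ((real ?D - real j) * r)"
    for j using P by (auto simp: distinguished_def)
  have b: "?b \<in> K" "vge ?b 0" "vge ?b ((real n - real (?D - 1)) * r)" using Suc.IH by blast+
  have bc: "?b * coeff P j \<in> K" "vge (?b * coeff P j) 0"
    "vge (?b * coeff P j) ((real (Suc n) - real j) * r)" for j
  proof -
    show "?b * coeff P j \<in> K" using b(1) c(1) by (rule K_mult)
    show "vge (?b * coeff P j) 0" using vge_mult[OF b(2) c(2)] by simp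
    show "vge (?b * coeff P j) ((real (Suc n) - real j) * r)"
      by (rule vge_mult'[OF b(3) c(3)]) (use D in \<open>simp add: of_nat_diff algebra_simps\<close>)
  qed
  show ?case
  proof (cases l)
    case 0
    then show ?thesis using rem_quot_kernel_Suc(1)[OF P] bc[of 0] K_uminus by simp
  next
    case (Suc l')
    then show ?thesis using rem_quot_kernel_Suc(2)[OF P] bc[of "Suc l'"] Suc.IH[of l']
      by (auto intro!: vge_diff K_diff)
  qed
qed

lemma quot_kernel_bounds:
  assumes P: "distinguished r P" and r: "0 \<le> r"
  shows "quot_kernel P n l \<in> K \<and> vge (quot_kernel P n l) 0 \<and>
    vge (quot_kernel P n l) ((real n - real l) * r - real (degree P) * r)"
proof (induction n arbitrary: l)
  case 0
  have "monom 1 0 div P = 0"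
    using P by (intro div_poly_less) (simp add: distinguished_def degree_monom_eq)
  then show ?case by (simp add: quot_kernel_def)
next
  case (Suc n)
  have D: "0 < degree P" using P by (simp add: distinguished_def)
  show ?case
  proof (cases l)
    case 0
    have "vge (rem_kernel P n (degree P - 1)) ((real n - real (degree P - 1)) * r)"
      using rem_kernel_bounds[OF P r] by blast
    then have "vge (rem_kernel P n (degree P - 1)) ((real (Suc n) - real 0) * r - real (degree P) * r)"
      using D by (simp add: of_nat_diff algebra_simps)
    then show ?thesis using 0 rem_quot_kernel_Suc(3)[OF P] rem_kernel_bounds[OF P r] by simp
  next
    case (Suc l')
    then show ?thesis using rem_quot_kernel_Suc(4)[OF P] Suc.IH[of l'] by simp
  qed
qed

end

section \<open>Univariate polynomials as power series in several variables\<close>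

text \<open>The exponents of the monomials in the variable \<open>i\<close> alone.\<close>

definition on_axis :: "'k \<Rightarrow> ('k \<Rightarrow> nat) \<Rightarrow> bool"
  where "on_axis i n \<longleftrightarrow> (\<forall>j. j \<noteq> i \<longrightarrow> n j = 0)"

definition mfps_of_poly :: "'k \<Rightarrow> 'c::comm_ring_1 poly \<Rightarrow> ('k, 'c) mfps"
  where "mfps_of_poly i P = Abs_mfps (\<lambda>n. if on_axis i n then coeff P (n i) else 0)"

lemma on_axis_fun_upd [simp]: "on_axis i (n(i := a)) \<longleftrightarrow> on_axis i n"
  by (simp add: on_axis_def)

lemma on_axis_zero [simp]: "on_axis i (\<lambda>_. 0)"
  by (simp add: on_axis_def)

lemma on_axis_zero_iff: "on_axis i n \<Longrightarrow> n = (\<lambda>_. 0) \<longleftrightarrow> n i = 0"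
  unfolding on_axis_def fun_eq_iff by metis

lemma mcoeff_Abs [simp]: "mcoeff (Abs_mfps f) = f"
  by (simp add: Abs_mfps_inverse)

lemma mcoeff_simps [simp]:
  "mcoeff 0 n = 0" "mcoeff (f + g) n = mcoeff f n + mcoeff g n"
  "mcoeff (f - g) n = mcoeff f n - mcoeff g n" "mcoeff (- f) n = - mcoeff f n"
  by (transfer; simp)+

lemma mcoeff_mult: "mcoeff (f * g) n = (\<Sum>i\<in>{..n}. mcoeff f i * mcoeff g (\<lambda>x. n x - i x))"
  by transfer simp

lemma mcoeff_mconst_mult [simp]:
  fixes f :: "('k::finite, 'c::comm_ring_1) mfps"
  shows "mcoeff (mconst c * f) n = c * mcoeff f n"
proof -
  have "mcoeff (mconst c * f) n =
    (\<Sum>i\<in>{..n}. (if i = (\<lambda>_. 0) then c else 0) * mcoeff f (\<lambda>x. n x - i x))"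
    by transfer simp
  also have "\<dots> = (\<Sum>i\<in>{..n}. if i = (\<lambda>_. 0) then c * mcoeff f n else 0)"
    by (rule sum.cong) auto
  also have "\<dots> = c * mcoeff f n" by (simp add: le_fun_def)
  finally show ?thesis .
qed

lemma mcoeff_mfps_of_poly_mult:
  fixes f :: "('k::finite, 'c::comm_ring_1) mfps"
  shows "mcoeff (mfps_of_poly i P * f) l = (\<Sum>j\<le>l i. coeff P j * mcoeff f (l(i := l i - j)))"
proof -
  let ?e = "\<lambda>j. (\<lambda>_. 0)(i := j)"
  have "mcoeff (mfps_of_poly i P * f) l =
    (\<Sum>a\<in>?e ` {..l i}. mcoeff (mfps_of_poly i P) a * mcoeff f (\<lambda>x. l x - a x))"
    unfolding mcoeff_mult
  proof (rule sum.mono_neutral_right)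
    show "?e ` {..l i} \<subseteq> {..l}" by (auto simp: le_fun_def)
    show "\<forall>a\<in>{..l} - ?e ` {..l i}. mcoeff (mfps_of_poly i P) a * mcoeff f (\<lambda>x. l x - a x) = 0"
    proof
      fix a assume a: "a \<in> {..l} - ?e ` {..l i}"
      have "\<not> on_axis i a"
      proof
        assume "on_axis i a"
        then have "a = ?e (a i)" by (auto simp: on_axis_def)
        moreover have "a i \<le> l i" using a by (auto simp: le_fun_def)
        ultimately show False using a by blast
      qed
      then show "mcoeff (mfps_of_poly i P) a * mcoeff f (\<lambda>x. l x - a x) = 0"
        by (simp add: mfps_of_poly_def)
    qed
  qed simp
  also have "\<dots> = (\<Sum>j\<le>l i. mcoeff (mfps_of_poly i P) (?e j) * mcoeff f (\<lambda>x. l x - ?e j x))"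
    by (subst sum.reindex) (auto simp: inj_on_def dest: fun_cong[where x = i])
  also have "\<dots> = (\<Sum>j\<le>l i. coeff P j * mcoeff f (l(i := l i - j)))"
    by (intro sum.cong refl arg_cong2[where f = "(*)"] arg_cong2[where f = mcoeff])
      (auto simp: mfps_of_poly_def)
  finally show ?thesis .
qed

lemma mfps_of_poly_const: "mfps_of_poly i [:c:] = mconst c"
proof (rule mfps_eqI)
  fix n
  show "mcoeff (mfps_of_poly i [:c:]) n = mcoeff (mconst c) n"
    by (cases "on_axis i n")
      (auto simp: mfps_of_poly_def mconst.rep_eq on_axis_zero_iff coeff_pCons split: nat.splits)
qed

lemma mfps_of_poly_var: "mfps_of_poly i [:0, 1:] = mvar i"
proof (rule mfps_eqI)
  fix n
  have "n = (\<lambda>j. if j = i then 1 else 0) \<longleftrightarrow> on_axis i n \<and> n i = 1"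
    by (auto simp: on_axis_def fun_eq_iff)
  then show "mcoeff (mfps_of_poly i [:0, 1:]) n = mcoeff (mvar i) n"
    by (auto simp: mfps_of_poly_def mvar.rep_eq coeff_pCons split: nat.splits)
qed

lemma mfps_of_poly_one: "mfps_of_poly i 1 = (1 :: ('k::finite, 'c::comm_ring_1) mfps)"
proof -
  have "mconst 1 = (1 :: ('k, 'c) mfps)" by transfer simp
  then show ?thesis using mfps_of_poly_const[of i "1::'c"] by (simp add: one_pCons)
qed

lemma mfps_of_poly_add:
  "mfps_of_poly i (P + Q) = mfps_of_poly i P + (mfps_of_poly i Q :: ('k::finite, 'c::comm_ring_1) mfps)"
  by (rule mfps_eqI) (simp add: mfps_of_poly_def)

lemma mfps_of_poly_diff:
  "mfps_of_poly i (P - Q) = mfps_of_poly i P - (mfps_of_poly i Q :: ('k::finite, 'c::comm_ring_1) mfps)"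
  by (rule mfps_eqI) (simp add: mfps_of_poly_def)

lemma mfps_of_poly_mult:
  "mfps_of_poly i (P * Q) = mfps_of_poly i P * (mfps_of_poly i Q :: ('k::finite, 'c::comm_ring_1) mfps)"
proof (rule mfps_eqI)
  fix n
  show "mcoeff (mfps_of_poly i (P * Q)) n = mcoeff (mfps_of_poly i P * mfps_of_poly i Q) n"
    unfolding mcoeff_mfps_of_poly_mult by (auto simp: mfps_of_poly_def coeff_mult)
qed

lemma mfps_of_poly_power:
  "mfps_of_poly i (P ^ n) = (mfps_of_poly i P :: ('k::finite, 'c::comm_ring_1) mfps) ^ n"
  by (induction n) (simp_all add: mfps_of_poly_one mfps_of_poly_mult)

lemma mfps_of_poly_prod:
  "mfps_of_poly i (\<Prod>a\<in>A. P a) = (\<Prod>a\<in>A. (mfps_of_poly i (P a) :: ('k::finite, 'c::comm_ring_1) mfps))"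
  by (induction A rule: infinite_finite_induct) (simp_all add: mfps_of_poly_one mfps_of_poly_mult)

section \<open>Series of bounded growth\<close>

context complete_subfield
begin

text \<open>The weight in the definition of \<open>vH\<close>; \<open>bd h c f\<close> states \<open>c \<le> vH p ord h f\<close>.\<close>

definition wt :: "('k::finite \<Rightarrow> real) \<Rightarrow> ('k \<Rightarrow> nat) \<Rightarrow> real"
  where "wt h n = (\<Sum>i\<in>UNIV. h i * real (ell p (n i)))"

definition bd :: "('k::finite \<Rightarrow> real) \<Rightarrow> real \<Rightarrow> ('k, 'c) mfps \<Rightarrow> bool"
  where "bd h c f \<longleftrightarrow> (\<forall>n. vge (mcoeff f n) (c - wt h n))"

abbreviation Hs :: "('k::finite \<Rightarrow> real) \<Rightarrow> ('k, 'c) mfps set"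
  where "Hs \<equiv> H_set p ord K"

lemma wt_fun_upd: "wt h (k(i := n)) = wt h k - h i * real (ell p (k i)) + h i * real (ell p n)"
proof -
  have "wt h m = h i * real (ell p (m i)) + (\<Sum>j\<in>UNIV - {i}. h j * real (ell p (m j)))" for m
    unfolding wt_def by (rule sum.remove) auto
  then show ?thesis by simp
qed

lemma wt_mono: "(\<And>i. 0 \<le> h i) \<Longrightarrow> m \<le> n \<Longrightarrow> wt h m \<le> wt h n"
  unfolding wt_def by (intro sum_mono mult_left_mono) (auto simp: le_fun_def intro: ell_mono[OF p_ge_2])

lemma wt_mono_weight: "(\<And>i. h i \<le> h' i) \<Longrightarrow> wt h n \<le> wt h' n"
  unfolding wt_def by (intro sum_mono mult_right_mono) auto

lemma wt_zero [simp]: "wt (\<lambda>_. 0) n = 0"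
  by (simp add: wt_def)

lemma bd_mono: "bd h c f \<Longrightarrow> c' \<le> c \<Longrightarrow> bd h c' f"
  unfolding bd_def by (meson diff_right_mono vge_mono)

lemma bd_add: "bd h c f \<Longrightarrow> bd h c g \<Longrightarrow> bd h c (f + g)"
  unfolding bd_def by (auto intro: vge_add)

lemma le_vH_iff: "ereal c \<le> vH p ord h f \<longleftrightarrow> bd h c f"
proof -
  have "ereal c \<le> ord x + ereal w \<longleftrightarrow> vge x (c - w)" for x w
    unfolding vge_def by (cases "ord x") auto
  then show ?thesis by (simp add: vH_def bd_def le_INF_iff wt_def)
qed

lemma Hs_iff: "f \<in> Hs h \<longleftrightarrow> (\<forall>n. mcoeff f n \<in> K) \<and> (\<exists>c. bd h c f)"
proof -
  have "- \<infinity> < x \<longleftrightarrow> (\<exists>c. ereal c \<le> x)" for x :: ereal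
    by (cases x) auto
  then show ?thesis by (simp add: H_set_def mfps_over_def le_vH_iff)
qed

lemma HsI: "(\<And>n. mcoeff f n \<in> K) \<Longrightarrow> bd h c f \<Longrightarrow> f \<in> Hs h"
  using Hs_iff by blast

lemma HsE: "f \<in> Hs h \<Longrightarrow> (\<And>c. (\<And>n. mcoeff f n \<in> K) \<Longrightarrow> bd h c f \<Longrightarrow> thesis) \<Longrightarrow> thesis"
  using Hs_iff by blast

lemma Hs_zero [simp]: "0 \<in> Hs h"
  by (rule HsI[where c = 0]) (auto simp: bd_def)

lemma Hs_uminus: "f \<in> Hs h \<Longrightarrow> - f \<in> Hs h"
  unfolding Hs_iff bd_def by (auto intro: K_uminus)

lemma Hs_add:
  assumes "f \<in> Hs h" "g \<in> Hs h" shows "f + g \<in> Hs h"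
proof -
  from assms(1) obtain c where "\<And>n. mcoeff f n \<in> K" "bd h c f" by (rule HsE) auto
  moreover from assms(2) obtain c' where "\<And>n. mcoeff g n \<in> K" "bd h c' g" by (rule HsE) auto
  ultimately show ?thesis
    by (intro HsI[where c = "min c c'"] bd_add) (auto intro: K_add elim: bd_mono)
qed

lemma Hs_diff: "f \<in> Hs h \<Longrightarrow> g \<in> Hs h \<Longrightarrow> f - g \<in> Hs h"
  using Hs_add[OF _ Hs_uminus, of f h g] by simp

lemma Hs_sum: "(\<And>a. a \<in> A \<Longrightarrow> f a \<in> Hs h) \<Longrightarrow> (\<Sum>a\<in>A. f a) \<in> Hs h"
  by (induction A rule: infinite_finite_induct) (auto intro: Hs_add)

lemma Hs_mono:
  assumes "\<And>i. h i \<le> h' i" "f \<in> Hs h" shows "f \<in> Hs h'"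
proof -
  from assms(2) obtain c where c: "\<And>n. mcoeff f n \<in> K" "bd h c f" by (rule HsE) auto
  have "vge (mcoeff f n) (c - wt h' n)" for n
    using c(2) wt_mono_weight[of h h' n, OF assms(1)]
    by (auto simp: bd_def intro: vge_mono[of "mcoeff f n" "c - wt h n"])
  then show ?thesis using c(1) by (intro HsI[where c = c]) (auto simp: bd_def)
qed

lemma bd_mult:
  assumes "\<And>i. 0 \<le> h i" "bd (\<lambda>_. 0) b f" "bd h c g"
  shows "bd h (b + c) (f * g)"
  unfolding bd_def mcoeff_mult
proof (intro allI vge_sum)
  fix n a :: "'a \<Rightarrow> nat" assume "a \<in> {..n}"
  have "vge (mcoeff f a) b" and g: "vge (mcoeff g (\<lambda>x. n x - a x)) (c - wt h (\<lambda>x. n x - a x))"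
    using assms(2,3) by (auto simp: bd_def)
  moreover have "wt h (\<lambda>x. n x - a x) \<le> wt h n"
    by (rule wt_mono[OF assms(1)]) (auto simp: le_fun_def)
  ultimately show "vge (mcoeff f a * mcoeff g (\<lambda>x. n x - a x)) (b + c - wt h n)"
    by (intro vge_mult'[OF _ g]) auto
qed

lemma Hs_mult:
  assumes h: "\<And>i. 0 \<le> h i" and f: "f \<in> Hs (\<lambda>_. 0)" and g: "g \<in> Hs h"
  shows "f * g \<in> Hs h"
proof -
  from f obtain b where f': "\<And>n. mcoeff f n \<in> K" "bd (\<lambda>_. 0) b f" by (rule HsE) auto
  from g obtain c where g': "\<And>n. mcoeff g n \<in> K" "bd h c g" by (rule HsE) auto
  show ?thesis
    using bd_mult[OF h f'(2) g'(2)] f'(1) g'(1)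
    by (intro HsI[where c = "b + c"]) (auto simp: mcoeff_mult intro!: K_sum K_mult)
qed

section \<open>Operators in one variable\<close>

text \<open>Matrices that act on series in one variable. Integrality serves for \<open>n \<le> l\<close>, the linear growth of
  the valuation for large \<open>n\<close>. The remainder and the quotient of Weierstrass division are both of
  this kind.\<close>

definition kernel :: "real \<Rightarrow> real \<Rightarrow> (nat \<Rightarrow> nat \<Rightarrow> 'c) \<Rightarrow> bool"
  where "kernel r C a \<longleftrightarrow> 0 < r \<and>
    (\<forall>n l. a n l \<in> K \<and> vge (a n l) 0 \<and> vge (a n l) ((real n - real l) * r - C))"

definition coord_op :: "'k::finite \<Rightarrow> (nat \<Rightarrow> nat \<Rightarrow> 'c) \<Rightarrow> ('k, 'c) mfps \<Rightarrow> ('k, 'c) mfps"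
  where "coord_op i a f = Abs_mfps (\<lambda>l. vsum (\<lambda>n. a n (l i) * mcoeff f (l(i := n))))"

lemma mcoeff_coord_op: "mcoeff (coord_op i a f) l = vsum (\<lambda>n. a n (l i) * mcoeff f (l(i := n)))"
  by (simp add: coord_op_def)

lemma kernel_rem: "distinguished r P \<Longrightarrow> 0 < r \<Longrightarrow> kernel r 0 (rem_kernel P)"
  using rem_kernel_bounds by (simp add: kernel_def)

lemma kernel_quot: "distinguished r P \<Longrightarrow> 0 < r \<Longrightarrow> kernel r (real (degree P) * r) (quot_kernel P)"
  using quot_kernel_bounds by (simp add: kernel_def)

lemma kernel_shift:
  assumes "kernel r C a" shows "kernel r C (\<lambda>n. a (n + j))"
proof -
  have "vge (a (n + j) l) ((real n - real l) * r - C)" for n l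
    using assms unfolding kernel_def
    by (elim conjE allE[where x = "n + j"] allE[where x = l] vge_mono) (simp add: mult_right_mono)
  then show ?thesis using assms by (simp add: kernel_def)
qed

text \<open>With this estimate a kernel acts on the series of growth \<open>h\<close>, at the price of a constant. For
  \<open>n > l\<close> it follows from \<open>ell n \<le> ell l + ell (n - l)\<close> and the sublinearity of \<open>ell\<close>.\<close>

lemma kernel_weight:
  assumes "kernel r C a" "0 \<le> h"
  shows "vge (a n l) (h * real (ell p n) - h * real (ell p l) - (\<bar>C\<bar> + (h + h\<^sup>2 / r)))"
proof (cases "n \<le> l")
  case True
  have r: "0 < r" and v: "vge (a n l) 0" using assms(1) by (auto simp: kernel_def)
  have "h * real (ell p n) \<le> h * real (ell p l)"
    using ell_mono[OF p_ge_2 True] assms(2) by (intro mult_left_mono) auto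
  moreover have "0 \<le> h\<^sup>2 / r" using r by simp
  ultimately show ?thesis using assms(2) by (intro vge_mono[OF v]) linarith
next
  case False
  have r: "0 < r" and v: "vge (a n l) ((real n - real l) * r - C)" using assms(1) by (auto simp: kernel_def)
  have "ell p n \<le> ell p l + ell p (n - l)" using ell_add_le[OF p_ge_2, of l "n - l"] False by simp
  then have "h * real (ell p n) \<le> h * real (ell p l + ell p (n - l))"
    using assms(2) by (intro mult_left_mono) (simp_all only: of_nat_le_iff)
  also have "\<dots> \<le> h * real (ell p l) + (r * real (n - l) + (h + h\<^sup>2 / r))"
    using ell_sublinear[OF p_ge_2 r assms(2), of "n - l"] by (simp add: distrib_left)
  finally show ?thesis
    using False by (intro vge_mono[OF v]) (simp add: of_nat_diff algebra_simps)
qed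

lemma vanishing_linear:
  assumes "0 < \<delta>" "\<And>n. vge (a n) (\<delta> * real n - B)" shows "vanishing a"
  unfolding vanishing_def eventually_sequentially
proof
  fix r
  obtain N where N: "(r + B) / \<delta> \<le> real N" using real_arch_simple by blast
  have "vge (a n) r" if "n \<ge> N" for n
  proof (rule vge_mono[OF assms(2)])
    have "(r + B) / \<delta> \<le> real n" using N that by linarith
    then show "r \<le> \<delta> * real n - B" using assms(1) by (simp add: field_simps)
  qed
  then show "\<exists>N. \<forall>n\<ge>N. vge (a n) r" by blast
qed

lemma kernel_vanishing:
  assumes a: "kernel r C a" and f: "f \<in> Hs h" and h: "\<And>i. 0 \<le> h i"
  shows "vanishing (\<lambda>n. a n l * mcoeff f (k(i := n)))"
proof -
  from f obtain c where c: "bd h c f" by (rule HsE) auto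
  have r: "0 < r" and v: "vge (a n l) ((real n - real l) * r - C)" for n
    using a by (auto simp: kernel_def)
  let ?M = "h i + (h i)\<^sup>2 / (r / 2)"
  let ?W = "wt h k - h i * real (ell p (k i))"
  \<comment> \<open>Half of the slope \<open>r\<close> absorbs the weight of the coefficients.\<close>
  show ?thesis
  proof (rule vanishing_linear[of "r / 2" _ "real l * r + C - c + ?W + ?M"])
    fix n
    have "vge (mcoeff f (k(i := n))) (c - (?W + h i * real (ell p n)))"
      using c by (simp add: bd_def wt_fun_upd[symmetric])
    moreover have "h i * real (ell p n) \<le> r / 2 * real n + ?M"
      using r h by (intro ell_sublinear p_ge_2) auto
    ultimately show "vge (a n l * mcoeff f (k(i := n))) (r / 2 * real n - (real l * r + C - c + ?W + ?M))"
      by (intro vge_mult'[OF v]) (auto simp: field_simps)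
  qed (use r in simp)
qed

lemma coord_op_bd:
  assumes a: "kernel r C a" and f: "\<And>n. mcoeff f n \<in> K" "bd h c f" and h: "\<And>i. 0 \<le> h i"
  shows "bd h (c - (\<bar>C\<bar> + (h i + (h i)\<^sup>2 / r))) (coord_op i a f)"
  unfolding bd_def mcoeff_coord_op
proof (intro allI vge_vsum)
  fix l
  show "vanishing (\<lambda>n. a n (l i) * mcoeff f (l(i := n)))"
    by (rule kernel_vanishing[OF a HsI h]) (use f in auto)
  fix n
  have "vge (mcoeff f (l(i := n))) (c - wt h (l(i := n)))" using f(2) by (simp add: bd_def)
  then show "vge (a n (l i) * mcoeff f (l(i := n))) (c - (\<bar>C\<bar> + (h i + (h i)\<^sup>2 / r)) - wt h l)"
    by (rule vge_mult'[OF kernel_weight[OF a h[of i]]]) (simp add: wt_fun_upd)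
qed

lemma coord_op_Hs:
  assumes a: "kernel r C a" and f: "f \<in> Hs h" and h: "\<And>i. 0 \<le> h i"
  shows "coord_op i a f \<in> Hs h"
proof -
  from f obtain c where c: "\<And>n. mcoeff f n \<in> K" "bd h c f" by (rule HsE) auto
  show ?thesis
  proof (rule HsI[OF _ coord_op_bd[OF a c h]])
    fix l show "mcoeff (coord_op i a f) l \<in> K"
      unfolding mcoeff_coord_op
      by (rule K_vsum[OF kernel_vanishing[OF a f h]]) (use a c in \<open>auto simp: kernel_def intro: K_mult\<close>)
  qed
qed

lemma vge_coord_op:
  assumes a: "kernel r C a" and f: "f \<in> Hs h" and h: "\<And>i. 0 \<le> h i"
    and "\<And>n. vge (a n (l i) * mcoeff f (l(i := n))) b"
  shows "vge (mcoeff (coord_op i a f) l) b"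
  unfolding mcoeff_coord_op using vge_vsum[OF kernel_vanishing[OF a f h]] assms(4) by blast

lemma coord_op_add:
  assumes a: "kernel r C a" and f: "f \<in> Hs h" and g: "g \<in> Hs h" and h: "\<And>i. 0 \<le> h i"
  shows "coord_op i a (f + g) = coord_op i a f + coord_op i a g"
  by (rule mfps_eqI)
    (simp add: mcoeff_coord_op distrib_left vsum_add kernel_vanishing[OF a f h] kernel_vanishing[OF a g h])

lemma coord_op_zero [simp]: "coord_op i a 0 = 0"
  by (rule mfps_eqI) (simp add: mcoeff_coord_op)

lemma coord_op_mconst:
  assumes a: "kernel r C a" and f: "f \<in> Hs h" and h: "\<And>i. 0 \<le> h i"
  shows "coord_op i a (mconst c * f) = mconst c * coord_op i a f"
  by (rule mfps_eqI)
    (simp add: mcoeff_coord_op mult.left_commute[of _ c] vsum_mult_left kernel_vanishing[OF a f h])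

text \<open>Operators in different variables do not interact: multiplication by a polynomial is a finite sum,
  which may be interchanged with the series.\<close>

lemma coord_op_mfps_of_poly:
  assumes a: "kernel r C a" and f: "f \<in> Hs h" and h: "\<And>i. 0 \<le> h i" and ij: "i \<noteq> j"
  shows "coord_op i a (mfps_of_poly j P * f) = mfps_of_poly j P * coord_op i a f"
proof (rule mfps_eqI)
  fix l
  let ?t = "\<lambda>t n. a n (l i) * mcoeff f ((l(j := l j - t))(i := n))"
  have van: "vanishing (?t t)" for t by (rule kernel_vanishing[OF a f h])
  have "mcoeff (coord_op i a (mfps_of_poly j P * f)) l =
    vsum (\<lambda>n. \<Sum>t\<le>l j. coeff P t * ?t t n)"
    unfolding mcoeff_coord_op mcoeff_mfps_of_poly_mult using ij
    by (simp add: sum_distrib_left mult.left_commute fun_upd_twist)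
  also have "\<dots> = (\<Sum>t\<le>l j. coeff P t * vsum (?t t))"
    by (simp add: vsum_sum vanishing_mult_left van vsum_mult_left)
  also have "\<dots> = mcoeff (mfps_of_poly j P * coord_op i a f) l"
    unfolding mcoeff_mfps_of_poly_mult mcoeff_coord_op using ij by simp
  finally show "mcoeff (coord_op i a (mfps_of_poly j P * f)) l =
    mcoeff (mfps_of_poly j P * coord_op i a f) l" .
qed

section \<open>Weierstrass division in one variable\<close>

definition weier_rem :: "'k::finite \<Rightarrow> 'c poly \<Rightarrow> ('k, 'c) mfps \<Rightarrow> ('k, 'c) mfps"
  where "weier_rem i P = coord_op i (rem_kernel P)"

definition weier_quot :: "'k::finite \<Rightarrow> 'c poly \<Rightarrow> ('k, 'c) mfps \<Rightarrow> ('k, 'c) mfps"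
  where "weier_quot i P = coord_op i (quot_kernel P)"

definition deg_less :: "'k \<Rightarrow> nat \<Rightarrow> ('k, 'c) mfps \<Rightarrow> bool"
  where "deg_less i D f \<longleftrightarrow> (\<forall>n. D \<le> n i \<longrightarrow> mcoeff f n = 0)"

text \<open>Both sides are series in the coefficients of \<open>f\<close> along the variable \<open>i\<close>, and by \<open>kernel_division\<close>
  they agree term by term.\<close>

lemma weier_division:
  assumes P: "distinguished r P" and r: "0 < r" and f: "f \<in> Hs h" and h: "\<And>i. 0 \<le> h i"
  shows "f = mfps_of_poly i P * weier_quot i P f + weier_rem i P f"
proof (rule mfps_eqI)
  fix l
  let ?f = "\<lambda>n. mcoeff f (l(i := n))"
  have q: "vanishing (\<lambda>n. quot_kernel P n t * ?f n)" for t
    by (rule kernel_vanishing[OF kernel_quot[OF P r] f h])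
  have m: "vanishing (\<lambda>n. rem_kernel P n t * ?f n)" for t
    by (rule kernel_vanishing[OF kernel_rem[OF P r] f h])
  have "mcoeff (mfps_of_poly i P * weier_quot i P f + weier_rem i P f) l =
    (\<Sum>j\<le>l i. coeff P j * vsum (\<lambda>n. quot_kernel P n (l i - j) * ?f n)) +
      vsum (\<lambda>n. rem_kernel P n (l i) * ?f n)"
    by (simp add: weier_quot_def weier_rem_def mcoeff_mfps_of_poly_mult mcoeff_coord_op)
  also have "\<dots> = vsum (\<lambda>n. (\<Sum>j\<le>l i. coeff P j * (quot_kernel P n (l i - j) * ?f n)) +
      rem_kernel P n (l i) * ?f n)"
    by (subst vsum_add) (simp_all add: m q vanishing_sum vanishing_mult_left vsum_sum vsum_mult_left)
  also have "(\<lambda>n. (\<Sum>j\<le>l i. coeff P j * (quot_kernel P n (l i - j) * ?f n)) +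
      rem_kernel P n (l i) * ?f n) = (\<lambda>n. if n = l i then mcoeff f l else 0)"
  proof
    fix n
    have "(\<Sum>j\<le>l i. coeff P j * (quot_kernel P n (l i - j) * ?f n)) + rem_kernel P n (l i) * ?f n =
      ((\<Sum>j\<le>l i. coeff P j * quot_kernel P n (l i - j)) + rem_kernel P n (l i)) * ?f n"
      by (simp add: distrib_right sum_distrib_right mult.assoc)
    then show "(\<Sum>j\<le>l i. coeff P j * (quot_kernel P n (l i - j) * ?f n)) + rem_kernel P n (l i) * ?f n =
      (if n = l i then mcoeff f l else 0)"
      unfolding kernel_division by simp
  qed
  finally show "mcoeff f l = mcoeff (mfps_of_poly i P * weier_quot i P f + weier_rem i P f) l"
    by (simp add: vsum_single)
qed

text \<open>After a change of the order of summation, the factor of each \<open>mcoeff f n\<close> is the remainder of a multiple of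
  \<open>P\<close>.\<close>

lemma weier_rem_mult:
  assumes P: "distinguished r P" and r: "0 < r" and f: "f \<in> Hs h" and h: "\<And>i. 0 \<le> h i"
  shows "weier_rem i P (mfps_of_poly i P * f) = 0"
proof (rule mfps_eqI)
  fix l
  let ?D = "degree P"
  let ?r = "\<lambda>n. rem_kernel P n (l i)" and ?f = "\<lambda>n. mcoeff f (l(i := n))"
  have van: "vanishing (\<lambda>n. ?r (n + j) * ?f n)" for j
    using kernel_vanishing[OF kernel_shift[OF kernel_rem[OF P r]] f h] by simp
  let ?t = "\<lambda>j n. if j \<le> n then ?r n * ?f (n - j) else 0"
  have van': "vanishing (?t j)" for j
    using van[of j] vanishing_shift[of "?t j" j] by simp
  have "vsum (?t j) = vsum (\<lambda>n. ?r (n + j) * ?f n)" for j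
    using vsum_shift[OF van'[of j], of j] by simp
  have "mcoeff (weier_rem i P (mfps_of_poly i P * f)) l =
    vsum (\<lambda>n. ?r n * (\<Sum>j\<le>n. coeff P j * ?f (n - j)))"
    by (simp add: weier_rem_def mcoeff_mfps_of_poly_mult mcoeff_coord_op)
  also have "(\<lambda>n. ?r n * (\<Sum>j\<le>n. coeff P j * ?f (n - j))) = (\<lambda>n. \<Sum>j\<le>?D. coeff P j * ?t j n)"
  proof
    fix n
    have "(\<Sum>j\<le>?D. coeff P j * ?t j n) = (\<Sum>j\<in>{..?D} \<inter> {..n}. coeff P j * ?t j n)"
      by (intro sum.mono_neutral_right) auto
    also have "\<dots> = (\<Sum>j\<le>n. coeff P j * ?t j n)"
      by (intro sum.mono_neutral_left) (auto simp: coeff_eq_0)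
    also have "\<dots> = ?r n * (\<Sum>j\<le>n. coeff P j * ?f (n - j))"
      by (simp add: sum_distrib_left mult.left_commute)
    finally show "?r n * (\<Sum>j\<le>n. coeff P j * ?f (n - j)) = (\<Sum>j\<le>?D. coeff P j * ?t j n)" ..
  qed
  also have "vsum \<dots> = (\<Sum>j\<le>?D. coeff P j * vsum (?t j))"
    by (simp only: vsum_sum[OF vanishing_mult_left[OF van']] vsum_mult_left[OF van'])
  also have "\<dots> = (\<Sum>j\<le>?D. coeff P j * vsum (\<lambda>n. ?r (n + j) * ?f n))"
    by (simp only: \<open>\<And>j. vsum (?t j) = vsum (\<lambda>n. ?r (n + j) * ?f n)\<close>)
  also have "\<dots> = vsum (\<lambda>n. \<Sum>j\<le>?D. coeff P j * (?r (n + j) * ?f n))"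
    by (simp only: vsum_sum[OF vanishing_mult_left[OF van]] vsum_mult_left[OF van])
  also have "(\<lambda>n. \<Sum>j\<le>?D. coeff P j * (?r (n + j) * ?f n)) = (\<lambda>n. 0)"
    by (simp add: rem_kernel_annihilates mult.assoc[symmetric] sum_distrib_right[symmetric])
  finally show "mcoeff (weier_rem i P (mfps_of_poly i P * f)) l = mcoeff 0 l" by simp
qed

lemma deg_less_weier_rem: "0 < degree P \<Longrightarrow> deg_less i (degree P) (weier_rem i P f)"
  by (simp add: deg_less_def weier_rem_def mcoeff_coord_op rem_kernel_eq_0)

lemma deg_less_coord_op: "i \<noteq> j \<Longrightarrow> deg_less j D f \<Longrightarrow> deg_less j D (coord_op i a f)"
  by (simp add: deg_less_def mcoeff_coord_op)

lemma weier_rem_deg_less: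
  assumes "deg_less i (degree P) f" shows "weier_rem i P f = f"
proof (rule mfps_eqI)
  fix l
  have "rem_kernel P n (l i) * mcoeff f (l(i := n)) = (if n = l i then mcoeff f l else 0)" for n
  proof (cases "n < degree P")
    case True
    then show ?thesis by (simp add: rem_kernel_less)
  next
    case False
    then have "mcoeff f (l(i := n)) = 0" using assms by (simp add: deg_less_def)
    then show ?thesis by (auto simp: fun_upd_idem)
  qed
  then show "mcoeff (weier_rem i P f) l = mcoeff f l"
    by (simp add: weier_rem_def mcoeff_coord_op vsum_single)
qed

end

section \<open>The polynomials defining the levels\<close>

text \<open>In \<open>n * (p ^ m choose n) = p ^ m * (p ^ m - 1 choose n - 1)\<close> the factor \<open>n\<close> accounts for fewer than
  \<open>ell p n\<close> factors \<open>p\<close>.\<close>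

lemma prime_power_dvd_choose:
  fixes p n m :: nat
  assumes p: "prime p" and n: "0 < n"
  shows "p ^ (m + 1 - ell p n) dvd (p ^ m choose n)"
proof -
  obtain n' s where n': "n = n' * p ^ s" "\<not> p dvd n'"
    by (rule multiplicity_decompose'[of n p]) (use n p in \<open>auto simp: mult.commute\<close>)
  have cop: "coprime (p ^ (m - s)) n'"
    using n'(2) p by (simp add: prime_imp_coprime)
  have "p ^ s < p ^ ell p n"
  proof -
    have "p ^ s \<le> n" using n' n by simp
    also have "n < p ^ ell p n" using ell_le_iff[of p n "ell p n"] p prime_ge_2_nat by simp
    finally show ?thesis .
  qed
  then have s: "s < ell p n" using p prime_gt_1_nat power_less_imp_less_exp by blast
  have "n * (p ^ m choose n) = p ^ m * (p ^ m - 1 choose (n - 1))"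
    using n times_binomial_minus1_eq by blast
  then have dvd: "p ^ m dvd n' * p ^ s * (p ^ m choose n)" using n'(1) by simp
  show ?thesis
  proof (cases "s \<le> m")
    case True
    then have "p ^ m = p ^ (m - s) * p ^ s" by (simp flip: power_add)
    then have "p ^ (m - s) * p ^ s dvd (n' * (p ^ m choose n)) * p ^ s"
      using dvd by (simp add: mult_ac)
    then have "p ^ (m - s) dvd n' * (p ^ m choose n)" using p prime_gt_0_nat by simp
    then have "p ^ (m - s) dvd (p ^ m choose n)" using cop coprime_dvd_mult_right_iff by blast
    moreover have "m + 1 - ell p n \<le> m - s" using s by simp
    ultimately show ?thesis using le_imp_power_dvd dvd_trans by blast
  next
    case False
    then show ?thesis using s by simp
  qed
qed

lemma coeff_linear_power_eq: "coeff ([:1, 1:] ^ N) n = (of_nat (N choose n) :: 'a::comm_ring_1)"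
proof (cases "n \<le> N")
  case True
  then show ?thesis using coeff_linear_poly_power[of n N 1 1] by simp
next
  case False
  moreover have "degree ([:1, 1:] ^ N :: 'a poly) \<le> N"
    using degree_power_le[of "[:1, 1:] :: 'a poly" N] by simp
  ultimately show ?thesis by (simp add: coeff_eq_0 binomial_eq_0)
qed

context complete_subfield
begin

definition integral_poly :: "'c poly \<Rightarrow> bool"
  where "integral_poly q \<longleftrightarrow> (\<forall>n. coeff q n \<in> K \<and> vge (coeff q n) 0)"

lemma integral_poly_const: "c \<in> K \<Longrightarrow> vge c 0 \<Longrightarrow> integral_poly [:c:]"
  by (auto simp: integral_poly_def coeff_pCons split: nat.splits)

lemma integral_poly_one: "integral_poly 1"
  using integral_poly_const[of 1] by (simp add: one_pCons)

lemma integral_poly_add: "integral_poly q \<Longrightarrow> integral_poly q' \<Longrightarrow> integral_poly (q + q')"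
  by (auto simp: integral_poly_def intro: K_add vge_add)

lemma integral_poly_diff: "integral_poly q \<Longrightarrow> integral_poly q' \<Longrightarrow> integral_poly (q - q')"
  by (auto simp: integral_poly_def intro: K_diff vge_diff)

lemma integral_poly_mult:
  assumes "integral_poly q" "integral_poly q'" shows "integral_poly (q * q')"
proof -
  have "vge (coeff q a * coeff q' b) 0" for a b
    using assms vge_mult[of "coeff q a" 0 "coeff q' b" 0] by (simp add: integral_poly_def)
  then show ?thesis using assms
    by (auto simp: integral_poly_def coeff_mult intro!: K_sum K_mult vge_sum)
qed

lemma integral_poly_power: "integral_poly q \<Longrightarrow> integral_poly (q ^ n)"
  by (induction n) (auto intro: integral_poly_mult integral_poly_one)

lemma integral_poly_sum: "(\<And>a. a \<in> A \<Longrightarrow> integral_poly (f a)) \<Longrightarrow> integral_poly (\<Sum>a\<in>A. f a)"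
  by (induction A rule: infinite_finite_induct)
    (auto intro: integral_poly_add simp: integral_poly_const[of 0, simplified])

lemma integral_poly_prod: "(\<And>a. a \<in> A \<Longrightarrow> integral_poly (f a)) \<Longrightarrow> integral_poly (\<Prod>a\<in>A. f a)"
  by (induction A rule: infinite_finite_induct) (auto intro: integral_poly_mult integral_poly_one)

text \<open>\<open>W k\<close> bounds the coefficients of a product of \<open>k\<close> factors. Taken with two different weights it gives
  the two bounds for the level polynomials.\<close>

lemma vge_coeff_prod:
  assumes "finite A" "\<And>a n. a \<in> A \<Longrightarrow> vge (coeff (q a) n) (w n)"
    and "W 0 0 \<le> 0" "\<And>k m n. W (Suc k) (m + n) \<le> w m + W k n"
  shows "vge (coeff (\<Prod>a\<in>A. q a) n) (W (card A) n)"
  using assms(1,2)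
proof (induction A arbitrary: n rule: finite_induct)
  case empty
  then show ?case using assms(3) by (cases n) auto
next
  case (insert a A)
  have "vge (coeff (q a) j * coeff (\<Prod>a\<in>A. q a) (n - j)) (W (Suc (card A)) n)" if "j \<le> n" for j
    using assms(4)[of "card A" j "n - j"] insert.prems[of a j] insert.IH[of "n - j"] insert.prems that
    by (intro vge_mult'[where r = "w j" and s = "W (card A) (n - j)"]) auto
  then show ?case using insert.hyps by (auto simp: coeff_mult intro!: vge_sum)
qed

lemma principal_unit_power:
  assumes "vge (x - 1) r" "0 \<le> r" shows "vge x 0" and "vge (x ^ n - 1) r"
proof -
  show x: "vge x 0" using vge_add[of "x - 1" 0 1] vge_mono[OF assms] by simp
  show "vge (x ^ n - 1) r"
  proof (induction n)
    case (Suc n)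
    have "x ^ Suc n - 1 = x * (x ^ n - 1) + (x - 1)" by (simp add: algebra_simps)
    moreover have "vge (x * (x ^ n - 1)) r" using vge_mult[OF x Suc.IH] by simp
    ultimately show ?case using assms(1) by (simp only: vge_add)
  qed simp
qed

lemma principal_unit_inverse:
  assumes "vge (x - 1) r" "0 < r" shows "vge (inverse x - 1) r"
proof -
  have x0: "x \<noteq> 0" using assms by auto
  obtain s where s: "ord x = ereal s"
    using x0 ord_eq_infinity_iff[of x] ord_not_minus_infinity[of x] by (cases "ord x") auto
  have "s \<le> 0"
  proof (rule ccontr)
    assume "\<not> s \<le> 0"
    then have pos: "0 < min r s" using assms by simp
    have "vge x (min r s)" using s by (simp add: vge_def)
    moreover have "vge (x - 1) (min r s)" by (rule vge_mono[OF assms(1)]) simp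
    ultimately have "vge (x - (x - 1)) (min r s)" by (rule vge_diff)
    then have "vge 1 (min r s)" by simp
    then show False using pos by (simp only: vge_one)
  qed
  then have "vge (inverse x) 0" using ord_inverse[OF s] by (simp add: vge_def)
  then have "vge (inverse x * (x - 1)) r" using vge_mult assms(1) by fastforce
  moreover have "inverse x - 1 = - (inverse x * (x - 1))" using x0 by (simp add: algebra_simps)
  ultimately show ?thesis by simp
qed

lemma principal_unit_power_int:
  assumes "vge (x - 1) r" "0 < r" shows "vge (x powi j - 1) r"
  using principal_unit_power(2)[OF assms(1)] principal_unit_power(2)[OF principal_unit_inverse[OF assms]] assms(2)
  by (simp add: power_int_def)

text \<open>Raising to the power \<open>p\<close> moves a principal unit one step closer to \<open>1\<close>.\<close>

lemma principal_unit_power_p: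
  assumes "vge (x - 1) r" "1 \<le> r" shows "vge (x ^ p - 1) (r + 1)"
proof -
  have "x ^ p - 1 = (x - 1) * (\<Sum>i<p. x ^ i)"
    by (rule power_diff_1_eq)
  also have "(\<Sum>i<p. x ^ i) = (\<Sum>i<p. x ^ i - 1) + of_nat p" by (simp add: sum_subtractf)
  finally have *: "x ^ p - 1 = (x - 1) * ((\<Sum>i<p. x ^ i - 1) + of_nat p)" .
  have "vge (x ^ i - 1) 1" for i
    using principal_unit_power(2)[OF vge_mono[OF assms]] by simp
  moreover have "vge (of_nat p) 1" by (simp add: vge_def ord_p one_ereal_def)
  ultimately show ?thesis unfolding * by (intro vge_mult[OF assms(1)] vge_add vge_sum)
qed

lemma principal_unit_power_p_power:
  assumes "vge (x - 1) 1" shows "vge (x ^ (p ^ m) - 1) (real m + 1)"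
proof (induction m)
  case (Suc m)
  have "x ^ (p ^ Suc m) = (x ^ (p ^ m)) ^ p" by (simp only: power_Suc2 power_mult)
  then show ?case using principal_unit_power_p[OF Suc.IH] by (simp add: add_ac)
qed (use assms in simp)

end

locale interpolation_points = complete_subfield p ord K
  for p :: nat and ord :: "'c::{field_char_0, complete_space} \<Rightarrow> ereal" and K +
  fixes u :: "'k::finite \<Rightarrow> 'c" and d e :: "'k \<Rightarrow> int"
  assumes u_K: "u i \<in> K" and u_principal: "vge (u i - 1) 1" and d_le_e: "d i \<le> e i"
begin

definition num_points :: "'k \<Rightarrow> nat"
  where "num_points i = card {d i..e i}"

definition level_factor :: "'k \<Rightarrow> nat \<Rightarrow> int \<Rightarrow> 'c poly"
  where "level_factor i m j = [:1, 1:] ^ (p ^ m) - [:u i powi (j * int (p ^ m)):]"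

definition level_poly :: "'k \<Rightarrow> nat \<Rightarrow> 'c poly"
  where "level_poly i m = (\<Prod>j\<in>{d i..e i}. level_factor i m j)"

definition slope :: "nat \<Rightarrow> real"
  where "slope m = 1 / (real (p ^ m) * (real p - 1))"

abbreviation Om :: "'k \<Rightarrow> nat \<Rightarrow> ('k, 'c) mfps"
  where "Om i m \<equiv> mfps_of_poly i (level_poly i m)"

lemma slope_pos: "0 < slope m"
  using p_gt_1 by (simp add: slope_def)

lemma num_points_pos: "0 < num_points i" and num_points_eq: "real (num_points i) = real_of_int (e i - d i + 1)"
  using d_le_e[of i] by (simp_all add: num_points_def)

lemma Omega_eq: "Omega p (u i) (d i) (e i) m i = Om i m"
proof -
  have "mfps_of_poly i [:1, 1:] = (1 + mvar i :: ('k, 'c) mfps)"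
    using mfps_of_poly_add[of i 1 "[:0, 1:]"] unfolding mfps_of_poly_one mfps_of_poly_var
    by (simp add: one_pCons)
  then show ?thesis
    by (simp add: Omega_def level_poly_def level_factor_def mfps_of_poly_prod mfps_of_poly_diff
        mfps_of_poly_power mfps_of_poly_const)
qed

lemma u_power:
  shows "u i powi (j * int N) = (u i powi j) ^ N" and "u i powi j \<in> K" and "vge (u i powi j - 1) 1"
proof -
  show "u i powi (j * int N) = (u i powi j) ^ N" by (simp add: power_int_mult)
  show "u i powi j \<in> K" by (auto simp: power_int_def intro: K_power K_inverse u_K)
  show "vge (u i powi j - 1) 1" by (rule principal_unit_power_int[OF u_principal]) simp
qed

lemma coeff_level_factor:
  "coeff (level_factor i m j) n =
    (if n = 0 then 1 - u i powi (j * int (p ^ m)) else of_nat (p ^ m choose n))"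
  by (auto simp: level_factor_def coeff_linear_power_eq coeff_pCons split: nat.splits)

lemma level_factor_integral: "integral_poly (level_factor i m j)"
  unfolding level_factor_def
proof (intro integral_poly_diff integral_poly_power)
  show "integral_poly [:1, 1:]" by (auto simp: integral_poly_def coeff_pCons split: nat.splits)
  show "integral_poly [:u i powi (j * int (p ^ m)):]"
    using u_power principal_unit_power(1)[OF u_power(3)] by (intro integral_poly_const) auto
qed

text \<open>At the exponent \<open>0\<close> the bound says that a \<open>p ^ m\<close>-th power of a principal unit is close to \<open>1\<close>,
  elsewhere it is the divisibility of binomial coefficients.\<close>

lemma level_factor_bound: "vge (coeff (level_factor i m j) n) (max 0 (real m + 1 - real (ell p n)))"
proof -
  have "vge (coeff (level_factor i m j) n) (real m + 1 - real (ell p n))"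
  proof (cases "n = 0")
    case True
    have "vge (1 - (u i powi j) ^ (p ^ m)) (real m + 1)"
      using vge_uminus[THEN iffD2, OF principal_unit_power_p_power[OF u_power(3)]] by simp
    then show ?thesis using True unfolding coeff_level_factor u_power(1)
      by (simp add: vge_mono)
  next
    case False
    have "vge (of_nat (p ^ m choose n)) (real (m + 1 - ell p n))"
      using False prime_p by (intro vge_of_nat_dvd prime_power_dvd_choose) auto
    then show ?thesis using False unfolding coeff_level_factor by (auto elim!: vge_mono)
  qed
  then show ?thesis using level_factor_integral by (auto simp: max_def integral_poly_def)
qed

lemma degree_level_factor: "degree (level_factor i m j) = p ^ m" "lead_coeff (level_factor i m j) = 1"
proof -
  have "coeff (level_factor i m j) (p ^ m) = 1" unfolding coeff_level_factor by simp
  moreover have "coeff (level_factor i m j) n = 0" if "n > p ^ m" for n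
    unfolding coeff_level_factor using that by (simp add: binomial_eq_0)
  ultimately have "degree (level_factor i m j) = p ^ m"
    using le_degree[of "level_factor i m j" "p ^ m"] degree_le[of "p ^ m" "level_factor i m j"]
    by (simp add: le_antisym)
  then show "degree (level_factor i m j) = p ^ m" "lead_coeff (level_factor i m j) = 1"
    using \<open>coeff (level_factor i m j) (p ^ m) = 1\<close> by auto
qed

text \<open>Divisibility by \<open>p\<close> suffices: the slope is chosen so that the line stays below \<open>1\<close> on the whole
  range of exponents.\<close>

lemma level_factor_slope:
  "vge (coeff (level_factor i m j) n) ((real (p ^ m) - real n) * slope m)"
proof -
  consider "n < p ^ m" | "n = p ^ m" | "n > p ^ m" by linarith
  then show ?thesis
  proof cases
    case 1
    have "(real (p ^ m) - real n) * slope m \<le> real (p ^ m) * slope m"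
      using slope_pos[of m] by (intro mult_right_mono) auto
    also have "\<dots> = 1 / (real p - 1)" by (simp add: slope_def)
    also have "\<dots> \<le> 1" using p_ge_2 by simp
    finally have "(real (p ^ m) - real n) * slope m \<le> 1" .
    moreover have "ell p n \<le> m" using 1 ell_le_iff[OF p_ge_2] by simp
    ultimately show ?thesis by (intro vge_mono[OF level_factor_bound]) auto
  next
    case 2
    then show ?thesis using degree_level_factor[of i m j] by simp
  next
    case 3
    then show ?thesis using degree_level_factor(1)[of i m j] by (simp add: coeff_eq_0)
  qed
qed

lemma level_poly_integral: "integral_poly (level_poly i m)"
  unfolding level_poly_def by (intro integral_poly_prod level_factor_integral)

lemma degree_level_poly: "degree (level_poly i m) = num_points i * p ^ m"
  and lead_coeff_level_poly: "lead_coeff (level_poly i m) = 1"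
proof -
  have "level_factor i m j \<noteq> 0" for j
    using degree_level_factor(2)[of i m j] by auto
  then show "degree (level_poly i m) = num_points i * p ^ m"
    unfolding level_poly_def num_points_def
    by (subst degree_prod_sum_eq) (auto simp: degree_level_factor)
  show "lead_coeff (level_poly i m) = 1"
    unfolding level_poly_def lead_coeff_prod degree_level_factor(2) by simp
qed

lemma distinguished_level_poly: "distinguished (slope m) (level_poly i m)"
proof -
  have "vge (coeff (level_poly i m) n) ((real (num_points i) * real (p ^ m) - real n) * slope m)" for n
    unfolding level_poly_def num_points_def
    by (rule vge_coeff_prod[where W = "\<lambda>k n. (real k * real (p ^ m) - real n) * slope m"])
      (auto intro: level_factor_slope simp: algebra_simps)
  then show ?thesis
    using level_poly_integral[of i m] degree_level_poly[of i m] lead_coeff_level_poly[of i m] num_points_pos[of i]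
    by (auto simp: distinguished_def integral_poly_def)
qed

text \<open>Near the origin the level polynomials are small, by one power of \<open>p\<close> for each interpolation
  point and each level. This is what beats the growth \<open>h\<close>.\<close>

lemma level_poly_bound:
  "vge (coeff (level_poly i m) n) (real (num_points i) * max 0 (real m + 1 - real (ell p n)))"
  unfolding level_poly_def num_points_def
proof (rule vge_coeff_prod[where W = "\<lambda>k n. real k * max 0 (real m + 1 - real (ell p n))"])
  fix k a b
  have "max 0 (real m + 1 - real (ell p (a + b))) \<le> max 0 (real m + 1 - real (ell p a))"
    "max 0 (real m + 1 - real (ell p (a + b))) \<le> max 0 (real m + 1 - real (ell p b))"
    using ell_mono[OF p_ge_2, of a "a + b"] ell_mono[OF p_ge_2, of b "a + b"] by auto
  then show "real (Suc k) * max 0 (real m + 1 - real (ell p (a + b)))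
      \<le> max 0 (real m + 1 - real (ell p a)) + real k * max 0 (real m + 1 - real (ell p b))"
    unfolding of_nat_Suc distrib_right by (simp add: add_mono mult_left_mono)
qed (auto intro: level_factor_bound)

text \<open>Each factor of level \<open>m + 1\<close> is a difference of \<open>p\<close>-th powers, hence divisible by the corresponding
  difference of bases, which is the factor of level \<open>m\<close>.\<close>

lemma level_poly_Suc: "\<exists>q. integral_poly q \<and> level_poly i (Suc m) = level_poly i m * q"
proof -
  let ?y = "\<lambda>j. [:u i powi (j * int (p ^ m)):]"
  let ?q = "\<lambda>j. \<Sum>k<p. ?y j ^ (p - Suc k) * ([:1, 1:] ^ (p ^ m)) ^ k"
  have const_power: "[:c:] ^ n = [:c ^ n:]" for c :: 'c and n
    by (induction n) (simp_all add: one_pCons)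
  have "integral_poly (?q j)" for j
  proof (intro integral_poly_sum integral_poly_mult integral_poly_power)
    show "integral_poly [:1, 1:]" by (auto simp: integral_poly_def coeff_pCons split: nat.splits)
    show "integral_poly (?y j)"
      using u_power principal_unit_power(1)[OF u_power(3)] by (intro integral_poly_const) auto
  qed
  then have q: "integral_poly (\<Prod>j\<in>{d i..e i}. ?q j)" by (intro integral_poly_prod)
  have factor: "level_factor i (Suc m) j = level_factor i m j * ?q j" for j
  proof -
    have "level_factor i (Suc m) j = ([:1, 1:] ^ (p ^ m)) ^ p - ?y j ^ p"
      unfolding level_factor_def u_power(1) const_power by (simp only: power_Suc2 power_mult)
    also have "\<dots> = level_factor i m j * ?q j"
      unfolding level_factor_def by (rule power_diff_sumr2)
    finally show ?thesis .
  qed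
  have "level_poly i (Suc m) = level_poly i m * (\<Prod>j\<in>{d i..e i}. ?q j)"
    unfolding level_poly_def factor by (rule prod.distrib)
  with q show ?thesis by (intro exI conjI)
qed

section \<open>Division in all variables\<close>

lemma Om_Hs: "Om i m \<in> Hs (\<lambda>_. 0)"
  by (rule HsI[where c = 0])
    (use level_poly_integral[of i m] in \<open>auto simp: bd_def mfps_of_poly_def integral_poly_def\<close>)

lemma integral_poly_Hs: "integral_poly q \<Longrightarrow> mfps_of_poly i q \<in> Hs (\<lambda>_. 0)"
  by (rule HsI[where c = 0]) (auto simp: bd_def mfps_of_poly_def integral_poly_def)

text \<open>For \<open>h = 0\<close> this is the ideal generated by the level polynomials in the ring of bounded series, in
  general it is the submodule that they generate in the series of growth \<open>h\<close>.\<close>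

definition level_span :: "('k \<Rightarrow> real) \<Rightarrow> ('k \<Rightarrow> nat) \<Rightarrow> ('k, 'c) mfps set"
  where "level_span h m = {(\<Sum>i\<in>UNIV. Om i (m i) * g i) |g. \<forall>i. g i \<in> Hs h}"

lemma level_spanI: "(\<And>i. g i \<in> Hs h) \<Longrightarrow> (\<Sum>i\<in>UNIV. Om i (m i) * g i) \<in> level_span h m"
  unfolding level_span_def by blast

lemma level_spanE:
  assumes "f \<in> level_span h m"
  obtains g where "\<And>i. g i \<in> Hs h" "f = (\<Sum>i\<in>UNIV. Om i (m i) * g i)"
  using assms unfolding level_span_def by blast

lemma level_span_zero: "0 \<in> level_span h m"
  using level_spanI[of "\<lambda>_. 0" h m] by simp

lemma level_span_add:
  assumes "f \<in> level_span h m" "g \<in> level_span h m" shows "f + g \<in> level_span h m"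
proof -
  obtain a where "\<And>i. a i \<in> Hs h" "f = (\<Sum>i\<in>UNIV. Om i (m i) * a i)"
    using assms(1) by (rule level_spanE) blast
  moreover obtain b where "\<And>i. b i \<in> Hs h" "g = (\<Sum>i\<in>UNIV. Om i (m i) * b i)"
    using assms(2) by (rule level_spanE) blast
  ultimately show ?thesis
    using level_spanI[of "\<lambda>i. a i + b i" h m] by (simp add: Hs_add distrib_left sum.distrib)
qed

lemma level_span_mult:
  assumes h: "\<And>i. 0 \<le> h i" and a: "a \<in> Hs (\<lambda>_. 0)" and f: "f \<in> level_span h m"
  shows "a * f \<in> level_span h m"
proof -
  obtain g where "\<And>i. g i \<in> Hs h" "f = (\<Sum>i\<in>UNIV. Om i (m i) * g i)"
    using f by (rule level_spanE) blast
  then show ?thesis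
    using level_spanI[of "\<lambda>i. a * g i" h m] Hs_mult[OF h a]
    by (simp add: sum_distrib_left mult.left_commute)
qed

lemma mconst_Hs: "c \<in> K \<Longrightarrow> mconst c \<in> Hs (\<lambda>_. 0)"
proof (cases "c = 0")
  case True
  then show ?thesis by (intro HsI[where c = 0]) (auto simp: bd_def mconst.rep_eq)
next
  case False
  assume "c \<in> K"
  moreover obtain s where "ord c = ereal s"
    using False ord_eq_infinity_iff[of c] ord_not_minus_infinity[of c] by (cases "ord c") auto
  ultimately show ?thesis by (intro HsI[where c = s]) (auto simp: bd_def mconst.rep_eq vge_def)
qed

lemma level_span_uminus:
  assumes "\<And>i. 0 \<le> h i" "f \<in> level_span h m" shows "- f \<in> level_span h m"
proof -
  have "(-1 :: ('k, 'c) mfps) \<in> Hs (\<lambda>_. 0)"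
    using Hs_uminus[OF integral_poly_Hs[OF integral_poly_one]] by (simp add: mfps_of_poly_one)
  from level_span_mult[OF assms(1) this assms(2)] show ?thesis by simp
qed

lemma level_span_diff:
  assumes "\<And>i. 0 \<le> h i" "f \<in> level_span h m" "g \<in> level_span h m" shows "f - g \<in> level_span h m"
  using level_span_add[OF assms(2) level_span_uminus[OF assms(1,3)]] by simp

lemma Om_mult_level_span:
  assumes "g \<in> Hs h" shows "Om i (m i) * g \<in> level_span h m"
proof -
  have "(\<Sum>j\<in>UNIV. Om j (m j) * (if j = i then g else 0)) = Om i (m i) * g"
    by (subst sum.remove[of _ i]) auto
  then show ?thesis using level_spanI[of "\<lambda>j. if j = i then g else 0" h m] assms by auto
qed

lemma level_poly_dvd:
  assumes "m \<le> m'" shows "\<exists>q. integral_poly q \<and> level_poly i m' = level_poly i m * q"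
  using assms
proof (induction m' rule: dec_induct)
  case base
  then show ?case by (intro exI[of _ 1]) (simp add: integral_poly_one)
next
  case (step m')
  then obtain q where "integral_poly q" "level_poly i m' = level_poly i m * q" by blast
  moreover obtain q' where "integral_poly q'" "level_poly i (Suc m') = level_poly i m' * q'"
    using level_poly_Suc by blast
  ultimately show ?case
    by (intro exI[of _ "q * q'"]) (simp add: integral_poly_mult mult.assoc)
qed

lemma level_span_antimono:
  assumes h: "\<And>i. 0 \<le> h i" and m: "m \<le> m'" shows "level_span h m' \<subseteq> level_span h m"
proof
  fix f assume "f \<in> level_span h m'"
  then obtain g where g: "\<And>i. g i \<in> Hs h" "f = (\<Sum>i\<in>UNIV. Om i (m' i) * g i)"
    by (rule level_spanE) blast
  have "\<exists>q. \<forall>i. integral_poly (q i) \<and> level_poly i (m' i) = level_poly i (m i) * q i"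
    using level_poly_dvd m by (intro choice) (auto simp: le_fun_def)
  then obtain q where q: "\<And>i. integral_poly (q i)" "\<And>i. level_poly i (m' i) = level_poly i (m i) * q i"
    by blast
  have "f = (\<Sum>i\<in>UNIV. Om i (m i) * (mfps_of_poly i (q i) * g i))"
    unfolding g(2) q(2) by (simp add: mfps_of_poly_mult mult.assoc)
  then show "f \<in> level_span h m"
    using level_spanI[of "\<lambda>i. mfps_of_poly i (q i) * g i" h m] Hs_mult[OF h integral_poly_Hs[OF q(1)] g(1)]
    by auto
qed

definition reduced :: "('k \<Rightarrow> nat) \<Rightarrow> ('k, 'c) mfps \<Rightarrow> bool"
  where "reduced m f \<longleftrightarrow> (\<forall>i. deg_less i (degree (level_poly i (m i))) f)"

text \<open>The variables are divided out in the order of a fixed list. The result does not depend on the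
  order, as the reduced representative is unique.\<close>

definition rem_list :: "'k list \<Rightarrow> ('k \<Rightarrow> nat) \<Rightarrow> ('k, 'c) mfps \<Rightarrow> ('k, 'c) mfps"
  where "rem_list xs m = fold (\<lambda>i. weier_rem i (level_poly i (m i))) xs"

definition vars :: "'k list"
  where "vars = (SOME xs. set xs = UNIV \<and> distinct xs)"

definition Rem :: "('k \<Rightarrow> nat) \<Rightarrow> ('k, 'c) mfps \<Rightarrow> ('k, 'c) mfps"
  where "Rem = rem_list vars"

lemma vars: "set vars = UNIV" "distinct vars"
proof -
  have "\<exists>xs :: 'k list. set xs = UNIV \<and> distinct xs"
    by (rule finite_distinct_list) simp
  then have "set vars = UNIV \<and> distinct vars" unfolding vars_def by (rule someI_ex)
  then show "set vars = UNIV" "distinct vars" by auto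
qed

lemma rem_list_simps [simp]:
  "rem_list [] m f = f" "rem_list (i # xs) m f = rem_list xs m (weier_rem i (level_poly i (m i)) f)"
  by (simp_all add: rem_list_def)

lemma level_kernel_rem: "kernel (slope m) 0 (rem_kernel (level_poly i m))"
  by (rule kernel_rem[OF distinguished_level_poly slope_pos])

lemma level_rem_Hs: "f \<in> Hs h \<Longrightarrow> (\<And>i. 0 \<le> h i) \<Longrightarrow> weier_rem i (level_poly i m) f \<in> Hs h"
  unfolding weier_rem_def by (rule coord_op_Hs[OF level_kernel_rem])

lemma level_quot_Hs: "f \<in> Hs h \<Longrightarrow> (\<And>i. 0 \<le> h i) \<Longrightarrow> weier_quot i (level_poly i m) f \<in> Hs h"
  unfolding weier_quot_def by (rule coord_op_Hs[OF kernel_quot[OF distinguished_level_poly slope_pos]])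

lemma rem_list_Hs: "f \<in> Hs h \<Longrightarrow> (\<And>i. 0 \<le> h i) \<Longrightarrow> rem_list xs m f \<in> Hs h"
  by (induction xs arbitrary: f) (simp_all add: level_rem_Hs)

lemma rem_list_zero [simp]: "rem_list xs m 0 = 0"
  by (induction xs) (simp_all add: weier_rem_def)

lemma rem_list_add:
  assumes "\<And>i. 0 \<le> h i" "f \<in> Hs h" "g \<in> Hs h"
  shows "rem_list xs m (f + g) = rem_list xs m f + rem_list xs m g"
  using assms(2,3)
proof (induction xs arbitrary: f g)
  case (Cons i xs)
  have "weier_rem i (level_poly i (m i)) (f + g) =
    weier_rem i (level_poly i (m i)) f + weier_rem i (level_poly i (m i)) g"
    unfolding weier_rem_def by (rule coord_op_add[OF level_kernel_rem Cons.prems assms(1)])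
  then show ?case using Cons.IH level_rem_Hs[OF Cons.prems(1) assms(1)] level_rem_Hs[OF Cons.prems(2) assms(1)]
    by simp
qed simp

lemma rem_list_mconst:
  assumes "\<And>i. 0 \<le> h i" "f \<in> Hs h"
  shows "rem_list xs m (mconst c * f) = mconst c * rem_list xs m f"
  using assms(2)
proof (induction xs arbitrary: f)
  case (Cons i xs)
  have "weier_rem i (level_poly i (m i)) (mconst c * f) = mconst c * weier_rem i (level_poly i (m i)) f"
    unfolding weier_rem_def by (rule coord_op_mconst[OF level_kernel_rem Cons.prems assms(1)])
  then show ?case
    by (simp only: rem_list_simps Cons.IH[OF level_rem_Hs[OF Cons.prems assms(1)]])
qed simp

lemma rem_list_span:
  assumes "\<And>i. 0 \<le> h i" "f \<in> Hs h"
  shows "f - rem_list xs m f \<in> level_span h m"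
  using assms(2)
proof (induction xs arbitrary: f)
  case (Cons i xs)
  let ?P = "level_poly i (m i)"
  have "f = Om i (m i) * weier_quot i ?P f + weier_rem i ?P f"
    by (rule weier_division[OF distinguished_level_poly slope_pos Cons.prems assms(1)])
  then have "f - weier_rem i ?P f = Om i (m i) * weier_quot i ?P f" by (metis add_diff_cancel_right')
  then have "f - weier_rem i ?P f \<in> level_span h m"
    using Om_mult_level_span[OF level_quot_Hs[OF Cons.prems assms(1)]] by simp
  from level_span_add[OF this Cons.IH[OF level_rem_Hs[OF Cons.prems assms(1), of i "m i"]]]
  show ?case by simp
qed (simp add: level_span_zero)

text \<open>The divisions in the other variables commute with the factor, until the variable \<open>i\<close> has its turn
  and the remainder becomes zero.\<close>

lemma rem_list_Om_mult:
  assumes "\<And>i. 0 \<le> h i" "g \<in> Hs h" "i \<in> set xs"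
  shows "rem_list xs m (Om i (m i) * g) = 0"
  using assms(2,3)
proof (induction xs arbitrary: g)
  case (Cons j xs)
  show ?case
  proof (cases "j = i")
    case True
    then show ?thesis
      using weier_rem_mult[OF distinguished_level_poly slope_pos Cons.prems(1) assms(1)] by simp
  next
    case False
    then have "weier_rem j (level_poly j (m j)) (Om i (m i) * g) =
        Om i (m i) * weier_rem j (level_poly j (m j)) g"
      unfolding weier_rem_def
      by (intro coord_op_mfps_of_poly[OF level_kernel_rem Cons.prems(1) assms(1)])
    then show ?thesis using Cons.IH[OF level_rem_Hs[OF Cons.prems(1) assms(1)]] Cons.prems(2) False
      by simp
  qed
qed simp

lemma degree_level_poly_pos: "0 < degree (level_poly i m)"
  using num_points_pos by (simp add: degree_level_poly)

lemma deg_less_level_rem: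
  "deg_less i (degree (level_poly i (m i))) f \<Longrightarrow>
    deg_less i (degree (level_poly i (m i))) (weier_rem j (level_poly j (m j)) f)"
  using deg_less_weier_rem[OF degree_level_poly_pos]
  by (cases "i = j") (auto simp: weier_rem_def intro: deg_less_coord_op)

lemma deg_less_rem_list:
  "i \<in> set xs \<or> deg_less i (degree (level_poly i (m i))) f \<Longrightarrow>
    deg_less i (degree (level_poly i (m i))) (rem_list xs m f)"
proof (induction xs arbitrary: f)
  case (Cons j xs)
  have "deg_less j (degree (level_poly j (m j))) (weier_rem j (level_poly j (m j)) f)"
    by (rule deg_less_weier_rem[OF degree_level_poly_pos])
  then have "i \<in> set xs \<or> deg_less i (degree (level_poly i (m i))) (weier_rem j (level_poly j (m j)) f)"
    using Cons.prems deg_less_level_rem[of i m f j] by auto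
  then show ?case using Cons.IH by simp
qed simp

lemma rem_list_reduced: "reduced m f \<Longrightarrow> rem_list xs m f = f"
  by (induction xs) (simp_all add: reduced_def weier_rem_deg_less)

lemma reduced_Rem: "reduced m (Rem m f)"
  unfolding reduced_def Rem_def by (simp add: deg_less_rem_list vars)

lemma Rem_reduced: "reduced m f \<Longrightarrow> Rem m f = f"
  unfolding Rem_def by (rule rem_list_reduced)

lemma Rem_Hs: "f \<in> Hs h \<Longrightarrow> (\<And>i. 0 \<le> h i) \<Longrightarrow> Rem m f \<in> Hs h"
  unfolding Rem_def by (rule rem_list_Hs)

lemma Rem_add: "(\<And>i. 0 \<le> h i) \<Longrightarrow> f \<in> Hs h \<Longrightarrow> g \<in> Hs h \<Longrightarrow> Rem m (f + g) = Rem m f + Rem m g"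
  unfolding Rem_def by (rule rem_list_add)

lemma Rem_diff:
  assumes "\<And>i. 0 \<le> h i" "f \<in> Hs h" "g \<in> Hs h" shows "Rem m (f - g) = Rem m f - Rem m g"
  using Rem_add[OF assms(1) Hs_diff[OF assms(2,3)] assms(3), of m] by simp

lemma Rem_mconst: "(\<And>i. 0 \<le> h i) \<Longrightarrow> f \<in> Hs h \<Longrightarrow> Rem m (mconst c * f) = mconst c * Rem m f"
  unfolding Rem_def by (rule rem_list_mconst)

lemma Rem_span: "(\<And>i. 0 \<le> h i) \<Longrightarrow> f \<in> Hs h \<Longrightarrow> f - Rem m f \<in> level_span h m"
  unfolding Rem_def by (rule rem_list_span)

lemma Rem_level_span:
  assumes "\<And>i. 0 \<le> h i" "f \<in> level_span h m" shows "Rem m f = 0"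
proof -
  obtain g where g: "\<And>i. g i \<in> Hs h" "f = (\<Sum>i\<in>UNIV. Om i (m i) * g i)"
    using assms(2) by (rule level_spanE) blast
  have "Rem m (\<Sum>i\<in>A. Om i (m i) * g i) = 0" for A
  proof (induction A rule: infinite_finite_induct)
    case (insert i A)
    have Hs: "Om j (m j) * g j \<in> Hs h" for j by (rule Hs_mult[OF assms(1) Om_Hs g(1)])
    have "Rem m (Om i (m i) * g i) = 0"
      unfolding Rem_def by (rule rem_list_Om_mult[OF assms(1) g(1)]) (simp add: vars)
    then show ?case
      using insert by (simp add: Rem_add[OF assms(1) Hs Hs_sum[OF Hs]])
  qed (simp_all add: Rem_def)
  then show ?thesis using g(2) by simp
qed

text \<open>Uniqueness of the reduced representative. It replaces any control over the coefficients in a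
  combination of level polynomials.\<close>

lemma reduced_level_span_eq_0:
  "(\<And>i. 0 \<le> h i) \<Longrightarrow> f \<in> level_span h m \<Longrightarrow> reduced m f \<Longrightarrow> f = 0"
  using Rem_level_span Rem_reduced by metis

lemma level_span_subset_Hs: "(\<And>i. 0 \<le> h i) \<Longrightarrow> level_span h m \<subseteq> Hs h"
  by (auto elim!: level_spanE intro!: Hs_sum Hs_mult Om_Hs)

lemma deg_less_diff: "deg_less i D f \<Longrightarrow> deg_less i D g \<Longrightarrow> deg_less i D (f - g)"
  by (simp add: deg_less_def)

section \<open>The size of remainders\<close>

text \<open>The left hand side is concave in \<open>t\<close>, and the right hand side is its maximum over real \<open>t\<close>.\<close>

lemma exp_tangent_bound:
  assumes "0 < h"
  shows "h * (real t + 1) - real p ^ t / (real p - 1)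
    \<le> h - h / ln (real p) * (1 + ln (ln (real p) / ((real p - 1) * h)))"
proof -
  define L where "L = ln (real p)"
  have L: "0 < L" and p1: "0 < real p - 1" using p_gt_1 by (simp_all add: L_def)
  define b where "b = h / L"
  have b: "0 < b" "b * L = h" using assms L by (simp_all add: b_def)
  \<comment> \<open>The maximum is attained where \<open>real p powr t = q\<close>; the bound is the tangent of the exponential
    function there.\<close>
  define q where "q = b * (real p - 1)"
  have q: "0 < q" using b p1 by (simp add: q_def)
  have "real p ^ t = exp (real t * L)"
    unfolding L_def using p_gt_1 by (simp add: exp_of_nat_mult)
  also have "\<dots> = q * exp (real t * L - ln q)" using q by (simp add: exp_diff)
  also have "\<dots> \<ge> q * (1 + (real t * L - ln q))"
    using q exp_ge_add_one_self by (intro mult_left_mono) auto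
  finally have "real p ^ t / (real p - 1) \<ge> q * (1 + (real t * L - ln q)) / (real p - 1)"
    using p1 by (intro divide_right_mono) auto
  moreover have "q * (1 + (real t * L - ln q)) / (real p - 1) = b * (1 + (real t * L - ln q))"
    using p1 by (simp add: q_def)
  moreover have "\<dots> = b * (1 - ln q) + (b * L) * real t" by (simp add: algebra_simps)
  moreover have "L / ((real p - 1) * h) = inverse q"
    using L p1 assms by (simp add: q_def b_def field_simps)
  then have "b * (1 + ln (L / ((real p - 1) * h))) = b * (1 - ln q)"
    using q by (simp add: ln_inverse)
  moreover have "h * (real t + 1) = h * real t + h" by (simp add: distrib_left)
  ultimately show ?thesis
    unfolding L_def[symmetric] b(2) b_def[symmetric] by linarith
qed

lemma alpha_const_ge:
  assumes "0 < h"
  shows "real (num_points i) / (real p - 1) +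
      max 0 (h - h / ln (real p) * (1 + ln (ln (real p) / ((real p - 1) * h))))
    \<le> real_of_int (alpha_const p h (d i) (e i))"
  unfolding alpha_const_def num_points_eq using assms by (simp del: of_int_add of_int_diff) linarith

text \<open>For \<open>l < degree P\<close> the valuation is at least \<open>(n - degree P) * slope m\<close>. Here \<open>degree P * slope m\<close>
  is the first summand of \<open>\<alpha>\<close>. If \<open>ell p n = m + t + 1\<close>, then \<open>n \<ge> p ^ (m + t)\<close>, and the second
  summand bounds \<open>h * (t + 1)\<close> minus \<open>n * slope m\<close> for every \<open>t\<close>.\<close>

lemma rem_kernel_alpha:
  assumes h: "0 \<le> h"
  shows "vge (rem_kernel (level_poly i m) n l)
    (h * real (ell p n) - (h * real m + real_of_int (alpha_const p h (d i) (e i))))"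
proof (cases "h = 0")
  case True
  then show ?thesis using level_kernel_rem[of m i] by (simp add: alpha_const_def kernel_def)
next
  case False
  with h have h: "0 < h" by simp
  let ?A = "real_of_int (alpha_const p h (d i) (e i))"
  let ?M = "max 0 (h - h / ln (real p) * (1 + ln (ln (real p) / ((real p - 1) * h))))"
  have A: "real (num_points i) / (real p - 1) + ?M \<le> ?A" by (rule alpha_const_ge[OF h])
  have p1: "0 < real p - 1" using p_gt_1 by simp
  have E: "0 \<le> real (num_points i) / (real p - 1)" using p1 by simp
  have v0: "vge (rem_kernel (level_poly i m) n l) 0"
    and v: "vge (rem_kernel (level_poly i m) n l) ((real n - real l) * slope m)"
    using level_kernel_rem[of m i] by (simp_all add: kernel_def)
  consider "ell p n \<le> m" | "degree (level_poly i m) \<le> l" | t where "ell p n = Suc (m + t)" "l < degree (level_poly i m)"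
    by (metis not_le less_imp_Suc_add)
  then show ?thesis
  proof cases
    case 1
    then have "h * real (ell p n) \<le> h * real m" using h by simp
    with A E show ?thesis by (intro vge_mono[OF v0]) linarith
  next
    case 2
    then show ?thesis using rem_kernel_eq_0[OF degree_level_poly_pos 2] by simp
  next
    case 3
    have "real l \<le> real (num_points i * p ^ m)"
      using 3(2) unfolding degree_level_poly by (simp only: of_nat_le_iff less_imp_le)
    then have "real l * slope m \<le> real (num_points i) * real (p ^ m) * slope m"
      using slope_pos[of m] unfolding of_nat_mult by (intro mult_right_mono) auto
    also have "\<dots> = real (num_points i) / (real p - 1)" by (simp add: slope_def)
    finally have l: "real l * slope m \<le> real (num_points i) / (real p - 1)" .
    have "real p ^ t / (real p - 1) = real (p ^ (m + t)) * slope m"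
      using p_gt_1 by (simp add: slope_def power_add)
    also have "\<dots> \<le> real n * slope m"
      using power_ell_le[OF p_ge_2 3(1)] slope_pos[of m] by (intro mult_right_mono) (simp_all only: of_nat_le_iff less_imp_le)
    finally have n: "real p ^ t / (real p - 1) \<le> real n * slope m" .
    have "h * (real t + 1) \<le> real p ^ t / (real p - 1) + ?M"
      using exp_tangent_bound[OF h, of t] by simp
    moreover have "h * real (ell p n) = h * real m + h * (real t + 1)"
      unfolding 3(1) by (simp add: algebra_simps)
    moreover have "(real n - real l) * slope m = real n * slope m - real l * slope m"
      by (rule left_diff_distrib)
    ultimately show ?thesis using A l n by (intro vge_mono[OF v]) linarith
  qed
qed

text \<open>The remainder of level \<open>m\<close> costs \<open>h i * m i\<close> and a constant in each variable.\<close>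

definition level_cost :: "('k \<Rightarrow> real) \<Rightarrow> ('k \<Rightarrow> nat) \<Rightarrow> real"
  where "level_cost h m = (\<Sum>i\<in>UNIV. h i * real (m i))"

definition alpha_sum :: "('k \<Rightarrow> real) \<Rightarrow> real"
  where "alpha_sum h = (\<Sum>i\<in>UNIV. real_of_int (alpha_const p (h i) (d i) (e i)))"

text \<open>Each division exchanges, in its own variable, the weight of the exponent for the cost of the level;
  \<open>S\<close> is the set of variables already treated.\<close>

lemma rem_list_alpha:
  fixes h :: "'k \<Rightarrow> real"
  defines "\<alpha> i \<equiv> real_of_int (alpha_const p (h i) (d i) (e i))"
  defines "W S m n \<equiv> \<Sum>i\<in>UNIV. if i \<in> S then h i * real (m i) + \<alpha> i else h i * real (ell p (n i))"
  assumes h: "\<And>i. 0 \<le> h i" and f: "f \<in> Hs h" "\<And>n. vge (mcoeff f n) (c - W S m n)"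
    and xs: "distinct xs" "set xs \<inter> S = {}"
  shows "vge (mcoeff (rem_list xs m f) n) (c - W (S \<union> set xs) m n)"
  using f xs
proof (induction xs arbitrary: f S)
  case (Cons i xs)
  let ?g = "weier_rem i (level_poly i (m i)) f"
  have "vge (mcoeff ?g l) (c - W (insert i S) m l)" for l
    unfolding weier_rem_def
  proof (rule vge_coord_op[OF level_kernel_rem Cons.prems(1) h])
    fix n
    have split: "W S' m n' = (if i \<in> S' then h i * real (m i) + \<alpha> i else h i * real (ell p (n' i))) +
        (\<Sum>j\<in>UNIV - {i}. if j \<in> S' then h j * real (m j) + \<alpha> j else h j * real (ell p (n' j)))" for S' n'
      unfolding W_def by (rule sum.remove) auto
    have "(\<Sum>j\<in>UNIV - {i}. if j \<in> S then h j * real (m j) + \<alpha> j else h j * real (ell p ((l(i := n)) j))) =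
      (\<Sum>j\<in>UNIV - {i}. if j \<in> insert i S then h j * real (m j) + \<alpha> j else h j * real (ell p (l j)))"
      by (rule sum.cong) auto
    then have eq: "W S m (l(i := n)) = W (insert i S) m l - (h i * real (m i) + \<alpha> i) + h i * real (ell p n)"
      using Cons.prems(4) split[of S "l(i := n)"] split[of "insert i S" l] by simp
    have "vge (rem_kernel (level_poly i (m i)) n (l i)) (h i * real (ell p n) - (h i * real (m i) + \<alpha> i))"
      unfolding \<alpha>_def by (rule rem_kernel_alpha[OF h])
    then show "vge (rem_kernel (level_poly i (m i)) n (l i) * mcoeff f (l(i := n))) (c - W (insert i S) m l)"
      by (rule vge_mult'[OF _ Cons.prems(2)[of "l(i := n)"]]) (use eq in linarith)
  qed
  then have "vge (mcoeff (rem_list xs m ?g) n) (c - W (insert i S \<union> set xs) m n)"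
    using Cons.prems level_rem_Hs[OF Cons.prems(1) h] by (intro Cons.IH) auto
  then show ?case by simp
qed simp

lemma Rem_alpha:
  assumes h: "\<And>i. 0 \<le> h i" and f: "f \<in> Hs h" "bd h c f"
  shows "vge (mcoeff (Rem m f) n) (c - alpha_sum h - level_cost h m)"
proof -
  have "vge (mcoeff f n) (c - (\<Sum>i\<in>UNIV. if i \<in> {}
      then h i * real (m i) + real_of_int (alpha_const p (h i) (d i) (e i)) else h i * real (ell p (n i))))" for n
    using f(2) by (simp add: bd_def wt_def)
  then have "vge (mcoeff (rem_list vars m f) n) (c - (\<Sum>i\<in>UNIV. if i \<in> {} \<union> set vars
      then h i * real (m i) + real_of_int (alpha_const p (h i) (d i) (e i)) else h i * real (ell p (n i))))"
    by (rule rem_list_alpha[OF h f(1) _ vars(2)]) simp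
  then show ?thesis
    by (simp add: Rem_def vars alpha_sum_def level_cost_def sum.distrib algebra_simps)
qed

section \<open>Compatible families of remainders and their limits\<close>

text \<open>The reduced representatives of an element of \<open>J\<close>, where \<open>c\<close> measures its denominator.\<close>

definition compatible :: "('k \<Rightarrow> real) \<Rightarrow> real \<Rightarrow> (('k \<Rightarrow> nat) \<Rightarrow> ('k, 'c) mfps) \<Rightarrow> bool"
  where "compatible h c r \<longleftrightarrow>
    (\<forall>m. r m \<in> Hs h \<and> reduced m (r m)) \<and>
    (\<forall>m m'. m \<le> m' \<longrightarrow> r m' - r m \<in> level_span h m) \<and>
    (\<forall>m n. vge (mcoeff (r m) n) (c - level_cost h m))"

abbreviation Er :: "'k \<Rightarrow> real"
  where "Er i \<equiv> real (num_points i)"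

text \<open>The difference lies in the submodule generated by all level polynomials, but it is already reduced
  in the variables other than \<open>i\<close>. So its remainder in the variable \<open>i\<close> is reduced and lies in the
  submodule, which forces it to vanish.\<close>

lemma compatible_step:
  assumes r: "compatible h c r" and h: "\<And>i. 0 \<le> h i"
  defines "\<delta> m i t \<equiv> r (m(i := Suc t)) - r (m(i := t))"
  shows "\<delta> m i t \<in> Hs h" "\<delta> m i t = Om i t * weier_quot i (level_poly i t) (\<delta> m i t)"
proof -
  let ?m = "m(i := t)" and ?P = "level_poly i t"
  let ?R = "weier_rem i ?P (\<delta> m i t)"
  have span: "\<delta> m i t \<in> level_span h ?m"
    using r unfolding compatible_def \<delta>_def by (auto simp: le_fun_def)
  then show Hs: "\<delta> m i t \<in> Hs h" using level_span_subset_Hs[of h, OF h] by blast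
  have div: "\<delta> m i t = Om i t * weier_quot i ?P (\<delta> m i t) + ?R"
    by (rule weier_division[OF distinguished_level_poly slope_pos Hs h])
  then have "?R = \<delta> m i t - Om i t * weier_quot i ?P (\<delta> m i t)" by (metis add_diff_cancel_left')
  moreover have "Om i (?m i) * weier_quot i ?P (\<delta> m i t) \<in> level_span h ?m"
    by (rule Om_mult_level_span[OF level_quot_Hs[OF Hs h]])
  ultimately have R: "?R \<in> level_span h ?m" using level_span_diff[OF h span] by simp
  have "deg_less j (degree (level_poly j (?m j))) ?R" for j
  proof (cases "j = i")
    case True
    then show ?thesis using deg_less_weier_rem[OF degree_level_poly_pos] by simp
  next
    case False
    have "deg_less j (degree (level_poly j ((m(i := t')) j))) (r (m(i := t')))" for t'
      using r unfolding compatible_def reduced_def by blast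
    from this[of t] this[of "Suc t"] show ?thesis
      using False unfolding weier_rem_def \<delta>_def by (auto intro: deg_less_coord_op deg_less_diff)
  qed
  then have "?R = 0" using reduced_level_span_eq_0[OF h R] by (simp add: reduced_def)
  then show "\<delta> m i t = Om i t * weier_quot i ?P (\<delta> m i t)" using div by simp
qed

text \<open>The kernel of the quotient is integral, so a bound that does not depend on the exponent of the
  variable \<open>i\<close> passes to the quotient. The level polynomial contributes the second summand.\<close>

lemma Om_quot_bound:
  assumes f: "f \<in> Hs h" "\<And>i. 0 \<le> h i" and b: "\<And>l. vge (mcoeff f l) (b l)" "\<And>l n. b (l(i := n)) = b l"
  shows "vge (mcoeff (Om i t * weier_quot i (level_poly i t) f) l)
    (b l + Er i * max 0 (real t + 1 - real (ell p (l i))))"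
  unfolding mcoeff_mfps_of_poly_mult
proof (rule vge_sum)
  fix j assume j: "j \<in> {..l i}"
  have q: "vge (mcoeff (weier_quot i (level_poly i t) f) l') (b l')" for l'
    unfolding weier_quot_def
  proof (rule vge_coord_op[OF kernel_quot[OF distinguished_level_poly slope_pos] f])
    fix n
    have "vge (quot_kernel (level_poly i t) n (l' i)) 0"
      using quot_kernel_bounds[OF distinguished_level_poly less_imp_le[OF slope_pos]] by blast
    then show "vge (quot_kernel (level_poly i t) n (l' i) * mcoeff f (l'(i := n))) (b l')"
      by (rule vge_mult'[OF _ b(1)]) (simp add: b(2))
  qed
  have "Er i * max 0 (real t + 1 - real (ell p (l i))) \<le> Er i * max 0 (real t + 1 - real (ell p j))"
    using ell_mono[OF p_ge_2, of j "l i"] j by (intro mult_left_mono) auto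
  then show "vge (coeff (level_poly i t) j * mcoeff (weier_quot i (level_poly i t) f) (l(i := l i - j)))
      (b l + Er i * max 0 (real t + 1 - real (ell p (l i))))"
    by (intro vge_mult'[OF level_poly_bound q]) (simp add: b(2))
qed

text \<open>The variables in \<open>S\<close> are measured by the weight of the exponent, the others by the cost of the
  level.\<close>

definition mixed_cost :: "('k \<Rightarrow> real) \<Rightarrow> 'k set \<Rightarrow> ('k \<Rightarrow> nat) \<Rightarrow> ('k \<Rightarrow> nat) \<Rightarrow> real"
  where "mixed_cost h S m n = (\<Sum>i\<in>UNIV. if i \<in> S then h i * real (ell p (n i)) else h i * real (m i))"

lemma mixed_cost_UNIV: "mixed_cost h UNIV m n = wt h n"
  by (simp add: mixed_cost_def wt_def)

lemma mixed_cost_empty: "mixed_cost h {} m n = level_cost h m"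
  by (simp add: mixed_cost_def level_cost_def)

lemma mixed_cost_cong:
  assumes "\<And>j. j \<in> S \<Longrightarrow> n j = n' j" "\<And>j. j \<notin> S \<Longrightarrow> m j = m' j"
  shows "mixed_cost h S m n = mixed_cost h S m' n'"
  unfolding mixed_cost_def by (rule sum.cong) (use assms in auto)

lemma mixed_cost_fun_upd:
  assumes "i \<notin> S"
  shows "mixed_cost h S (m(i := t)) n = mixed_cost h (insert i S) m n - h i * real (ell p (n i)) + h i * real t"
proof -
  have split: "mixed_cost h S' m' n = (if i \<in> S' then h i * real (ell p (n i)) else h i * real (m' i)) +
      (\<Sum>j\<in>UNIV - {i}. if j \<in> S' then h j * real (ell p (n j)) else h j * real (m' j))" for S' m'
    unfolding mixed_cost_def by (rule sum.remove) auto
  have "(\<Sum>j\<in>UNIV - {i}. if j \<in> S then h j * real (ell p (n j)) else h j * real ((m(i := t)) j)) =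
    (\<Sum>j\<in>UNIV - {i}. if j \<in> insert i S then h j * real (ell p (n j)) else h j * real (m j))"
    by (rule sum.cong) auto
  then show ?thesis using assms split[of S "m(i := t)"] split[of "insert i S" m] by simp
qed

lemma compatible_step_bound:
  assumes r: "compatible h c r" and h: "\<And>i. 0 \<le> h i" and i: "i \<notin> S"
    and S: "\<And>m n. vge (mcoeff (r m) n) (c - mixed_cost h S m n)"
  shows "vge (mcoeff (r (m(i := Suc t)) - r (m(i := t))) n)
    (c - mixed_cost h S (m(i := Suc t)) n + Er i * max 0 (real t + 1 - real (ell p (n i))))"
proof -
  let ?\<delta> = "r (m(i := Suc t)) - r (m(i := t))"
  have "mixed_cost h S (m(i := t)) l \<le> mixed_cost h S (m(i := Suc t)) l" for l
    using h[of i] unfolding mixed_cost_fun_upd[OF i] by (simp add: algebra_simps)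
  then have "vge (mcoeff (r (m(i := t))) l) (c - mixed_cost h S (m(i := Suc t)) l)" for l
    by (intro vge_mono[OF S]) simp
  then have "vge (mcoeff ?\<delta> l) (c - mixed_cost h S (m(i := Suc t)) l)" for l
    using S by (auto intro: vge_diff)
  moreover have "c - mixed_cost h S (m(i := Suc t)) (l(i := n)) = c - mixed_cost h S (m(i := Suc t)) l" for l n
    using i by (subst mixed_cost_cong[of S "l(i := n)" l]) auto
  ultimately show ?thesis
    using Om_quot_bound[OF compatible_step(1)[OF r h] h, of m i t "\<lambda>l. c - mixed_cost h S (m(i := Suc t)) l" i t n]
    by (subst compatible_step(2)[OF r h]) blast
qed

text \<open>The cost of a level is traded for the growth weight, one variable after the other: the step
  from \<open>t\<close> to \<open>t + 1\<close> is a multiple of a level polynomial, which is small enough at every exponent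
  whose digit length is below \<open>t + 1\<close>.\<close>

lemma compatible_mixed:
  assumes r: "compatible h c r" and h: "\<And>i. 0 \<le> h i" "\<And>i. h i \<le> Er i"
  shows "vge (mcoeff (r m) n) (c - mixed_cost h S m n)"
  using finite[of S]
proof (induction S arbitrary: m n rule: finite_induct)
  case empty
  then show ?case using r by (simp add: compatible_def mixed_cost_empty)
next
  case (insert i S)
  let ?B = "c - mixed_cost h (insert i S) m n"
  have "vge (mcoeff (r (m(i := t))) n) ?B" for t
  proof (induction t)
    case 0
    show ?case
      by (rule vge_mono[OF insert.IH[of "m(i := 0)"]])
        (use h(1)[of i] in \<open>simp only: mixed_cost_fun_upd[OF insert.hyps(2)], simp\<close>)
  next
    case (Suc t)
    have "h i * (real t + 1) \<le> h i * real (ell p (n i)) + Er i * max 0 (real t + 1 - real (ell p (n i)))"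
    proof (cases "real t + 1 \<le> real (ell p (n i))")
      case True
      then have "h i * (real t + 1) \<le> h i * real (ell p (n i))" using h(1)[of i] by (intro mult_left_mono) auto
      then show ?thesis using True by simp
    next
      case False
      then have "h i * (real t + 1 - real (ell p (n i))) \<le> Er i * (real t + 1 - real (ell p (n i)))"
        using h(2)[of i] by (intro mult_right_mono) auto
      then show ?thesis using False by (simp add: max_def algebra_simps)
    qed
    then have "?B \<le> c - mixed_cost h S (m(i := Suc t)) n + Er i * max 0 (real t + 1 - real (ell p (n i)))"
      unfolding mixed_cost_fun_upd[OF insert.hyps(2)] by (simp add: add.commute)
    then have "vge (mcoeff (r (m(i := Suc t)) - r (m(i := t))) n) ?B"
      by (intro vge_mono[OF compatible_step_bound[OF r h(1) insert.hyps(2) insert.IH]])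
    from vge_add[OF this Suc.IH] show ?case by (simp only: mcoeff_simps diff_add_cancel)
  qed
  from this[of "m i"] show ?case by simp
qed

lemma compatible_bd:
  assumes "compatible h c r" "\<And>i. 0 \<le> h i" "\<And>i. h i \<le> Er i"
  shows "bd h c (r m)"
  using compatible_mixed[OF assms, of m _ UNIV] by (simp add: bd_def mixed_cost_UNIV)

text \<open>For the coarser weight \<open>Er\<close> the family converges along the diagonal.\<close>

lemma compatible_step_Er:
  assumes r: "compatible h c r" and h: "\<And>i. 0 \<le> h i" "\<And>i. h i + \<delta> \<le> Er i" and \<delta>: "0 \<le> \<delta>"
  shows "bd Er (c + \<delta> * real (m i)) (r (m(i := Suc (m i))) - r m)"
  unfolding bd_def
proof
  fix n
  let ?S = "UNIV - {i}"
  have hE: "h j \<le> Er j" for j using h(2)[of j] \<delta> by simp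
  have "vge (mcoeff (r (m(i := Suc (m i))) - r (m(i := m i))) n)
    (c - mixed_cost h ?S (m(i := Suc (m i))) n + Er i * max 0 (real (m i) + 1 - real (ell p (n i))))"
    by (rule compatible_step_bound[OF r h(1) _ compatible_mixed[OF r h(1) hE]]) simp
  moreover have "mixed_cost h ?S (m(i := Suc (m i))) n \<le> (wt Er n - Er i * real (ell p (n i))) + h i * (real (m i) + 1)"
  proof -
    have "wt Er n = Er i * real (ell p (n i)) + (\<Sum>j\<in>?S. Er j * real (ell p (n j)))"
      unfolding wt_def by (rule sum.remove) auto
    moreover have "wt h n = h i * real (ell p (n i)) + (\<Sum>j\<in>?S. h j * real (ell p (n j)))"
      unfolding wt_def by (rule sum.remove) auto
    moreover have "(\<Sum>j\<in>?S. h j * real (ell p (n j))) \<le> (\<Sum>j\<in>?S. Er j * real (ell p (n j)))"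
      using hE by (intro sum_mono mult_right_mono) auto
    ultimately show ?thesis
      by (subst mixed_cost_fun_upd) (simp_all add: insert_UNIV mixed_cost_UNIV add.commute)
  qed
  moreover have "\<delta> * real (m i) + h i * (real (m i) + 1) \<le>
      Er i * real (ell p (n i)) + Er i * max 0 (real (m i) + 1 - real (ell p (n i)))"
  proof -
    have "\<delta> * real (m i) + h i * (real (m i) + 1) \<le> (h i + \<delta>) * (real (m i) + 1)"
      using \<delta> by (simp add: algebra_simps)
    also have "\<dots> \<le> Er i * (real (m i) + 1)" using h(2) by (intro mult_right_mono) auto
    also have "\<dots> \<le> Er i * (real (ell p (n i)) + max 0 (real (m i) + 1 - real (ell p (n i))))"
      by (intro mult_left_mono) auto
    finally show ?thesis by (simp add: distrib_left)
  qed
  ultimately show "vge (mcoeff (r (m(i := Suc (m i))) - r m) n) (c + \<delta> * real (m i) - wt Er n)"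
    by (auto elim!: vge_mono)
qed

lemma compatible_diagonal_step:
  assumes r: "compatible h c r" and h: "\<And>i. 0 \<le> h i" "\<And>i. h i + \<delta> \<le> Er i" and \<delta>: "0 \<le> \<delta>"
  shows "bd Er (c + \<delta> * real N) (r (\<lambda>_. Suc N) - r (\<lambda>_. N))"
proof -
  have "bd Er (c + \<delta> * real N) (r (\<lambda>i. if i \<in> S then Suc N else N) - r (\<lambda>_. N))" if "finite S" for S
    using that
  proof (induction S rule: finite_induct)
    case empty
    then show ?case by (simp add: bd_def)
  next
    case (insert i S)
    let ?m = "\<lambda>i. if i \<in> S then Suc N else N"
    have "bd Er (c + \<delta> * real (?m i)) (r (?m(i := Suc (?m i))) - r ?m)"
      by (rule compatible_step_Er[OF r h \<delta>])
    moreover have "?m i = N" using insert.hyps by simp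
    moreover have "?m(i := Suc N) = (\<lambda>j. if j \<in> insert i S then Suc N else N)" by auto
    ultimately have "bd Er (c + \<delta> * real N) (r (\<lambda>j. if j \<in> insert i S then Suc N else N) - r ?m)"
      by simp
    from bd_add[OF this insert.IH] show ?case by simp
  qed
  from this[of UNIV] show ?thesis by simp
qed

definition diagonal_limit :: "(('k \<Rightarrow> nat) \<Rightarrow> ('k, 'c) mfps) \<Rightarrow> ('k, 'c) mfps"
  where "diagonal_limit r = Abs_mfps (\<lambda>n. vlim (\<lambda>N. mcoeff (r (\<lambda>_. N)) n))"

text \<open>The steps along the diagonal gain \<open>\<delta>\<close> each, where \<open>\<delta>\<close> is the gap between \<open>h\<close> and \<open>Er\<close>.\<close>

lemma diagonal_limit:
  assumes r: "compatible h c r" and h: "\<And>i. 0 \<le> h i" "\<And>i. h i + \<delta> \<le> Er i" and \<delta>: "0 < \<delta>"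
  shows "diagonal_limit r \<in> Hs h" "bd h c (diagonal_limit r)"
    "bd Er (c + \<delta> * real N) (diagonal_limit r - r (\<lambda>_. N))"
proof -
  let ?r = "\<lambda>N. r (\<lambda>_. N)"
  have step: "bd Er (c + \<delta> * real N) (?r (Suc N) - ?r N)" for N
    by (rule compatible_diagonal_step[OF r h]) (use \<delta> in auto)
  have lim: "vanishing (\<lambda>N. mcoeff (?r N) n - mcoeff (diagonal_limit r) n)" for n
  proof -
    have "vanishing (\<lambda>N. mcoeff (?r (Suc N)) n - mcoeff (?r N) n)"
    proof (rule vanishing_linear[OF \<delta>])
      fix N
      show "vge (mcoeff (?r (Suc N)) n - mcoeff (?r N) n) (\<delta> * real N - (wt Er n - c))"
        using step[of N] by (auto simp: bd_def algebra_simps)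
    qed
    then show ?thesis unfolding diagonal_limit_def mcoeff_Abs by (rule vlim_vanishing)
  qed
  have hE: "h j \<le> Er j" for j using h(2)[of j] \<delta> by simp
  show bd: "bd h c (diagonal_limit r)"
    unfolding bd_def using compatible_bd[OF r h(1) hE] by (auto intro!: vge_limit[OF lim] simp: bd_def)
  show "diagonal_limit r \<in> Hs h"
  proof (rule HsI[OF _ bd])
    fix n show "mcoeff (diagonal_limit r) n \<in> K"
      by (rule K_limit[OF lim]) (use r in \<open>auto simp: compatible_def Hs_iff\<close>)
  qed
  have diff: "bd Er (c + \<delta> * real N) (?r N' - ?r N)" if "N \<le> N'" for N'
    using that
  proof (induction N' rule: dec_induct)
    case base
    then show ?case by (simp add: bd_def)
  next
    case (step N')
    have "bd Er (c + \<delta> * real N) (?r (Suc N') - ?r N')"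
      by (rule bd_mono[OF \<open>\<And>N. bd Er (c + \<delta> * real N) (?r (Suc N) - ?r N)\<close>])
        (use \<delta> step.hyps in \<open>simp add: mult_left_mono\<close>)
    from bd_add[OF this step.IH] show ?case by simp
  qed
  show "bd Er (c + \<delta> * real N) (diagonal_limit r - ?r N)"
    unfolding bd_def
  proof
    fix n
    have "vanishing (\<lambda>N'. mcoeff (?r N' - ?r N) n - mcoeff (diagonal_limit r - ?r N) n)"
      using lim[of n] by simp
    moreover have "\<forall>\<^sub>F N' in sequentially. vge (mcoeff (?r N' - ?r N) n) (c + \<delta> * real N - wt Er n)"
      using diff unfolding bd_def eventually_sequentially by blast
    ultimately show "vge (mcoeff (diagonal_limit r - ?r N) n) (c + \<delta> * real N - wt Er n)"
      by (rule vge_limit)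
  qed
qed

text \<open>Coefficientwise convergence would not suffice, since a remainder depends on infinitely many
  coefficients. But \<open>Rem m\<close> is continuous for the weight \<open>Er\<close>, and for this weight the convergence is
  uniform.\<close>

lemma Rem_diagonal_limit:
  assumes r: "compatible h c r" and h: "\<And>i. 0 \<le> h i" "\<And>i. h i + \<delta> \<le> Er i" and \<delta>: "0 < \<delta>"
  shows "Rem m (diagonal_limit r) = r m"
proof (rule mfps_eqI)
  fix n
  let ?f = "diagonal_limit r"
  note lim = diagonal_limit[OF r h \<delta>]
  have rHs: "r m \<in> Hs h" for m using r by (simp add: compatible_def)
  have "vge (mcoeff (Rem m ?f - r m) n) (c + \<delta> * real N - alpha_sum Er - level_cost Er m)"
    if N: "m \<le> (\<lambda>_. N)" for N
  proof -
    have "r (\<lambda>_. N) - r m \<in> level_span h m" using r N by (simp add: compatible_def)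
    then have "Rem m (r (\<lambda>_. N) - r m) = 0" by (rule Rem_level_span[OF h(1)])
    then have "Rem m (r (\<lambda>_. N)) = Rem m (r m)" using Rem_diff[OF h(1) rHs rHs] by simp
    also have "\<dots> = r m" using r by (simp add: compatible_def Rem_reduced)
    finally have "Rem m (?f - r (\<lambda>_. N)) = Rem m ?f - r m"
      using Rem_diff[OF h(1) lim(1) rHs] by simp
    moreover have "?f - r (\<lambda>_. N) \<in> Hs Er"
    proof (rule Hs_mono)
      show "h i \<le> Er i" for i using h(2)[of i] \<delta> by simp
    qed (rule Hs_diff[OF lim(1) rHs])
    from Rem_alpha[OF _ this lim(3)] have
      "vge (mcoeff (Rem m (?f - r (\<lambda>_. N))) n) (c + \<delta> * real N - alpha_sum Er - level_cost Er m)"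
      by simp
    ultimately show ?thesis by simp
  qed
  note bound = this
  have "vge (mcoeff (Rem m ?f - r m) n) x" for x
  proof -
    obtain N where N: "(x - c + alpha_sum Er + level_cost Er m) / \<delta> \<le> real N"
      using real_arch_simple by blast
    let ?N = "max N (Max (range m))"
    have "m \<le> (\<lambda>_. ?N)" by (auto simp: le_fun_def max.coboundedI2)
    from bound[OF this] show ?thesis
    proof (rule vge_mono)
      have "x - c + alpha_sum Er + level_cost Er m \<le> \<delta> * real N" using N \<delta> by (simp add: field_simps)
      also have "\<dots> \<le> \<delta> * real ?N" using \<delta> by (intro mult_left_mono) auto
      finally show "x \<le> c + \<delta> * real ?N - alpha_sum Er - level_cost Er m" by simp
    qed
  qed
  then have "mcoeff (Rem m ?f - r m) n = 0" by (rule vge_all_eq_0)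
  then show "mcoeff (Rem m ?f) n = mcoeff (r m) n" by simp
qed

section \<open>A series is determined by its remainders\<close>

lemma compatible_Rem:
  assumes h: "\<And>i. 0 \<le> h i" and f: "f \<in> Hs h" "bd h c f"
  shows "compatible h (c - alpha_sum h) (\<lambda>m. Rem m f)"
  unfolding compatible_def
proof (intro conjI allI impI)
  fix m m' n :: "'k \<Rightarrow> nat"
  show "Rem m f \<in> Hs h" by (rule Rem_Hs[OF f(1) h])
  show "reduced m (Rem m f)" by (rule reduced_Rem)
  show "vge (mcoeff (Rem m f) n) (c - alpha_sum h - level_cost h m)" by (rule Rem_alpha[OF h f])
  assume "m \<le> m'"
  then have "f - Rem m' f \<in> level_span h m"
    using level_span_antimono[of h, OF h] Rem_span[of h, OF h f(1)] by blast
  from level_span_diff[OF h Rem_span[OF h f(1)] this]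
  show "Rem m' f - Rem m f \<in> level_span h m" by simp
qed

lemma ell_power: "k < ell p (p ^ k)"
  using ell_le_iff[OF p_ge_2, of "p ^ k" k] by simp

text \<open>The polynomials \<open>low N\<close> approximate \<open>f\<close> only with respect to the coarser weight \<open>Er\<close>, which is why
  the gap \<open>\<delta>\<close> is needed.\<close>

lemma Rem_eq_0_imp_eq_0:
  assumes h: "\<And>i. 0 \<le> h i" "\<And>i. h i + \<delta> \<le> Er i" and \<delta>: "0 < \<delta>"
    and f: "f \<in> Hs h" and zero: "\<And>m. Rem m f = 0"
  shows "f = 0"
proof (rule mfps_eqI)
  fix n
  from f obtain c where fK: "\<And>n. mcoeff f n \<in> K" and c: "bd h c f" by (rule HsE) auto
  define low where "low N = Abs_mfps (\<lambda>n. if \<forall>i. n i < N then mcoeff f n else 0)" for N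
  have low_Hs: "low N \<in> Hs h" for N
    by (rule HsI[where c = c]) (use c fK in \<open>auto simp: low_def bd_def\<close>)
  have tail_Hs: "f - low N \<in> Hs Er" for N
  proof (rule Hs_mono[OF _ Hs_diff[OF f low_Hs]])
    show "h i \<le> Er i" for i using h(2)[of i] \<delta> by simp
  qed
  have tail: "bd Er (c + \<delta> * real (ell p N)) (f - low N)" for N
    unfolding bd_def
  proof
    fix n
    show "vge (mcoeff (f - low N) n) (c + \<delta> * real (ell p N) - wt Er n)"
    proof (cases "\<forall>i. n i < N")
      case True
      then show ?thesis by (simp add: low_def)
    next
      case False
      then obtain i where i: "N \<le> n i" by (auto simp: not_less)
      have "wt Er n - wt h n = (\<Sum>i\<in>UNIV. (Er i - h i) * real (ell p (n i)))"
        by (simp add: wt_def sum_subtractf algebra_simps)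
      moreover have "(\<Sum>i\<in>UNIV. (Er i - h i) * real (ell p (n i))) \<ge> (\<Sum>j\<in>{i}. (Er j - h j) * real (ell p (n j)))"
      proof (rule sum_mono2)
        show "0 \<le> (Er j - h j) * real (ell p (n j))" for j
          using h(2)[of j] \<delta> by (intro mult_nonneg_nonneg) auto
      qed auto
      moreover have "(\<Sum>j\<in>{i}. (Er j - h j) * real (ell p (n j))) \<ge> \<delta> * real (ell p N)"
        using h(2)[of i] \<delta> ell_mono[OF p_ge_2 i] by (auto intro!: mult_mono)
      ultimately have "c + \<delta> * real (ell p N) - wt Er n \<le> c - wt h n" by simp
      moreover have "vge (mcoeff f n) (c - wt h n)" using c by (simp add: bd_def)
      moreover have "mcoeff (f - low N) n = mcoeff f n" unfolding low_def mcoeff_simps mcoeff_Abs using False by (simp only: if_False diff_zero)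
      ultimately show ?thesis using vge_mono by simp
    qed
  qed
  have Rem_tail: "Rem (\<lambda>_. N) (f - low N) = - low N" for N
  proof -
    have "N \<le> num_points i * p ^ N" for i
    proof -
      have "N \<le> p ^ N" using power_gt_expt[of p N] p_gt_1 by simp
      also have "\<dots> \<le> num_points i * p ^ N" using num_points_pos[of i] by simp
      finally show ?thesis .
    qed
    then have "reduced (\<lambda>_. N) (low N)"
      unfolding reduced_def deg_less_def degree_level_poly low_def mcoeff_Abs
      by (metis le_trans not_le)
    then show ?thesis using Rem_diff[OF h(1) f low_Hs] zero Rem_reduced by simp
  qed
  have "vge (mcoeff f n) (c + \<delta> * real (ell p N) - alpha_sum Er - wt Er n)" if N: "\<forall>i. n i < N" for N
  proof -
    have "compatible Er (c + \<delta> * real (ell p N) - alpha_sum Er) (\<lambda>m. Rem m (f - low N))"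
      by (rule compatible_Rem[OF _ tail_Hs tail]) simp
    then have "bd Er (c + \<delta> * real (ell p N) - alpha_sum Er) (Rem (\<lambda>_. N) (f - low N))"
      by (rule compatible_bd) auto
    then have "vge (mcoeff (low N) n) (c + \<delta> * real (ell p N) - alpha_sum Er - wt Er n)"
      unfolding Rem_tail by (simp add: bd_def)
    then show ?thesis using N by (simp add: low_def)
  qed
  note bound = this
  have "vge (mcoeff f n) x" for x
  proof -
    obtain k where k: "(x - c + alpha_sum Er + wt Er n) / \<delta> \<le> real k" using real_arch_simple by blast
    let ?N = "max (p ^ k) (Suc (Max (range n)))"
    have "\<forall>i. n i < ?N" by (auto simp: less_max_iff_disj less_Suc_eq_le)
    from bound[OF this] show ?thesis
    proof (rule vge_mono)
      have "x - c + alpha_sum Er + wt Er n \<le> \<delta> * real k" using k \<delta> by (simp add: field_simps)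
      also have "k \<le> ell p ?N" using ell_power[of k] ell_mono[OF p_ge_2, of "p ^ k" ?N] by simp
      then have "\<delta> * real k \<le> \<delta> * real (ell p ?N)" using \<delta> by (intro mult_left_mono) auto
      finally show "x \<le> c + \<delta> * real (ell p ?N) - alpha_sum Er - wt Er n" by simp
    qed
  qed
  then show "mcoeff f n = mcoeff 0 n" using vge_all_eq_0 by simp
qed

end

section \<open>The ideals, the levels and the modules\<close>

lemma subring_of_type_cring:
  fixes S :: "'a::comm_ring_1 set"
  assumes "0 \<in> S" "1 \<in> S" "\<And>x. x \<in> S \<Longrightarrow> - x \<in> S"
    "\<And>x y. x \<in> S \<Longrightarrow> y \<in> S \<Longrightarrow> x + y \<in> S" "\<And>x y. x \<in> S \<Longrightarrow> y \<in> S \<Longrightarrow> x * y \<in> S"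
  shows "cring (ring_of_type_algebra\<lparr>carrier := S\<rparr>)"
proof (rule cringI)
  show "abelian_group (ring_of_type_algebra\<lparr>carrier := S\<rparr>)"
  proof (rule abelian_groupI)
    fix x assume "x \<in> carrier (ring_of_type_algebra\<lparr>carrier := S\<rparr>)"
    then show "\<exists>y\<in>carrier (ring_of_type_algebra\<lparr>carrier := S\<rparr>).
        y \<oplus>\<^bsub>ring_of_type_algebra\<lparr>carrier := S\<rparr>\<^esub> x = \<zero>\<^bsub>ring_of_type_algebra\<lparr>carrier := S\<rparr>\<^esub>"
      using assms(3) by (intro bexI[of _ "- x"]) (auto simp: ring_of_type_algebra_def)
  qed (use assms in \<open>auto simp: ring_of_type_algebra_def algebra_simps\<close>)
  show "Group.comm_monoid (ring_of_type_algebra\<lparr>carrier := S\<rparr>)"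
    by (rule comm_monoidI) (use assms in \<open>auto simp: ring_of_type_algebra_def algebra_simps\<close>)
qed (auto simp: ring_of_type_algebra_def algebra_simps)

context interpolation_points
begin

abbreviation A0 :: "('k, 'c) mfps ring" where "A0 \<equiv> Iw ord K"
abbreviation AK :: "('k, 'c) mfps ring" where "AK \<equiv> IwK ord K"
abbreviation bounded_series :: "('k, 'c) mfps set" where "bounded_series \<equiv> Hs (\<lambda>_. 0)"
abbreviation span0 :: "('k \<Rightarrow> nat) \<Rightarrow> ('k, 'c) mfps set" where "span0 \<equiv> level_span (\<lambda>_. 0)"
abbreviation cl :: "('k \<Rightarrow> nat) \<Rightarrow> ('k, 'c) mfps \<Rightarrow> ('k, 'c) mfps set" where "cl \<equiv> cls p ord K u d e"
abbreviation lev :: "('k \<Rightarrow> nat) \<Rightarrow> ('k, 'c) mfps set ring" where "lev \<equiv> level p ord K u d e"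

lemma one_bounded: "1 \<in> bounded_series"
  using integral_poly_Hs[OF integral_poly_one] by (simp add: mfps_of_poly_one)

lemma bounded_mult: "f \<in> bounded_series \<Longrightarrow> g \<in> bounded_series \<Longrightarrow> f * g \<in> bounded_series"
  by (rule Hs_mult) auto

lemma A0_iff: "f \<in> carrier A0 \<longleftrightarrow> (\<forall>n. mcoeff f n \<in> K) \<and> bd (\<lambda>_. 0) 0 f"
  by (auto simp: Iw_def mfps_over_def valuation_ring_def bd_def vge_def zero_ereal_def)

lemma A0_subset: "carrier A0 \<subseteq> bounded_series"
  by (auto simp: A0_iff intro: HsI)

lemma A0_simps [simp]: "x \<otimes>\<^bsub>A0\<^esub> y = x * y" "x \<oplus>\<^bsub>A0\<^esub> y = x + y" "\<zero>\<^bsub>A0\<^esub> = 0" "\<one>\<^bsub>A0\<^esub> = 1"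
  by (simp_all add: Iw_def ring_of_type_algebra_def)

lemma AK_simps [simp]: "x \<otimes>\<^bsub>AK\<^esub> y = x * y" "x \<oplus>\<^bsub>AK\<^esub> y = x + y" "\<zero>\<^bsub>AK\<^esub> = 0" "\<one>\<^bsub>AK\<^esub> = 1"
  by (simp_all add: IwK_def ring_of_type_algebra_def)

lemma inverse_p_power:
  "inverse (of_nat p ^ N) \<in> K" "ord (inverse (of_nat p ^ N)) = ereal (- real N)"
  by (rule K_inverse[OF K_power[OF K_of_nat]], rule ord_inverse[OF ord_p_power])

lemma carrier_AK [simp]: "carrier AK = bounded_series"
proof
  show "carrier AK \<subseteq> bounded_series"
    using A0_subset by (auto simp: IwK_def intro!: bounded_mult mconst_Hs)
  show "bounded_series \<subseteq> carrier AK"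
  proof
    fix f assume f: "f \<in> bounded_series"
    then obtain c where fK: "\<And>n. mcoeff f n \<in> K" and c: "bd (\<lambda>_. 0) c f" by (rule HsE) auto
    obtain N where N: "- c \<le> real N" using real_arch_simple by blast
    define x where "x = inverse (of_nat p ^ N :: 'c)"
    have x: "x \<in> K" "ord x = ereal (- real N)" unfolding x_def by (rule inverse_p_power)+
    then have x0: "x \<noteq> 0" by auto
    have "vge (mcoeff f n) (- real N)" for n
      using c N by (auto simp: bd_def intro: vge_mono)
    then have "mconst (inverse x) * f \<in> carrier A0"
      using fK x by (auto simp: A0_iff bd_def vge_scale_iff[OF ord_inverse[OF x(2)]] intro: K_mult K_inverse)
    moreover have "f = mconst x * (mconst (inverse x) * f)"
      by (rule mfps_eqI) (simp add: x0)
    ultimately show "f \<in> carrier AK" using x(1) by (auto simp: IwK_def)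
  qed
qed

lemma cring_A0: "cring A0"
  unfolding Iw_def
proof (rule subring_of_type_cring)
  have S: "mfps_over (valuation_ring ord K) = carrier A0" by (simp add: Iw_def)
  show "0 \<in> (mfps_over (valuation_ring ord K) :: ('k, 'c) mfps set)" unfolding S by (simp add: A0_iff bd_def)
  show "1 \<in> (mfps_over (valuation_ring ord K) :: ('k, 'c) mfps set)" unfolding S
    by (auto simp: A0_iff bd_def one_mfps.rep_eq)
  fix x :: "('k, 'c) mfps" assume x: "x \<in> mfps_over (valuation_ring ord K)"
  then show "- x \<in> mfps_over (valuation_ring ord K)" unfolding S by (auto simp: A0_iff bd_def intro: K_uminus)
  fix y :: "('k, 'c) mfps" assume y: "y \<in> mfps_over (valuation_ring ord K)"
  show "x + y \<in> mfps_over (valuation_ring ord K)"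
    using x y unfolding S by (auto simp: A0_iff intro: K_add bd_add)
  show "x * y \<in> mfps_over (valuation_ring ord K)"
    using x y bd_mult[of "\<lambda>_. 0" 0 x 0 y] unfolding S by (auto simp: A0_iff mcoeff_mult intro!: K_sum K_mult)
qed

lemma cring_AK: "cring AK"
proof -
  have AK: "AK = ring_of_type_algebra\<lparr>carrier := bounded_series\<rparr>"
    using carrier_AK by (simp add: IwK_def)
  show ?thesis unfolding AK
    by (rule subring_of_type_cring) (auto intro: Hs_uminus Hs_add bounded_mult one_bounded)
qed

lemma a_inv_eq_uminus:
  assumes "abelian_group M" "x \<in> carrier M" "- x \<in> carrier M"
    and "- x \<oplus>\<^bsub>M\<^esub> x = - x + x" "\<zero>\<^bsub>M\<^esub> = (0 :: ('k, 'c) mfps)"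
  shows "\<ominus>\<^bsub>M\<^esub> x = - x"
  by (rule abelian_group.minus_equality[OF assms(1)]) (use assms in auto)

lemma ideal_span0: "ideal (span0 m) AK"
proof -
  interpret AK: cring AK by (rule cring_AK)
  show ?thesis
  proof (rule idealI)
    show "subgroup (span0 m) (add_monoid AK)"
    proof (rule AK.add.subgroupI)
      show "span0 m \<subseteq> carrier AK" using level_span_subset_Hs[of "\<lambda>_. 0" m] by simp
      show "span0 m \<noteq> {}" using level_span_zero by blast
      fix a assume a: "a \<in> span0 m"
      then have "a \<in> bounded_series" using level_span_subset_Hs[of "\<lambda>_. 0" m] by auto
      then have "\<ominus>\<^bsub>AK\<^esub> a = - a"
        by (intro a_inv_eq_uminus AK.abelian_group_axioms) (auto intro: Hs_uminus)
      then show "\<ominus>\<^bsub>AK\<^esub> a \<in> span0 m" using level_span_uminus[OF _ a] by simp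
      fix b assume "b \<in> span0 m"
      with a show "a \<oplus>\<^bsub>AK\<^esub> b \<in> span0 m" by (simp add: level_span_add)
    qed
    fix a x assume "a \<in> span0 m" "x \<in> carrier AK"
    then show "x \<otimes>\<^bsub>AK\<^esub> a \<in> span0 m" "a \<otimes>\<^bsub>AK\<^esub> x \<in> span0 m"
      using level_span_mult[of "\<lambda>_. 0" x a m] by (simp_all add: mult.commute)
  qed (rule AK.ring_axioms)
qed

lemma ideal_span0_A0: "ideal (span0 m \<inter> carrier A0) A0"
proof -
  interpret A0: cring A0 by (rule cring_A0)
  show ?thesis
  proof (rule idealI)
    show "subgroup (span0 m \<inter> carrier A0) (add_monoid A0)"
    proof (rule A0.add.subgroupI)
      show "span0 m \<inter> carrier A0 \<subseteq> carrier A0" by simp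
      show "span0 m \<inter> carrier A0 \<noteq> {}" using level_span_zero A0.zero_closed by auto
      fix a assume a: "a \<in> span0 m \<inter> carrier A0"
      then have "\<ominus>\<^bsub>A0\<^esub> a = - a"
        by (intro a_inv_eq_uminus A0.abelian_group_axioms) (auto simp: A0_iff bd_def intro: K_uminus)
      then show "\<ominus>\<^bsub>A0\<^esub> a \<in> span0 m \<inter> carrier A0"
        using level_span_uminus[of "\<lambda>_. 0" a m] a A0.a_inv_closed[of a] by auto
      fix b assume b: "b \<in> span0 m \<inter> carrier A0"
      then show "a \<oplus>\<^bsub>A0\<^esub> b \<in> span0 m \<inter> carrier A0"
        using a A0.a_closed[of a b] by (simp add: level_span_add)
    qed
    fix a x assume "a \<in> span0 m \<inter> carrier A0" "x \<in> carrier A0"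
    then show "x \<otimes>\<^bsub>A0\<^esub> a \<in> span0 m \<inter> carrier A0" "a \<otimes>\<^bsub>A0\<^esub> x \<in> span0 m \<inter> carrier A0"
      using level_span_mult[of "\<lambda>_. 0" x a m] A0.m_closed[of x a] A0_subset by (auto simp: mult.commute)
  qed (rule A0.ring_axioms)
qed

lemma Om_in_span0: "Om i (m i) \<in> span0 m"
  using Om_mult_level_span[OF one_bounded, of i m] by simp

lemma Omega_ideal_subset: "Omega_ideal p ord K u d e m \<subseteq> span0 m"
proof -
  have "Om i (m i) \<in> span0 m \<inter> carrier A0" for i
    using Om_in_span0 level_poly_integral[of i "m i"]
    by (auto simp: A0_iff bd_def mfps_of_poly_def integral_poly_def)
  then show ?thesis
    unfolding Omega_ideal_def genideal_def Omega_eq using ideal_span0_A0[of m] by blast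
qed

lemma Om_in_Omega_ideal: "Om i (m i) \<in> Omega_ideal p ord K u d e m"
  unfolding Omega_ideal_def genideal_def Omega_eq by blast

text \<open>Extending scalars from the integral series to the bounded ones yields all combinations of level
  polynomials with bounded coefficients.\<close>

lemma Omega_idealK_eq: "Omega_idealK p ord K u d e m = span0 m"
proof
  show "Omega_idealK p ord K u d e m \<subseteq> span0 m"
    unfolding Omega_idealK_def genideal_def using ideal_span0[of m] Omega_ideal_subset[of m] by blast
  show "span0 m \<subseteq> Omega_idealK p ord K u d e m"
    unfolding Omega_idealK_def genideal_def
  proof (intro subsetI InterI, elim CollectE conjE)
    fix f I assume "f \<in> span0 m" and I: "ideal I AK" "Omega_ideal p ord K u d e m \<subseteq> I"
    then obtain g where g: "\<And>i. g i \<in> bounded_series" "f = (\<Sum>i\<in>UNIV. Om i (m i) * g i)"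
      by (auto elim: level_spanE)
    interpret I: ideal I AK by (rule I(1))
    have "(\<Sum>i\<in>S. Om i (m i) * g i) \<in> I" for S
    proof (induction S rule: infinite_finite_induct)
      case (insert i S)
      have "Om i (m i) \<in> I" using Om_in_Omega_ideal[of i m] I(2) by blast
      then have "Om i (m i) * g i \<in> I" using I.I_r_closed[of "Om i (m i)" "g i"] g(1) by simp
      then show ?case using insert additive_subgroup.a_closed[OF I.additive_subgroup_axioms, of "Om i (m i) * g i"] by simp
    qed (use additive_subgroup.zero_closed[OF I.additive_subgroup_axioms] in simp_all)
    then show "f \<in> I" using g(2) by simp
  qed
qed

lemma H_module_simps [simp]:
  "carrier (H_module p ord K h) = Hs h" "x \<oplus>\<^bsub>H_module p ord K h\<^esub> y = x + y"
  "\<zero>\<^bsub>H_module p ord K h\<^esub> = 0" "a \<odot>\<^bsub>H_module p ord K h\<^esub> x = a * x"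
  by (simp_all add: H_module_def)

lemma abelian_group_H_module: "abelian_group (H_module p ord K h)"
proof (rule abelian_groupI)
  fix x assume "x \<in> carrier (H_module p ord K h)"
  then show "\<exists>y\<in>carrier (H_module p ord K h). y \<oplus>\<^bsub>H_module p ord K h\<^esub> x = \<zero>\<^bsub>H_module p ord K h\<^esub>"
    by (intro bexI[of _ "- x"]) (auto intro: Hs_uminus)
qed (auto intro: Hs_add simp: algebra_simps)

lemma module_H_module:
  fixes h :: "'k \<Rightarrow> real"
  assumes "\<And>i. 0 \<le> h i" shows "module AK (H_module p ord K h)"
  by (rule moduleI[OF cring_AK abelian_group_H_module])
    (use Hs_mult[OF assms] in \<open>auto simp: algebra_simps\<close>)

lemma submodule_level_span:
  assumes h: "\<And>i. 0 \<le> h i" shows "submodule (level_span h m) AK (H_module p ord K h)"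
proof (rule module.submoduleI[OF module_H_module[OF h]])
  show "level_span h m \<subseteq> carrier (H_module p ord K h)" using level_span_subset_Hs[of h, OF h] by simp
  show "\<zero>\<^bsub>H_module p ord K h\<^esub> \<in> level_span h m" by (simp add: level_span_zero)
  fix a assume a: "a \<in> level_span h m"
  then have "a \<in> Hs h" using level_span_subset_Hs[of h, OF h] by auto
  then have "\<ominus>\<^bsub>H_module p ord K h\<^esub> a = - a"
    by (intro a_inv_eq_uminus abelian_group_H_module) (auto intro: Hs_uminus)
  then show "\<ominus>\<^bsub>H_module p ord K h\<^esub> a \<in> level_span h m" using level_span_uminus[of h, OF h a] by simp
qed (use level_span_add level_span_mult[of h, OF h] in auto)

lemma Omega_H_eq:
  assumes h: "\<And>i. 0 \<le> h i" shows "Omega_H p ord K u d e h m = level_span h m"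
proof
  have "w * f \<in> level_span h m" if w: "w \<in> Omega_ideal p ord K u d e m" and f: "f \<in> Hs h" for w f
  proof -
    obtain g where g: "\<And>i. g i \<in> bounded_series" "w = (\<Sum>i\<in>UNIV. Om i (m i) * g i)"
      using w Omega_ideal_subset[of m] by (auto elim: level_spanE)
    then show ?thesis
      using level_spanI[of "\<lambda>i. g i * f" h m] Hs_mult[OF h g(1) f] by (simp add: sum_distrib_right mult.assoc)
  qed
  then show "Omega_H p ord K u d e h m \<subseteq> level_span h m"
    unfolding Omega_H_def using submodule_level_span[of h m, OF h] by blast
  show "level_span h m \<subseteq> Omega_H p ord K u d e h m"
    unfolding Omega_H_def
  proof (intro subsetI InterI, elim CollectE conjE)
    fix f N assume "f \<in> level_span h m" and N: "submodule N AK (H_module p ord K h)"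
      "{w * f |w f. w \<in> Omega_ideal p ord K u d e m \<and> f \<in> Hs h} \<subseteq> N"
    then obtain g where g: "\<And>i. g i \<in> Hs h" "f = (\<Sum>i\<in>UNIV. Om i (m i) * g i)"
      by (auto elim: level_spanE)
    interpret N: submodule N AK "H_module p ord K h" by (rule N(1))
    have "(\<Sum>i\<in>S. Om i (m i) * g i) \<in> N" for S
    proof (induction S rule: infinite_finite_induct)
      case (insert i S)
      have "Om i (m i) * g i \<in> N" using N(2) Om_in_Omega_ideal[of i m] g(1) by blast
      then show ?case using insert N.m_closed[of "Om i (m i) * g i"] by simp
    qed (use N.one_closed in simp_all)
    then show "f \<in> N" using g(2) by simp
  qed
qed

lemma mem_cl_iff: "t \<in> cl m f \<longleftrightarrow> t - f \<in> span0 m"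
  by (force simp: cls_def Omega_idealK_eq a_r_coset_def r_coset_def)

lemma cl_eq_iff: "cl m f = cl m g \<longleftrightarrow> f - g \<in> span0 m"
proof
  assume "cl m f = cl m g"
  moreover have "f \<in> cl m f" by (simp add: mem_cl_iff level_span_zero)
  ultimately show "f - g \<in> span0 m" using mem_cl_iff by blast
next
  assume fg: "f - g \<in> span0 m"
  have "t - f \<in> span0 m \<longleftrightarrow> t - g \<in> span0 m" for t
    using level_span_add[OF _ fg, of "t - f"] level_span_diff[OF _ _ fg, of "t - g"] by auto
  then show "cl m f = cl m g" by (auto simp: mem_cl_iff)
qed

lemma self_mem_cl: "f \<in> cl m f"
  by (simp add: mem_cl_iff level_span_zero)

lemma lev_simps:
  "carrier (lev m) = cl m ` bounded_series"
  "\<zero>\<^bsub>lev m\<^esub> = cl m 0"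
  "f \<in> bounded_series \<Longrightarrow> g \<in> bounded_series \<Longrightarrow> cl m f \<otimes>\<^bsub>lev m\<^esub> cl m g = cl m (f * g)"
  "f \<in> bounded_series \<Longrightarrow> g \<in> bounded_series \<Longrightarrow> cl m f \<oplus>\<^bsub>lev m\<^esub> cl m g = cl m (f + g)"
proof -
  interpret I: ideal "span0 m" AK by (rule ideal_span0)
  show "carrier (lev m) = cl m ` bounded_series"
    by (auto simp: level_def FactRing_def A_RCOSETS_defs cls_def Omega_idealK_eq a_r_coset_def)
  show "\<zero>\<^bsub>lev m\<^esub> = cl m 0"
    by (auto simp: level_def FactRing_def mem_cl_iff Omega_idealK_eq)
  assume "f \<in> bounded_series" "g \<in> bounded_series"
  then show "cl m f \<otimes>\<^bsub>lev m\<^esub> cl m g = cl m (f * g)" "cl m f \<oplus>\<^bsub>lev m\<^esub> cl m g = cl m (f + g)"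
    using I.rcoset_mult_add[of f g] I.a_rcos_sum[of f g]
    by (simp_all add: level_def FactRing_def cls_def Omega_idealK_eq)
qed

end

section \<open>The isomorphism\<close>

locale interpolation_problem = interpolation_points p ord K u d e
  for p :: nat and ord :: "'c::{field_char_0, complete_space} \<Rightarrow> ereal" and K
    and u :: "'k::finite \<Rightarrow> 'c" and d e :: "'k \<Rightarrow> int" +
  fixes h :: "'k \<Rightarrow> real"
  assumes h_value: "\<exists>c\<in>K. ord c = ereal (h i)"
    and h_nonneg: "0 \<le> h i" and h_less: "h i < real (num_points i)"
begin

lemma gap: obtains \<delta> where "0 < \<delta>" "\<And>i. h i + \<delta> \<le> Er i"
proof
  define \<delta> where "\<delta> = Min (range (\<lambda>i. Er i - h i))"
  have "\<delta> \<in> range (\<lambda>i. Er i - h i)" unfolding \<delta>_def by (rule Min_in) auto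
  then show "0 < \<delta>" using h_less by auto
  fix i
  have "\<delta> \<le> Er i - h i" unfolding \<delta>_def by (rule Min_le) auto
  then show "h i + \<delta> \<le> Er i" by linarith
qed

definition twist_elt :: "('k \<Rightarrow> nat) \<Rightarrow> 'c"
  where "twist_elt m = elt_of_ord ord K (level_cost h m)"

text \<open>The valuation \<open>\<langle>h, m\<rangle>\<close> is attained by a monomial in elements of valuation \<open>h i\<close>.\<close>

lemma twist_elt: "twist_elt m \<in> K" "ord (twist_elt m) = ereal (level_cost h m)"
proof -
  obtain c where c: "\<And>i. c i \<in> K" "\<And>i. ord (c i) = ereal (h i)"
    using h_value by metis
  have "ord (\<Prod>i\<in>S. c i ^ m i) = ereal (\<Sum>i\<in>S. h i * real (m i))" for S
    by (induction S rule: infinite_finite_induct)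
      (auto simp: ord_mult ord_power[OF c(2)] zero_ereal_def mult.commute)
  then have "(\<Prod>i\<in>UNIV. c i ^ m i) \<in> K \<and> ord (\<Prod>i\<in>UNIV. c i ^ m i) = ereal (level_cost h m)"
    by (auto simp: level_cost_def intro: K_prod K_power c(1))
  then have "twist_elt m \<in> K \<and> ord (twist_elt m) = ereal (level_cost h m)"
    unfolding twist_elt_def elt_of_ord_def by (rule someI)
  then show "twist_elt m \<in> K" "ord (twist_elt m) = ereal (level_cost h m)" by auto
qed

lemma twist_eq: "twist p ord K u d e h s = (\<lambda>m. cl m (mconst (twist_elt m)) \<otimes>\<^bsub>lev m\<^esub> s m)"
  by (simp add: twist_def scale_family_def twist_elt_def level_cost_def)

lemma bounded_subset_Hs: "bounded_series \<subseteq> Hs h"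
  using Hs_mono[of "\<lambda>_. 0" h] h_nonneg by blast

lemma span0_subset: "span0 m \<subseteq> level_span h m"
  using bounded_subset_Hs by (auto elim!: level_spanE intro!: level_spanI)

lemma Rem_bounded: assumes "f \<in> Hs h" shows "Rem m f \<in> bounded_series"
proof -
  from assms obtain c where c: "bd h c f" by (rule HsE) auto
  show ?thesis
  proof (rule HsI)
    show "mcoeff (Rem m f) n \<in> K" for n using Rem_Hs[OF assms h_nonneg, of m] by (simp add: Hs_iff)
    show "bd (\<lambda>_. 0) (c - alpha_sum h - level_cost h m) (Rem m f)"
      using Rem_alpha[OF h_nonneg assms c] by (simp add: bd_def)
  qed
qed

text \<open>Division shows that a bounded series which is a combination of level polynomials over the
  larger module is already one over the bounded series.\<close>

lemma bounded_level_span: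
  assumes "f \<in> bounded_series" "f \<in> level_span h m" shows "f \<in> span0 m"
  using Rem_span[of "\<lambda>_. 0" f m] assms(1) Rem_level_span[OF h_nonneg assms(2)] by simp

text \<open>The element of \<open>J\<close> that belongs to \<open>f\<close>.\<close>

definition level_classes :: "('k, 'c) mfps \<Rightarrow> ('k \<Rightarrow> nat) \<Rightarrow> ('k, 'c) mfps set"
  where "level_classes f = (\<lambda>m. cl m (Rem m f))"

text \<open>The lifts of the classes of \<open>f\<close> are exactly the bounded series that are congruent
  to \<open>f\<close> modulo the level polynomials over the larger module.\<close>

lemma cl_eq_level_classes_iff:
  assumes f: "f \<in> Hs h" and t: "t \<in> bounded_series"
  shows "cl m t = level_classes f m \<longleftrightarrow> f - t \<in> level_span h m"
proof -
  have fR: "f - Rem m f \<in> level_span h m" by (rule Rem_span[OF h_nonneg f])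
  have "t - Rem m f \<in> level_span h m \<longleftrightarrow> t - Rem m f \<in> span0 m"
    using bounded_level_span[OF Hs_diff[OF t Rem_bounded[OF f]]] span0_subset by blast
  moreover have "t - Rem m f \<in> level_span h m \<longleftrightarrow> f - t \<in> level_span h m"
    using level_span_diff[OF h_nonneg fR, of "t - Rem m f"] level_span_diff[OF h_nonneg fR, of "f - t"]
    by auto
  ultimately show ?thesis by (simp add: level_classes_def cl_eq_iff)
qed

lemma all_level_span_eq_0:
  assumes "f \<in> Hs h" "\<And>m. f \<in> level_span h m" shows "f = 0"
proof -
  obtain \<delta> where "0 < \<delta>" "\<And>i. h i + \<delta> \<le> Er i" using gap by blast
  then show ?thesis
    using Rem_eq_0_imp_eq_0[OF h_nonneg _ _ assms(1)] Rem_level_span[OF h_nonneg assms(2)] by blast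
qed

lemma level_classes_inj: "inj_on level_classes (Hs h)"
proof (rule inj_onI)
  fix f g assume fg: "f \<in> Hs h" "g \<in> Hs h" "level_classes f = level_classes g"
  have "f - g \<in> level_span h m" for m
  proof -
    have "cl m (Rem m f) = level_classes f m" by (simp add: level_classes_def)
    then have "cl m (Rem m f) = level_classes g m" by (simp only: fg(3))
    then have "f - Rem m f \<in> level_span h m" "g - Rem m f \<in> level_span h m"
      using Rem_span[of h f m, OF h_nonneg fg(1)] cl_eq_level_classes_iff[OF fg(2) Rem_bounded[OF fg(1)]]
      by blast+
    from level_span_diff[OF h_nonneg this] show ?thesis by simp
  qed
  then have "f - g = 0" by (intro all_level_span_eq_0 Hs_diff fg)
  then show "f = g" by simp
qed

lemma level_classes_add:
  assumes "f \<in> Hs h" "g \<in> Hs h" shows "level_classes (f + g) m = level_classes f m \<oplus>\<^bsub>lev m\<^esub> level_classes g m"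
  by (simp add: level_classes_def lev_simps Rem_bounded assms Rem_add[OF h_nonneg assms])

lemma level_classes_mult:
  assumes a: "a \<in> bounded_series" and f: "f \<in> Hs h"
  shows "level_classes (a * f) m = cl m a \<otimes>\<^bsub>lev m\<^esub> level_classes f m"
proof -
  have "a * f - a * Rem m f \<in> level_span h m"
    using level_span_mult[OF h_nonneg a Rem_span[OF h_nonneg f, of m]] by (simp add: algebra_simps)
  then have "cl m (a * Rem m f) = level_classes (a * f) m"
    using cl_eq_level_classes_iff[OF Hs_mult[OF h_nonneg a f] bounded_mult[OF a Rem_bounded[OF f]]] by simp
  then show ?thesis by (simp add: level_classes_def lev_simps Rem_bounded f a)
qed

lemma level_classes_zero: "level_classes 0 m = \<zero>\<^bsub>lev m\<^esub>"
  by (simp add: level_classes_def Rem_def lev_simps)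

lemma inverse_limitE:
  assumes "s \<in> inverse_limit p ord K u d e"
  obtains t where "\<And>m. t m \<in> bounded_series" "s = (\<lambda>m. cl m (t m))"
    "\<And>m m'. m \<le> m' \<Longrightarrow> t m' - t m \<in> span0 m"
proof -
  have s: "\<And>m. s m \<in> cl m ` bounded_series" "\<And>m m' f. m \<le> m' \<Longrightarrow> f \<in> s m' \<Longrightarrow> s m = cl m f"
    using assms by (auto simp: inverse_limit_def lev_simps)
  have "\<forall>m. \<exists>t. t \<in> bounded_series \<and> s m = cl m t"
  proof
    fix m
    show "\<exists>t. t \<in> bounded_series \<and> s m = cl m t" using s(1)[of m] by auto
  qed
  from choice[OF this] obtain t where t: "\<And>m. t m \<in> bounded_series" "\<And>m. s m = cl m (t m)"
    by blast
  have tt: "t m' - t m \<in> span0 m" if "m \<le> m'" for m m'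
  proof -
    have "t m' \<in> s m'" unfolding t(2) by (rule self_mem_cl)
    then have "cl m (t m') = cl m (t m)" using s(2)[OF that, of "t m'"] by (simp only: t(2))
    then show ?thesis by (simp only: cl_eq_iff)
  qed
  have "s = (\<lambda>m. cl m (t m))" by (rule ext) (rule t(2))
  with t(1) show ?thesis using tt by (rule that)
qed

text \<open>Surjectivity: the remainders of the lifts of a bounded family are compatible, and their
  diagonal limit is the interpolating series.\<close>

lemma level_classes_surj:
  assumes s: "s \<in> inverse_limit p ord K u d e"
    and c: "c \<in> K" "ord c = ereal r" and a: "\<And>m. a m \<in> carrier A0"
    and twist: "\<And>m. twist p ord K u d e h s m = cl m (mconst c * a m)"
  obtains f where "f \<in> Hs h" "bd h r f" "s = level_classes f"
proof -
  obtain t where t: "\<And>m. t m \<in> bounded_series" "s = (\<lambda>m. cl m (t m))"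
    and tt: "\<And>m m'. m \<le> m' \<Longrightarrow> t m' - t m \<in> span0 m"
    by (rule inverse_limitE[OF s]) blast
  have tR: "t m - Rem m (t m) \<in> span0 m" for m by (rule Rem_span[OF _ t(1)]) simp
  have z: "0 \<le> (\<lambda>_::'k. 0::real) i" for i by simp
  have a': "a m \<in> bounded_series" for m using a A0_subset by blast
  have "compatible h r (\<lambda>m. Rem m (t m))"
    unfolding compatible_def
  proof (intro conjI allI impI)
    fix m m' n :: "'k \<Rightarrow> nat"
    show "Rem m (t m) \<in> Hs h" by (rule Rem_Hs[OF _ h_nonneg]) (use t bounded_subset_Hs in auto)
    show "reduced m (Rem m (t m))" by (rule reduced_Rem)
    have "cl m (mconst (twist_elt m) * t m) = cl m (mconst c * a m)"
      using twist[of m] by (simp add: twist_eq t lev_simps mconst_Hs twist_elt)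
    then have diff: "mconst (twist_elt m) * t m - mconst c * a m \<in> span0 m" by (simp add: cl_eq_iff)
    have "mconst (twist_elt m) * t m \<in> bounded_series" "mconst c * a m \<in> bounded_series"
      by (rule bounded_mult[OF mconst_Hs[OF twist_elt(1)] t(1)], rule bounded_mult[OF mconst_Hs[OF c(1)] a'])
    from Rem_diff[OF z this] have "Rem m (mconst (twist_elt m) * t m) - Rem m (mconst c * a m) = 0"
      using Rem_level_span[OF z diff] by simp
    then have "mconst (twist_elt m) * Rem m (t m) = mconst c * Rem m (a m)"
      using Rem_mconst[OF z t(1)] Rem_mconst[OF z a'] by simp
    from arg_cong[OF this, of "\<lambda>f. mcoeff f n"]
    have eq: "twist_elt m * mcoeff (Rem m (t m)) n = c * mcoeff (Rem m (a m)) n" by simp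
    have "vge (mcoeff (Rem m (a m)) n) 0"
      using Rem_alpha[OF z a', of 0 m m n] a[of m]
      by (simp add: A0_iff alpha_sum_def level_cost_def alpha_const_def)
    then have "vge (twist_elt m * mcoeff (Rem m (t m)) n) r"
      unfolding eq by (simp add: vge_scale_iff[OF c(2)])
    then show "vge (mcoeff (Rem m (t m)) n) (r - level_cost h m)"
      by (simp add: vge_scale_iff[OF twist_elt(2)])
    assume mm': "m \<le> m'"
    have "t m' - Rem m' (t m') \<in> span0 m"
      using tR[of m'] level_span_antimono[OF z mm'] by blast
    from level_span_diff[OF z level_span_add[OF tR[of m] tt[OF mm']] this]
    moreover have "t m - Rem m (t m) + (t m' - t m) - (t m' - Rem m' (t m')) = Rem m' (t m') - Rem m (t m)"
      by (simp add: algebra_simps)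
    ultimately have "Rem m' (t m') - Rem m (t m) \<in> span0 m" by simp
    then show "Rem m' (t m') - Rem m (t m) \<in> level_span h m" using span0_subset by blast
  qed
  note r = this
  obtain \<delta> where \<delta>: "0 < \<delta>" "\<And>i. h i + \<delta> \<le> Er i" using gap by blast
  let ?f = "diagonal_limit (\<lambda>m. Rem m (t m))"
  have "s = level_classes ?f"
  proof
    fix m
    have "Rem m ?f = Rem m (t m)" by (rule Rem_diagonal_limit[OF r h_nonneg \<delta>(2,1)])
    have "s m = cl m (t m)" by (simp only: t(2))
    also have "\<dots> = cl m (Rem m (t m))" unfolding cl_eq_iff by (rule tR)
    also have "\<dots> = level_classes ?f m" by (simp only: level_classes_def \<open>Rem m ?f = Rem m (t m)\<close>)
    finally show "s m = level_classes ?f m" .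
  qed
  with diagonal_limit(1,2)[OF r h_nonneg \<delta>(2,1)] show ?thesis by (rule that)
qed

text \<open>By \<open>Rem_alpha\<close> the remainder of level \<open>m\<close>, multiplied by the twist, has valuation at least
  \<open>b - alpha_sum h\<close>. For \<open>r = 0\<close> and \<open>c = 1\<close> this is the first inclusion of the theorem.\<close>

lemma twist_classes:
  assumes f: "f \<in> Hs h" "bd h b f" and c: "c \<in> K" "ord c = ereal r" "r \<le> b - alpha_sum h"
  shows "\<exists>a. \<forall>m. a m \<in> carrier A0 \<and> twist p ord K u d e h (level_classes f) m = cl m (mconst c * a m)"
proof (intro exI allI conjI)
  fix m
  let ?a = "mconst (twist_elt m * inverse c) * Rem m f"
  have c0: "c \<noteq> 0" using c(2) by auto
  have "ord (twist_elt m * inverse c) = ereal (level_cost h m - r)"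
    using twist_elt(2) ord_inverse[OF c(2)] by (simp add: ord_mult)
  moreover have "vge (mcoeff (Rem m f) n) (r - level_cost h m)" for n
    using vge_mono[OF Rem_alpha[OF h_nonneg f, of m n]] c(3) by simp
  ultimately show "?a \<in> carrier A0"
    using Rem_bounded[OF f(1), of m] c(1) twist_elt(1)
    by (auto simp: A0_iff Hs_iff bd_def vge_scale_iff intro: K_mult K_inverse)
  have "mconst c * ?a = mconst (twist_elt m) * Rem m f"
    by (rule mfps_eqI) (simp add: c0)
  then show "twist p ord K u d e h (level_classes f) m = cl m (mconst c * ?a)"
    by (simp add: twist_eq level_classes_def lev_simps mconst_Hs twist_elt Rem_bounded f)
qed

lemma level_classes_inverse_limit:
  assumes f: "f \<in> Hs h" shows "level_classes f \<in> inverse_limit p ord K u d e"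
  unfolding inverse_limit_def
proof (intro CollectI conjI allI impI ballI)
  fix m m' :: "'k \<Rightarrow> nat" and t
  show "level_classes f m \<in> carrier (lev m)" using Rem_bounded[OF f] by (simp add: level_classes_def lev_simps)
  assume mm': "m \<le> m'" and t: "t \<in> level_classes f m'"
  then have t': "t - Rem m' f \<in> span0 m'" by (simp add: level_classes_def mem_cl_iff)
  then have "t - Rem m' f \<in> bounded_series" using level_span_subset_Hs[of "\<lambda>_. 0" m'] by auto
  from Hs_add[OF this Rem_bounded[OF f, of m']] have tb: "t \<in> bounded_series" by simp
  have "t \<in> cl m' t" by (rule self_mem_cl)
  have "cl m' t = level_classes f m'" using t' by (simp add: level_classes_def cl_eq_iff)
  then have "f - t \<in> level_span h m'" using cl_eq_level_classes_iff[OF f tb, of m'] by simp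
  then have "f - t \<in> level_span h m" using level_span_antimono[of h, OF h_nonneg mm'] by blast
  then show "level_classes f m = cl m t" using cl_eq_level_classes_iff[OF f tb, of m] by simp
qed

text \<open>The scalar \<open>0\<close> can be replaced by \<open>1\<close>, so that a real number measures the denominator.\<close>

lemma mem_bounded_families_iff:
  "s \<in> bounded_families p ord K u d e \<longleftrightarrow>
    (\<exists>c\<in>K. c \<noteq> 0 \<and> (\<exists>a. \<forall>m. a m \<in> carrier A0 \<and> s m = cl m (mconst c * a m)))" (is "_ \<longleftrightarrow> ?R")
proof
  assume "s \<in> bounded_families p ord K u d e"
  then obtain c s' where c: "c \<in> K" and s': "s = scale_family p ord K u d e (\<lambda>_. mconst c) s'"
    "s' \<in> integral_families p ord K u d e"
    unfolding bounded_families_def by blast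
  then obtain a where a: "\<And>m. a m \<in> carrier A0" and "\<And>m. s' m = cl m (a m)"
    unfolding integral_families_def by blast
  then have s: "s m = cl m (mconst c * a m)" for m
    using c s' A0_subset by (simp add: scale_family_def lev_simps mconst_Hs subset_iff)
  show ?R
  proof (cases "c = 0")
    case True
    have "mconst 0 * f = mconst 1 * 0" for f :: "('k, 'c) mfps" by (rule mfps_eqI) simp
    moreover have "0 \<in> carrier A0" by (simp add: A0_iff bd_def)
    ultimately show ?thesis using s True by (intro bexI[of _ 1] conjI exI[of _ "\<lambda>_. 0"]) auto
  qed (use c a s in blast)
next
  assume ?R
  then obtain c a where c: "c \<in> K" and a: "\<And>m. a m \<in> carrier A0"
    and s: "\<And>m. s m = cl m (mconst c * a m)" by blast
  have "(\<lambda>m. cl m (a m)) \<in> integral_families p ord K u d e"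
    unfolding integral_families_def by (intro CollectI exI[of _ a]) (simp add: a)
  moreover have "s = scale_family p ord K u d e (\<lambda>_. mconst c) (\<lambda>m. cl m (a m))"
    using a c s A0_subset by (auto simp: scale_family_def lev_simps mconst_Hs subset_iff)
  ultimately show "s \<in> bounded_families p ord K u d e"
    using c by (auto simp: bounded_families_def)
qed

lemma mconst_one_mult: "mconst 1 * f = (f :: ('k, 'c) mfps)"
  by (rule mfps_eqI) simp

lemma J_set_eq: "J_set p ord K u d e h = level_classes ` Hs h"
proof
  show "J_set p ord K u d e h \<subseteq> level_classes ` Hs h"
  proof
    fix s assume "s \<in> J_set p ord K u d e h"
    then obtain c a where s: "s \<in> inverse_limit p ord K u d e" and c: "c \<in> K" "c \<noteq> 0"
      and a: "\<And>m. a m \<in> carrier A0" "\<And>m. twist p ord K u d e h s m = cl m (mconst c * a m)"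
      by (auto simp: J_set_def mem_bounded_families_iff)
    obtain r where "ord c = ereal r"
      using c(2) ord_eq_infinity_iff[of c] ord_not_minus_infinity[of c] by (cases "ord c") auto
    from level_classes_surj[OF s c(1) this a] show "s \<in> level_classes ` Hs h" by blast
  qed
  show "level_classes ` Hs h \<subseteq> J_set p ord K u d e h"
  proof
    fix s assume "s \<in> level_classes ` Hs h"
    then obtain f where f: "f \<in> Hs h" and s: "s = level_classes f" by blast
    then obtain b where b: "bd h b f" by (auto elim: HsE)
    obtain N where N: "- (b - alpha_sum h) \<le> real N" using real_arch_simple by blast
    let ?c = "inverse (of_nat p ^ N) :: 'c"
    have "\<exists>a. \<forall>m. a m \<in> carrier A0 \<and> twist p ord K u d e h s m = cl m (mconst ?c * a m)"
      unfolding s by (rule twist_classes[OF f b inverse_p_power]) (use N in simp)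
    then have "twist p ord K u d e h s \<in> bounded_families p ord K u d e"
      unfolding mem_bounded_families_iff using inverse_p_power(1)[of N]
      by (intro bexI[of _ ?c] conjI) auto
    then show "s \<in> J_set p ord K u d e h"
      using level_classes_inverse_limit[OF f] by (simp add: J_set_def s)
  qed
qed

lemma J_set0_subset: "J_set0 p ord K u d e h \<subseteq> level_classes ` {f \<in> Hs h. bd h 0 f}"
proof
  fix s assume "s \<in> J_set0 p ord K u d e h"
  then obtain a where s: "s \<in> inverse_limit p ord K u d e"
    and a: "\<And>m. a m \<in> carrier A0" "\<And>m. twist p ord K u d e h s m = cl m (mconst 1 * a m)"
    by (auto simp: J_set0_def J_set_def integral_families_def mconst_one_mult)
  have "ord 1 = ereal 0" by (simp add: zero_ereal_def)
  from level_classes_surj[OF s K_1 this a] show "s \<in> level_classes ` {f \<in> Hs h. bd h 0 f}" by blast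
qed

lemma level_classes_J_set0:
  assumes f: "f \<in> Hs h" "bd h (alpha_sum h) f" shows "level_classes f \<in> J_set0 p ord K u d e h"
proof -
  have "ord 1 = ereal 0" by (simp add: zero_ereal_def)
  from twist_classes[OF f K_1 this] have "twist p ord K u d e h (level_classes f) \<in> integral_families p ord K u d e"
    by (simp add: integral_families_def mconst_one_mult)
  then show ?thesis using f(1) by (simp add: J_set0_def J_set_eq)
qed

lemma interpolates_classes_iff:
  assumes f: "f \<in> Hs h" shows "interpolates p ord K u d e h (level_classes f) g \<longleftrightarrow> g = f"
proof
  assume "interpolates p ord K u d e h (level_classes f) g"
  then have g: "g \<in> Hs h" and *: "\<And>m. g - Rem m f \<in> level_span h m"
    using self_mem_cl by (auto simp: interpolates_def Omega_H_eq h_nonneg level_classes_def)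
  have "cl m (Rem m f) = level_classes g m" for m
    using cl_eq_level_classes_iff[OF g Rem_bounded[OF f]] * by simp
  then have "level_classes f = level_classes g" by (simp add: level_classes_def)
  then show "g = f" using level_classes_inj f g by (simp add: inj_on_def)
next
  assume "g = f"
  have "f - t \<in> level_span h m" if "t \<in> level_classes f m" for t m
  proof -
    have "t - Rem m f \<in> level_span h m" using that span0_subset by (auto simp: level_classes_def mem_cl_iff)
    from level_span_diff[OF h_nonneg Rem_span[OF h_nonneg f, of m] this] show ?thesis by simp
  qed
  then show "interpolates p ord K u d e h (level_classes f) g"
    using f \<open>g = f\<close> by (simp add: interpolates_def Omega_H_eq h_nonneg)
qed

lemma interpolant_classes: "f \<in> Hs h \<Longrightarrow> interpolant p ord K u d e h (level_classes f) = f"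
  by (simp add: interpolant_def interpolates_classes_iff)

lemma J_module_simps [simp]:
  "carrier (J_module p ord K u d e h) = level_classes ` Hs h"
  "s \<oplus>\<^bsub>J_module p ord K u d e h\<^esub> t = (\<lambda>m. s m \<oplus>\<^bsub>lev m\<^esub> t m)"
  "\<zero>\<^bsub>J_module p ord K u d e h\<^esub> = (\<lambda>m. \<zero>\<^bsub>lev m\<^esub>)"
  "a \<odot>\<^bsub>J_module p ord K u d e h\<^esub> s = (\<lambda>m. cl m a \<otimes>\<^bsub>lev m\<^esub> s m)"
  by (simp_all add: J_module_def J_set_eq scale_family_def)

text \<open>The module structure of \<open>J\<close> is transported along the bijection \<open>level_classes\<close>.\<close>

lemma module_J_module: "module AK (J_module p ord K u d e h)"
proof -
  let ?J = "J_module p ord K u d e h"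
  have add: "level_classes f \<oplus>\<^bsub>?J\<^esub> level_classes g = level_classes (f + g)" if "f \<in> Hs h" "g \<in> Hs h" for f g
    using that by (simp add: level_classes_add fun_eq_iff)
  have smult: "a \<odot>\<^bsub>?J\<^esub> level_classes f = level_classes (a * f)" if "a \<in> bounded_series" "f \<in> Hs h" for a f
    using that by (simp add: level_classes_mult fun_eq_iff)
  have zero: "\<zero>\<^bsub>?J\<^esub> = level_classes 0" by (simp add: level_classes_zero fun_eq_iff)
  have carr: "carrier ?J = level_classes ` Hs h" by simp
  note J = add smult zero carr
  note closed = Hs_add Hs_mult[OF h_nonneg] Hs_uminus bounded_mult one_bounded
  have "abelian_group ?J"
  proof (rule abelian_groupI)
    fix x assume "x \<in> carrier ?J"
    then obtain f where "f \<in> Hs h" "x = level_classes f" by auto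
    then show "\<exists>y\<in>carrier ?J. y \<oplus>\<^bsub>?J\<^esub> x = \<zero>\<^bsub>?J\<^esub>"
      unfolding J by (intro bexI[of _ "level_classes (- f)"]) (auto simp only: J closed left_minus Hs_uminus imageI)
  qed (auto simp del: J_module_simps simp add: J closed add_ac)
  then show ?thesis
    by (rule moduleI[OF cring_AK])
      (auto simp del: J_module_simps simp add: J closed algebra_simps)
qed

lemma module_iso_interpolant:
  "module_iso AK (J_module p ord K u d e h) (H_module p ord K h) (interpolant p ord K u d e h)"
  unfolding module_iso_def
proof (intro conjI ballI)
  show "module AK (J_module p ord K u d e h)" by (rule module_J_module)
  show "module AK (H_module p ord K h)" by (rule module_H_module[OF h_nonneg])
  show "bij_betw (interpolant p ord K u d e h) (carrier (J_module p ord K u d e h)) (carrier (H_module p ord K h))"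
    by (rule bij_betw_byWitness[where f' = level_classes]) (auto simp: interpolant_classes)
next
  fix x y assume "x \<in> carrier (J_module p ord K u d e h)" "y \<in> carrier (J_module p ord K u d e h)"
  then obtain f g where fg: "f \<in> Hs h" "g \<in> Hs h" "x = level_classes f" "y = level_classes g" by auto
  then have "x \<oplus>\<^bsub>J_module p ord K u d e h\<^esub> y = level_classes (f + g)"
    by (simp add: level_classes_add fun_eq_iff)
  then show "interpolant p ord K u d e h (x \<oplus>\<^bsub>J_module p ord K u d e h\<^esub> y) =
      interpolant p ord K u d e h x \<oplus>\<^bsub>H_module p ord K h\<^esub> interpolant p ord K u d e h y"
    using fg by (simp only: interpolant_classes Hs_add H_module_simps)
next
  fix a x assume "a \<in> carrier AK" "x \<in> carrier (J_module p ord K u d e h)"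
  then obtain f where f: "a \<in> bounded_series" "f \<in> Hs h" "x = level_classes f" by auto
  then have "a \<odot>\<^bsub>J_module p ord K u d e h\<^esub> x = level_classes (a * f)"
    by (simp add: level_classes_mult fun_eq_iff)
  then show "interpolant p ord K u d e h (a \<odot>\<^bsub>J_module p ord K u d e h\<^esub> x) =
      a \<odot>\<^bsub>H_module p ord K h\<^esub> interpolant p ord K u d e h x"
    using f by (simp only: interpolant_classes Hs_mult[OF h_nonneg] H_module_simps)
qed

end

theorem theoremB:
  fixes p :: nat
    and ord :: "'c::{field_char_0, complete_space} \<Rightarrow> ereal"
    and K :: "'c set"
    and u :: "'k::finite \<Rightarrow> 'c"
    and h :: "'k \<Rightarrow> real"
    and d e :: "'k \<Rightarrow> int"
  assumes "padic_complex_field p ord"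
    and "subfield K ring_of_type_algebra" and "complete K"
    and "\<And>i. topological_generator (u i) (principal_units p ord)"
    and "\<And>i. ereal (h i) \<in> ord ` (valuation_ring ord K - {0})"
    and "d \<le> e"
    and "\<And>i. \<lfloor>h i\<rfloor> \<le> e i - d i"
  shows "(\<forall>s \<in> J_set p ord K u d e h. \<exists>!f. interpolates p ord K u d e h s f) \<and>
    module_iso (IwK ord K) (J_module p ord K u d e h) (H_module p ord K h)
      (interpolant p ord K u d e h) \<and>
    {f \<in> H_set p ord K h. ereal (\<Sum>i\<in>UNIV. real_of_int (alpha_const p (h i) (d i) (e i))) \<le> vH p ord h f}
      \<subseteq> interpolant p ord K u d e h ` J_set0 p ord K u d e h \<and>
    interpolant p ord K u d e h ` J_set0 p ord K u d e h
      \<subseteq> {f \<in> H_set p ord K h. ereal (\<Sum>i\<in>UNIV. real_of_int (beta_const p (h i))) \<le> vH p ord h f}"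
proof -
  interpret complete_subfield p ord K
    using assms(1-3) by (intro complete_subfield.intro complete_subfield_axioms.intro)
  have u: "u i \<in> K \<and> vge (u i - 1) 1" for i
  proof -
    from assms(4)[of i] obtain x where x: "u i = 1 + 2 * of_nat p * x" "x \<in> padic_integers ord"
      by (auto simp: topological_generator_def principal_units_def)
    then have "x \<in> K" "vge x 0"
      using padic_rationals_subset_K by (auto simp: padic_integers_def vge_def zero_ereal_def)
    moreover have "vge (of_nat (2 * p)) (real 1)" by (rule vge_of_nat_dvd) simp
    ultimately have "of_nat (2 * p) * x \<in> K" "vge (of_nat (2 * p) * x) 1"
      using vge_mult[of "of_nat (2 * p)" 1 x 0] K_mult[OF K_of_nat[of "2 * p"]] by simp_all
    moreover have "u i = 1 + of_nat (2 * p) * x" using x(1) by simp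
    ultimately show ?thesis using K_add[OF K_1] by simp
  qed
  interpret interpolation_points p ord K u d e
    by standard (use u assms(6) in \<open>auto simp: le_fun_def\<close>)
  have hv: "\<exists>c\<in>K. ord c = ereal (h i)" "0 \<le> h i" for i
  proof -
    from assms(5)[of i] obtain c where "ereal (h i) = ord c" "c \<in> valuation_ring ord K - {0}"
      by (rule imageE)
    then have "c \<in> K" "0 \<le> ord c" "ord c = ereal (h i)" by (simp_all add: valuation_ring_def)
    then show "\<exists>c\<in>K. ord c = ereal (h i)" "0 \<le> h i" by (auto simp: zero_ereal_def)
  qed
  have "h i < real (num_points i)" for i
    using assms(7)[of i] unfolding num_points_eq by linarith
  with hv interpret interpolation_problem p ord K u d e h
    by unfold_locales auto
  have beta: "(\<Sum>i\<in>UNIV. real_of_int (beta_const p (h i))) \<le> 0"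
  proof (intro sum_nonpos)
    fix i
    have "0 \<le> \<lfloor>max (h i) (real p / (real p - 1))\<rfloor>" using hv(2)[of i] by simp
    then have "- \<lfloor>max (h i) (real p / (real p - 1))\<rfloor> - 1 \<le> 0" by linarith
    then show "real_of_int (beta_const p (h i)) \<le> 0"
      unfolding beta_const_def of_int_le_0_iff by (simp only: split: if_split) blast
  qed
  show ?thesis
  proof (intro conjI)
    show "\<forall>s \<in> J_set p ord K u d e h. \<exists>!f. interpolates p ord K u d e h s f"
      by (auto simp: J_set_eq interpolates_classes_iff)
    show "module_iso (IwK ord K) (J_module p ord K u d e h) (H_module p ord K h) (interpolant p ord K u d e h)"
      by (rule module_iso_interpolant)
    show "{f \<in> H_set p ord K h. ereal (\<Sum>i\<in>UNIV. real_of_int (alpha_const p (h i) (d i) (e i))) \<le> vH p ord h f}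
        \<subseteq> interpolant p ord K u d e h ` J_set0 p ord K u d e h"
    proof
      fix f assume "f \<in> {f \<in> H_set p ord K h. ereal (\<Sum>i\<in>UNIV. real_of_int (alpha_const p (h i) (d i) (e i))) \<le> vH p ord h f}"
      then have f: "f \<in> Hs h" "bd h (alpha_sum h) f" by (simp_all add: le_vH_iff alpha_sum_def)
      show "f \<in> interpolant p ord K u d e h ` J_set0 p ord K u d e h"
        using level_classes_J_set0[OF f] interpolant_classes[OF f(1)] by (metis image_eqI)
    qed
    show "interpolant p ord K u d e h ` J_set0 p ord K u d e h
        \<subseteq> {f \<in> H_set p ord K h. ereal (\<Sum>i\<in>UNIV. real_of_int (beta_const p (h i))) \<le> vH p ord h f}"
    proof
      fix g assume "g \<in> interpolant p ord K u d e h ` J_set0 p ord K u d e h"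
      then obtain f where "f \<in> Hs h" "bd h 0 f" "g = f"
        using J_set0_subset interpolant_classes by fastforce
      then show "g \<in> {f \<in> H_set p ord K h. ereal (\<Sum>i\<in>UNIV. real_of_int (beta_const p (h i))) \<le> vH p ord h f}"
        using bd_mono[OF _ beta] by (simp add: le_vH_iff)
    qed
  qed
qed

end
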